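(* Let $\mathcal E$ be a tensor bundle $T^{k_1}_{k_2}(M)$ and let $\mathcal L$ be a minimally coupled, diffeomorphism invariant Lagrangian depending on a field with values in $\mathcal E$. Let $g$ be a slice-compatible Lorentzian metric on $M$ with $(n+1)$ decomposition $(h,N,X)$, let $T$ be a section of $\mathcal E$, let $B=\mathcal S(T;X)$, and suppose $\mathcal L$ is stationary at $T$. Let $\mathcal J$ be the momentum density of $\mathcal L$ (with matter field $T$ and metric $g$). Then for every slice $\Sigma_t$ and every compactly supported spatial vector field $\delta X$ on $\Sigma_t$, \[ \int_{\Sigma_t}\mathcal J(\delta X)\,dV_h=-\frac12\int_{\Sigma_t}\Pi_B(\mathcal L_{\delta X}B), \] where $\Pi_B$ is the momentum conjugate to $B$ evaluated at $(B,\partial_xB,\partial_tB,h,N,X,\partial_xX)$ on $\Sigma_t$.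
   Context: Setting: $M=\Sigma\times I$, where $\Sigma\subseteq\mathbb R^n$ is open with coordinates $x^1,\dots,x^n$ and $I\subseteq\mathbb R$ is an open interval with coordinate $t$; $\Sigma_t=\Sigma\times\{t\}$; $M$ carries a fixed orientation; all fields smooth; $\mathcal L_Y$ denotes Lie derivative. A tensor is spatial if it vanishes whenever one of its arguments is $dt$ or $\partial_t$. The projection $j_*$: $j_*dt=0$, $j_*dx^i=dx^i$, $j_*\partial_t=0$, $j_*\partial_{x^i}=\partial_{x^i}$, $j_*T(\cdot,\dots,\cdot)=T(j_*\cdot,\dots,j_*\cdot)$. A Lorentzian metric $g$ is slice compatible if its restriction to each $\Sigma_t$ is Riemannian; its unit normal $\nu$ satisfies $\nu(dt)>0$, $g(\nu,\nu)=-1$, $j_*g(\nu,\cdot)=0$; $\partial_t=N\nu+X$ with $X$ spatial defines lapse $N>0$ and shift $X$; with $h=j_*g$, $(h,N,X)$ is the $(n+1)$ decomposition, and $g(h,N,X)=-N^2dt^2+h_{ab}(dx^a+X^adt)(dx^b+X^bdt)$. $dV_g$ is the positive volume form and $dV_h=N^{-1}\partial_t\lrcorner dV_g$. Decomposition of tensors: for a spatial vector field $X$, let $\mathcal P_X(a\partial_t+W)=aX+W$ ($W$ spatial) and let $\mathcal P_X^*$ be its adjoint on 1-forms. For a tensor $T$ of rank $k$, one obtains $2^k$ spatial tensors by choosing, for each slot taking a vector, either to insert $\partial_t-X$ or to precompose with $j_*$, and for each slot taking a covector, either to insert $dt$ or to precompose with $\mathcal P_X^*$ (e.g. $b\,dt+\eta\mapsto(b-\eta(X),\eta)$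 and $a\partial_t+W\mapsto(a,W+aX)$). In a fixed order these form the tuple $\mathcal S(T;X)$, a decomposed tensor (of the unified type of $T$); $\mathcal S(\cdot;X)$ is invertible with inverse $\mathcal S^{-1}(\cdot;X)$. Lie derivatives, $j_*$, pullbacks and contractions act on decomposed tensors componentwise. Lagrangian: a minimally coupled Lagrangian depending on a field with values in $\mathcal E$ is a smooth bundle map $\mathcal L:\mathcal E\oplus(\mathcal E\oplus\cdots\oplus\mathcal E)\oplus G(M)\to\Lambda^{n+1}(M)$ ($n+1$ copies in the middle, $G(M)$ the Lorentzian metrics); for a section $T$ and $g$ it gives $\mathcal L(T,\partial T,g)$, $\partial T=(\mathcal L_{\partial_{x^1}}T,\dots,\mathcal L_{\partial_{x^n}}T,\mathcal L_{\partial_t}T)$. It is diffeomorphism invariant if $\Psi^*\mathcal L(T,\partial T,g)=\mathcal L(\Psi^*T,\partial(\Psi^*T),\Psi^*g)$ on $U_1$ for every orientation-preserving diffeomorphism $\Psi$ from an open $U_1\subseteq M$ onto an open $U_2\subseteq M$ and all $T,g$ on $U_2$. It is stationary at $T$ if for every smooth path $T_s$ with $T_0=T$ and $\frac{d}{ds}|_{s=0}T_s$ compactly supported, $\int_M\frac{d}{ds}|_{s=0}\mathcal L(T_s,\partial T_s,g)=0$. The slice Lagrangian: for decomposed tensors $B$ (and its derivatives) and shift $X$ defined near a point, $L_\Sigma(B,\partial_xB,\partial_tB,h,N,X,\partial_xX,\partial_tX)=\partial_t\lrcorner\mathcal L(\mathcal S^{-1}(B;X),\partial\mathcal S^{-1}(B;X),g(h,N,X))$,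 where $\partial_x$ denotes the tuple of $\mathcal L_{\partial_{x^i}}$ and $\partial_t=\mathcal L_{\partial_t}$ (for pointwise arguments one uses any local extensions with the given values and derivatives; the result is independent of the extension). The momentum conjugate to $B$ is $\Pi_B=\partial L_\Sigma/\partial\dot B$ (linearization in the $\partial_tB$-slot); it is a tuple of dual-tensor-valued spatial $n$-forms $(B_j^*\omega)$ and $\Pi_B(\delta B)=\sum_jB_j^*(\delta B_j)\omega$ (tensor contraction). Momentum density: the stress-energy tensor $T^{\mathrm{SE}}$ is defined by $T^{\mathrm{SE}}dV_g=-\partial\mathcal L/\partial g^{-1}$ (pointwise, matter field fixed), and $\mathcal J=-j_*T^{\mathrm{SE}}(\nu,\cdot)$. *)

theory Defs
  imports "HOL-Analysis.Analysis"
begin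

text \<open>Spatial directions are the elements of a finite type 'n; spacetime directions are
  'n option, with None standing for the time direction t.  Points of spacetime are
  vectors in real^('n option).\<close>

type_synonym 'n pt = "real ^ ('n option)"
text \<open>tensor values: components T^{us}_{ls} (us = contravariant, ls = covariant indices)\<close>
type_synonym 'n ten = "'n option list \<Rightarrow> 'n option list \<Rightarrow> real"
text \<open>decomposed tensors: a spatial tensor for every choice (normal/spatial) of every slot\<close>
type_synonym 'n dten = "bool list \<Rightarrow> bool list \<Rightarrow> 'n ten"
type_synonym 'n lagr =
  "'n pt \<Rightarrow> 'n ten \<Rightarrow> ('n option \<Rightarrow> 'n ten) \<Rightarrow> ('n option \<Rightarrow> 'n option \<Rightarrow> real) \<Rightarrow> real"

definition mk :: "real ^ ('n::finite) \<Rightarrow> real \<Rightarrow> 'n pt" where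
  "mk x t = (\<chi> a. case a of None \<Rightarrow> t | Some i \<Rightarrow> x $ i)"

definition Mset :: "(real ^ ('n::finite)) set \<Rightarrow> real set \<Rightarrow> 'n pt set" where
  "Mset S I = {p. (\<chi> i. p $ Some i) \<in> S \<and> p $ None \<in> I}"

definition pdir :: "'a::real_normed_vector \<Rightarrow> ('a \<Rightarrow> real) \<Rightarrow> 'a \<Rightarrow> real" where
  "pdir v f p = frechet_derivative f (at p) v"

fun itpd :: "'a::real_normed_vector list \<Rightarrow> ('a \<Rightarrow> real) \<Rightarrow> 'a \<Rightarrow> real" where
  "itpd [] f = f"
| "itpd (v # vs) f = pdir v (itpd vs f)"

definition Csmooth_on :: "'a::euclidean_space set \<Rightarrow> ('a \<Rightarrow> real) \<Rightarrow> bool" where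
  "Csmooth_on U f \<longleftrightarrow> (\<forall>vs. set vs \<subseteq> Basis \<longrightarrow> itpd vs f differentiable_on U)"

definition pd :: "('n::finite) option \<Rightarrow> ('n pt \<Rightarrow> real) \<Rightarrow> 'n pt \<Rightarrow> real" where
  "pd a f p = pdir (axis a 1) f p"

definition spd :: "('n::finite) \<Rightarrow> (real ^ 'n \<Rightarrow> real) \<Rightarrow> real ^ 'n \<Rightarrow> real" where
  "spd i f x = pdir (axis i 1) f x"

definition tenvals :: "nat \<Rightarrow> nat \<Rightarrow> ('n::finite) ten set" where
  "tenvals k1 k2 = {\<tau>. \<forall>us ls. \<not> (length us = k1 \<and> length ls = k2) \<longrightarrow> \<tau> us ls = 0}"

definition tfield :: "nat \<Rightarrow> nat \<Rightarrow> ('n::finite) pt set \<Rightarrow> ('n pt \<Rightarrow> 'n ten) \<Rightarrow> bool" where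
  "tfield k1 k2 U T \<longleftrightarrow> (\<forall>p. T p \<in> tenvals k1 k2) \<and>
      (\<forall>us ls. Csmooth_on U (\<lambda>p. T p us ls))"

text \<open>the tuple \<partial>T = (L_{\<partial>_a} T)_a of coordinate Lie derivatives\<close>
definition dT :: "(('n::finite) pt \<Rightarrow> 'n ten) \<Rightarrow> 'n pt \<Rightarrow> ('n option \<Rightarrow> 'n ten)" where
  "dT T p = (\<lambda>a us ls. pd a (\<lambda>q. T q us ls) p)"

definition toM :: "(('n::finite) option \<Rightarrow> 'n option \<Rightarrow> real) \<Rightarrow> real ^ 'n option ^ 'n option" where
  "toM gv = (\<chi> a b. gv a b)"

definition fromM :: "real ^ ('n::finite) option ^ 'n option \<Rightarrow> ('n option \<Rightarrow> 'n option \<Rightarrow> real)" where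
  "fromM m = (\<lambda>a b. m $ a $ b)"

definition qf :: "(('n::finite) option \<Rightarrow> 'n option \<Rightarrow> real) \<Rightarrow> ('n option \<Rightarrow> real) \<Rightarrow> real" where
  "qf gv v = (\<Sum>a\<in>UNIV. \<Sum>b\<in>UNIV. gv a b * v a * v b)"

text \<open>Lorentzian: symmetric, nondegenerate, of index exactly 1 (there is a timelike
  vector and no 2-dimensional negative definite subspace)\<close>
definition lorentzian :: "(('n::finite) option \<Rightarrow> 'n option \<Rightarrow> real) \<Rightarrow> bool" where
  "lorentzian gv \<longleftrightarrow> (\<forall>a b. gv a b = gv b a) \<and> det (toM gv) \<noteq> 0 \<and>
     (\<exists>v. qf gv v < 0) \<and>
     \<not> (\<exists>v w. \<forall>\<alpha> \<beta>::real. (\<alpha>, \<beta>) \<noteq> (0, 0) \<longrightarrow> qf gv (\<lambda>a. \<alpha> * v a + \<beta> * w a) < 0)"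

definition riemannian :: "(('n::finite) \<Rightarrow> 'n \<Rightarrow> real) \<Rightarrow> bool" where
  "riemannian hv \<longleftrightarrow> (\<forall>i j. hv i j = hv j i) \<and>
     (\<forall>v. v \<noteq> (\<lambda>_. 0) \<longrightarrow> (\<Sum>i\<in>UNIV. \<Sum>j\<in>UNIV. hv i j * v i * v j) > 0)"

definition lor_metric :: "('n::finite) pt set \<Rightarrow> ('n pt \<Rightarrow> 'n option \<Rightarrow> 'n option \<Rightarrow> real) \<Rightarrow> bool" where
  "lor_metric U g \<longleftrightarrow> (\<forall>a b. Csmooth_on U (\<lambda>p. g p a b)) \<and> (\<forall>p\<in>U. lorentzian (g p))"

definition slice_compatible :: "('n::finite) pt set \<Rightarrow> ('n pt \<Rightarrow> 'n option \<Rightarrow> 'n option \<Rightarrow> real) \<Rightarrow> bool" where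
  "slice_compatible M g \<longleftrightarrow> lor_metric M g \<and>
     (\<forall>p\<in>M. riemannian (\<lambda>i j. g p (Some i) (Some j)))"

definition is_unit_normal :: "(('n::finite) option \<Rightarrow> 'n option \<Rightarrow> real) \<Rightarrow> ('n option \<Rightarrow> real) \<Rightarrow> bool" where
  "is_unit_normal gv \<nu> \<longleftrightarrow> \<nu> None > 0 \<and> qf gv \<nu> = -1 \<and>
     (\<forall>i. (\<Sum>a\<in>UNIV. gv a (Some i) * \<nu> a) = 0)"

definition nu :: "(('n::finite) option \<Rightarrow> 'n option \<Rightarrow> real) \<Rightarrow> ('n option \<Rightarrow> real)" where
  "nu gv = (THE \<nu>. is_unit_normal gv \<nu>)"

definition decomp :: "('n::finite) pt set \<Rightarrow> ('n pt \<Rightarrow> 'n option \<Rightarrow> 'n option \<Rightarrow> real) \<Rightarrow>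
    ('n pt \<Rightarrow> 'n \<Rightarrow> 'n \<Rightarrow> real) \<Rightarrow> ('n pt \<Rightarrow> real) \<Rightarrow> ('n pt \<Rightarrow> real ^ 'n) \<Rightarrow> bool" where
  "decomp M g h N X \<longleftrightarrow> (\<forall>p\<in>M. h p = (\<lambda>i j. g p (Some i) (Some j)) \<and> N p > 0 \<and>
     (\<forall>a. (case a of None \<Rightarrow> 1 | Some i \<Rightarrow> 0) =
          N p * nu (g p) a + (case a of None \<Rightarrow> 0 | Some i \<Rightarrow> X p $ i)))"

text \<open>g(h,N,X) = -N^2 dt^2 + h_ab (dx^a + X^a dt)(dx^b + X^b dt)\<close>
definition gHNX :: "(('n::finite) \<Rightarrow> 'n \<Rightarrow> real) \<Rightarrow> real \<Rightarrow> real ^ 'n \<Rightarrow> ('n option \<Rightarrow> 'n option \<Rightarrow> real)" where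
  "gHNX hv Nv Xv a b = (case (a, b) of
      (None, None) \<Rightarrow> - Nv\<^sup>2 + (\<Sum>i\<in>UNIV. \<Sum>j\<in>UNIV. hv i j * Xv $ i * Xv $ j)
    | (None, Some j) \<Rightarrow> (\<Sum>i\<in>UNIV. hv i j * Xv $ i)
    | (Some i, None) \<Rightarrow> (\<Sum>j\<in>UNIV. hv i j * Xv $ j)
    | (Some i, Some j) \<Rightarrow> hv i j)"

text \<open>Top forms are represented by their coefficient w.r.t. a fixed constant reference
  (n+1)-form e with |e(\<partial>_1,...,\<partial>_n,\<partial>_t)| = 1; spatial n-forms by their coefficient w.r.t.
  \<epsilon> = \<partial>_t \<lrcorner> e.  An orientation of M is a locally constant sign ori (ori p = 1 iff e is
  positively oriented at p).\<close>
definition orientation :: "('n::finite) pt set \<Rightarrow> ('n pt \<Rightarrow> real) \<Rightarrow> bool" where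
  "orientation M ori \<longleftrightarrow> (\<forall>p\<in>M. ori p = 1 \<or> ori p = -1) \<and> continuous_on M ori"

definition jac :: "(('n::finite) pt \<Rightarrow> 'n pt) \<Rightarrow> 'n pt \<Rightarrow> real ^ 'n option ^ 'n option" where
  "jac \<Psi> p = (\<chi> c a. pd a (\<lambda>q. \<Psi> q $ c) p)"

definition diffeo :: "('n::finite) pt set \<Rightarrow> 'n pt set \<Rightarrow> ('n pt \<Rightarrow> 'n pt) \<Rightarrow> bool" where
  "diffeo U1 U2 \<Psi> \<longleftrightarrow> open U1 \<and> open U2 \<and> bij_betw \<Psi> U1 U2 \<and>
     (\<forall>c. Csmooth_on U1 (\<lambda>p. \<Psi> p $ c)) \<and>
     (\<exists>\<Phi>. (\<forall>q\<in>U2. \<Phi> q \<in> U1 \<and> \<Psi> (\<Phi> q) = q) \<and> (\<forall>c. Csmooth_on U2 (\<lambda>q. \<Phi> q $ c)))"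

definition or_pres :: "(('n::finite) pt \<Rightarrow> real) \<Rightarrow> 'n pt set \<Rightarrow> ('n pt \<Rightarrow> 'n pt) \<Rightarrow> bool" where
  "or_pres ori U1 \<Psi> \<longleftrightarrow> (\<forall>p\<in>U1. ori (\<Psi> p) * det (jac \<Psi> p) * ori p > 0)"

definition lists_len :: "nat \<Rightarrow> ('n::finite) option list set" where
  "lists_len k = {xs. length xs = k}"

definition pbT :: "nat \<Rightarrow> nat \<Rightarrow> (('n::finite) pt \<Rightarrow> 'n pt) \<Rightarrow> ('n pt \<Rightarrow> 'n ten) \<Rightarrow> 'n pt \<Rightarrow> 'n ten" where
  "pbT k1 k2 \<Psi> T p us ls = (if length us = k1 \<and> length ls = k2 then
     (\<Sum>cs\<in>lists_len k1. \<Sum>ds\<in>lists_len k2. T (\<Psi> p) cs ds *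
        (\<Prod>i<k1. matrix_inv (jac \<Psi> p) $ (us ! i) $ (cs ! i)) *
        (\<Prod>j<k2. jac \<Psi> p $ (ds ! j) $ (ls ! j)))
     else 0)"

definition pbg :: "(('n::finite) pt \<Rightarrow> 'n pt) \<Rightarrow> ('n pt \<Rightarrow> 'n option \<Rightarrow> 'n option \<Rightarrow> real) \<Rightarrow>
    'n pt \<Rightarrow> 'n option \<Rightarrow> 'n option \<Rightarrow> real" where
  "pbg \<Psi> g p a b = (\<Sum>c\<in>UNIV. \<Sum>d\<in>UNIV. g (\<Psi> p) c d * jac \<Psi> p $ c $ a * jac \<Psi> p $ d $ b)"

text \<open>coordinates of the fibre of the bundle E + (E+...+E) + G(M), together with the base point\<close>
datatype 'n jc = JP "'n option" | JT "'n option list" "'n option list"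
  | JD "'n option" "'n option list" "'n option list" | JG "'n option" "'n option"

definition cpd :: "'c \<Rightarrow> (('c \<Rightarrow> real) \<Rightarrow> real) \<Rightarrow> ('c \<Rightarrow> real) \<Rightarrow> real" where
  "cpd c F v = deriv (\<lambda>s. F (v(c := v c + s))) 0"

fun itcpd :: "'c list \<Rightarrow> (('c \<Rightarrow> real) \<Rightarrow> real) \<Rightarrow> ('c \<Rightarrow> real) \<Rightarrow> real" where
  "itcpd [] F = F"
| "itcpd (c # cs) F = cpd c (itcpd cs F)"

definition ccont_on :: "'c set \<Rightarrow> ('c \<Rightarrow> real) set \<Rightarrow> (('c \<Rightarrow> real) \<Rightarrow> real) \<Rightarrow> bool" where
  "ccont_on C U G \<longleftrightarrow> (\<forall>v\<in>U. \<forall>e>0. \<exists>d>0. \<forall>w\<in>U. (\<forall>c\<in>C. \<bar>w c - v c\<bar> < d) \<longrightarrow> \<bar>G w - G v\<bar> < e)"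

definition csmooth :: "'c set \<Rightarrow> ('c \<Rightarrow> real) set \<Rightarrow> (('c \<Rightarrow> real) \<Rightarrow> real) \<Rightarrow> bool" where
  "csmooth C U F \<longleftrightarrow> finite C \<and> (\<forall>cs. set cs \<subseteq> C \<longrightarrow> ccont_on C U (itcpd cs F) \<and>
     (\<forall>c\<in>C. \<forall>v\<in>U. (\<lambda>s. itcpd cs F (v(c := v c + s))) differentiable (at 0)))"

definition jcoords :: "nat \<Rightarrow> nat \<Rightarrow> ('n::finite) jc set" where
  "jcoords k1 k2 = range JP \<union> {JT us ls |us ls. length us = k1 \<and> length ls = k2}
     \<union> {JD a us ls |a us ls. length us = k1 \<and> length ls = k2} \<union> {JG a b |a b. True}"

definition jet_lag :: "nat \<Rightarrow> nat \<Rightarrow> ('n::finite) lagr \<Rightarrow> ('n jc \<Rightarrow> real) \<Rightarrow> real" where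
  "jet_lag k1 k2 L v = L (\<chi> a. v (JP a))
     (\<lambda>us ls. if length us = k1 \<and> length ls = k2 then v (JT us ls) else 0)
     (\<lambda>a us ls. if length us = k1 \<and> length ls = k2 then v (JD a us ls) else 0)
     (\<lambda>a b. (v (JG a b) + v (JG b a)) / 2)"

text \<open>a minimally coupled Lagrangian: smooth bundle map on M x E x E^{n+1} x G(M)\<close>
definition lagrangian :: "('n::finite) pt set \<Rightarrow> nat \<Rightarrow> nat \<Rightarrow> 'n lagr \<Rightarrow> bool" where
  "lagrangian M k1 k2 L \<longleftrightarrow> csmooth (jcoords k1 k2)
     {v. (\<chi> a. v (JP a)) \<in> M \<and> lorentzian (\<lambda>a b. (v (JG a b) + v (JG b a)) / 2)}
     (jet_lag k1 k2 L)"

definition diffeo_invariant :: "('n::finite) pt set \<Rightarrow> ('n pt \<Rightarrow> real) \<Rightarrow> nat \<Rightarrow> nat \<Rightarrow> 'n lagr \<Rightarrow> bool" where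
  "diffeo_invariant M ori k1 k2 L \<longleftrightarrow>
     (\<forall>U1 U2 \<Psi> T g. U1 \<subseteq> M \<and> U2 \<subseteq> M \<and> diffeo U1 U2 \<Psi> \<and> or_pres ori U1 \<Psi> \<and>
        tfield k1 k2 U2 T \<and> lor_metric U2 g \<longrightarrow>
        (\<forall>p\<in>U1. det (jac \<Psi> p) * L (\<Psi> p) (T (\<Psi> p)) (dT T (\<Psi> p)) (g (\<Psi> p)) =
                L p (pbT k1 k2 \<Psi> T p) (dT (pbT k1 k2 \<Psi> T) p) (pbg \<Psi> g p)))"

definition intM :: "('n::finite) pt set \<Rightarrow> ('n pt \<Rightarrow> real) \<Rightarrow> ('n pt \<Rightarrow> real) \<Rightarrow> real" where
  "intM M ori w = integral M (\<lambda>p. ori p * w p)"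

text \<open>integral of a spatial n-form over \<Sigma>_t, \<Sigma>_t oriented so that \<partial>_t \<lrcorner> (positive form) is positive\<close>
definition intSlice :: "(real ^ ('n::finite)) set \<Rightarrow> real \<Rightarrow> ('n pt \<Rightarrow> real) \<Rightarrow> (real ^ 'n \<Rightarrow> real) \<Rightarrow> real" where
  "intSlice S t ori w = integral S (\<lambda>x. ori (mk x t) * w x)"

definition smooth_path :: "('n::finite) pt set \<Rightarrow> nat \<Rightarrow> nat \<Rightarrow> (real \<Rightarrow> 'n pt \<Rightarrow> 'n ten) \<Rightarrow> bool" where
  "smooth_path M k1 k2 Ts \<longleftrightarrow> (\<forall>s p. Ts s p \<in> tenvals k1 k2) \<and>
     (\<forall>us ls. Csmooth_on (UNIV \<times> M) (\<lambda>(s, p). Ts s p us ls))"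

definition stationary :: "('n::finite) pt set \<Rightarrow> ('n pt \<Rightarrow> real) \<Rightarrow> nat \<Rightarrow> nat \<Rightarrow> 'n lagr \<Rightarrow>
    ('n pt \<Rightarrow> 'n option \<Rightarrow> 'n option \<Rightarrow> real) \<Rightarrow> ('n pt \<Rightarrow> 'n ten) \<Rightarrow> bool" where
  "stationary M ori k1 k2 L g T \<longleftrightarrow>
     (\<forall>Ts. smooth_path M k1 k2 Ts \<and> (\<forall>p\<in>M. Ts 0 p = T p) \<and>
        (\<exists>K. compact K \<and> K \<subseteq> M \<and>
           (\<forall>p\<in>M - K. \<forall>us ls. deriv (\<lambda>s. Ts s p us ls) 0 = 0)) \<longrightarrow>
        intM M ori (\<lambda>p. deriv (\<lambda>s. L p (Ts s p) (dT (Ts s) p) (g p)) 0) = 0)"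

definition pxco :: "real ^ ('n::finite) \<Rightarrow> 'n option \<Rightarrow> 'n option \<Rightarrow> real" where
  "pxco Xv i a = (case i of None \<Rightarrow> 0
     | Some j \<Rightarrow> (if a = Some j then 1 else if a = None then Xv $ j else 0))"

text \<open>covectors inserted in the contravariant slots: dt (True) or P_X^* dx^j (False)\<close>
fun upco :: "real ^ ('n::finite) \<Rightarrow> bool list \<Rightarrow> 'n option list \<Rightarrow> ('n option \<Rightarrow> real) list" where
  "upco Xv [] is = []"
| "upco Xv (True # cs) is = (\<lambda>a. if a = None then 1 else 0) # upco Xv cs is"
| "upco Xv (False # cs) (i # is) = pxco Xv i # upco Xv cs is"
| "upco Xv (False # cs) [] = (\<lambda>a. 0) # upco Xv cs []"

text \<open>vectors inserted in the covariant slots: \<partial>_t - X (True) or j_* \<partial>_j (False)\<close>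
fun lowv :: "real ^ ('n::finite) \<Rightarrow> bool list \<Rightarrow> 'n option list \<Rightarrow> ('n option \<Rightarrow> real) list" where
  "lowv Xv [] is = []"
| "lowv Xv (True # cs) is = (\<lambda>b. case b of None \<Rightarrow> 1 | Some m \<Rightarrow> - Xv $ m) # lowv Xv cs is"
| "lowv Xv (False # cs) (i # is) =
     (\<lambda>b. case i of None \<Rightarrow> 0 | Some j \<Rightarrow> (if b = Some j then 1 else 0)) # lowv Xv cs is"
| "lowv Xv (False # cs) [] = (\<lambda>b. 0) # lowv Xv cs []"

definition contract :: "nat \<Rightarrow> nat \<Rightarrow> ('n::finite) ten \<Rightarrow> ('n option \<Rightarrow> real) list \<Rightarrow> ('n option \<Rightarrow> real) list \<Rightarrow> real" where
  "contract k1 k2 \<tau> \<theta>s vs = (\<Sum>as\<in>lists_len k1. \<Sum>bs\<in>lists_len k2.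
      \<tau> as bs * (\<Prod>i<k1. (\<theta>s ! i) (as ! i)) * (\<Prod>j<k2. (vs ! j) (bs ! j)))"

definition Sdec :: "nat \<Rightarrow> nat \<Rightarrow> real ^ ('n::finite) \<Rightarrow> 'n ten \<Rightarrow> 'n dten" where
  "Sdec k1 k2 Xv \<tau> cu cl us ls = (if length cu = k1 \<and> length cl = k2 \<and>
        length us = count_list cu False \<and> length ls = count_list cl False
     then contract k1 k2 \<tau> (upco Xv cu us) (lowv Xv cl ls) else 0)"

definition Sinv :: "nat \<Rightarrow> nat \<Rightarrow> real ^ ('n::finite) \<Rightarrow> 'n dten \<Rightarrow> 'n ten" where
  "Sinv k1 k2 Xv B = inv_into (tenvals k1 k2) (Sdec k1 k2 Xv) B"

text \<open>L_\<Sigma> evaluated along fields B, h, N, X (coefficient w.r.t. \<epsilon> = \<partial>_t \<lrcorner> e)\<close>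
definition LSig :: "nat \<Rightarrow> nat \<Rightarrow> ('n::finite) lagr \<Rightarrow> ('n pt \<Rightarrow> 'n \<Rightarrow> 'n \<Rightarrow> real) \<Rightarrow> ('n pt \<Rightarrow> real) \<Rightarrow>
    ('n pt \<Rightarrow> real ^ 'n) \<Rightarrow> ('n pt \<Rightarrow> 'n dten) \<Rightarrow> 'n pt \<Rightarrow> real" where
  "LSig k1 k2 L h N X B p =
     (let Tf = (\<lambda>q. Sinv k1 k2 (X q) (B q)) in L p (Tf p) (dT Tf p) (gHNX (h p) (N p) (X p)))"

text \<open>\<Pi>_B(\<delta>) at p: linearisation of L_\<Sigma> in the \<partial>_t B slot, realised by the local extension
  B + \<epsilon> (t - t_p) \<delta> (same value and spatial derivatives at p, \<partial>_t B shifted by \<epsilon> \<delta>)\<close>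
definition PiB :: "nat \<Rightarrow> nat \<Rightarrow> ('n::finite) lagr \<Rightarrow> ('n pt \<Rightarrow> 'n \<Rightarrow> 'n \<Rightarrow> real) \<Rightarrow> ('n pt \<Rightarrow> real) \<Rightarrow>
    ('n pt \<Rightarrow> real ^ 'n) \<Rightarrow> ('n pt \<Rightarrow> 'n dten) \<Rightarrow> 'n pt \<Rightarrow> 'n dten \<Rightarrow> real" where
  "PiB k1 k2 L h N X B p \<delta> = deriv (\<lambda>\<epsilon>. LSig k1 k2 L h N X
      (\<lambda>q cu cl us ls. B q cu cl us ls + \<epsilon> * (q $ None - p $ None) * \<delta> cu cl us ls) p) 0"

definition sLie :: "(real ^ ('n::finite) \<Rightarrow> real ^ 'n) \<Rightarrow> (real ^ 'n \<Rightarrow> 'n ten) \<Rightarrow> real ^ 'n \<Rightarrow> 'n ten" where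
  "sLie Y S x us ls = (if None \<notin> set us \<and> None \<notin> set ls then
       (\<Sum>c\<in>UNIV. Y x $ c * spd c (\<lambda>y. S y us ls) x)
     - (\<Sum>i<length us. \<Sum>c\<in>UNIV. S x (us[i := Some c]) ls * spd c (\<lambda>y. Y y $ the (us ! i)) x)
     + (\<Sum>j<length ls. \<Sum>c\<in>UNIV. S x us (ls[j := Some c]) * spd (the (ls ! j)) (\<lambda>y. Y y $ c) x)
     else 0)"

definition dLie :: "(real ^ ('n::finite) \<Rightarrow> real ^ 'n) \<Rightarrow> (real ^ 'n \<Rightarrow> 'n dten) \<Rightarrow> real ^ 'n \<Rightarrow> 'n dten" where
  "dLie Y B x = (\<lambda>cu cl. sLie Y (\<lambda>y. B y cu cl) x)"

definition Esym :: "('n::finite) option \<Rightarrow> 'n option \<Rightarrow> real ^ 'n option ^ 'n option" where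
  "Esym a b = (\<chi> c d. ((if c = a \<and> d = b then 1 else 0) + (if c = b \<and> d = a then 1 else 0)) / 2)"

definition dLdginv :: "('n::finite) lagr \<Rightarrow> 'n pt \<Rightarrow> 'n ten \<Rightarrow> ('n option \<Rightarrow> 'n ten) \<Rightarrow>
    ('n option \<Rightarrow> 'n option \<Rightarrow> real) \<Rightarrow> 'n option \<Rightarrow> 'n option \<Rightarrow> real" where
  "dLdginv L p \<tau> d\<tau> gv a b =
     deriv (\<lambda>\<epsilon>. L p \<tau> d\<tau> (fromM (matrix_inv (matrix_inv (toM gv) + \<epsilon> *\<^sub>R Esym a b)))) 0"

text \<open>coefficient of dV_g w.r.t. e (positive volume form for orientation o)\<close>
definition dVg :: "(('n::finite) pt \<Rightarrow> real) \<Rightarrow> ('n pt \<Rightarrow> 'n option \<Rightarrow> 'n option \<Rightarrow> real) \<Rightarrow> 'n pt \<Rightarrow> real" where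
  "dVg ori g p = ori p * sqrt \<bar>det (toM (g p))\<bar>"

definition TSE :: "('n::finite) lagr \<Rightarrow> ('n pt \<Rightarrow> real) \<Rightarrow> ('n pt \<Rightarrow> 'n option \<Rightarrow> 'n option \<Rightarrow> real) \<Rightarrow>
    ('n pt \<Rightarrow> 'n ten) \<Rightarrow> 'n pt \<Rightarrow> 'n option \<Rightarrow> 'n option \<Rightarrow> real" where
  "TSE L ori g T p a b = - dLdginv L p (T p) (dT T p) (g p) a b / dVg ori g p"

definition Jmom :: "('n::finite) lagr \<Rightarrow> ('n pt \<Rightarrow> real) \<Rightarrow> ('n pt \<Rightarrow> 'n option \<Rightarrow> 'n option \<Rightarrow> real) \<Rightarrow>
    ('n pt \<Rightarrow> 'n ten) \<Rightarrow> 'n pt \<Rightarrow> real ^ 'n \<Rightarrow> real" where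
  "Jmom L ori g T p w = - (\<Sum>a\<in>UNIV. \<Sum>i\<in>UNIV. TSE L ori g T p a (Some i) * nu (g p) a * w $ i)"

text \<open>dV_h = N^{-1} \<partial>_t \<lrcorner> dV_g (coefficient w.r.t. \<epsilon>)\<close>
definition dVh :: "(('n::finite) pt \<Rightarrow> real) \<Rightarrow> ('n pt \<Rightarrow> 'n option \<Rightarrow> 'n option \<Rightarrow> real) \<Rightarrow> ('n pt \<Rightarrow> real) \<Rightarrow> 'n pt \<Rightarrow> real" where
  "dVh ori g N p = dVg ori g p / N p"

end

theory Submission
  imports Defs "HOL-Computational_Algebra.Polynomial"
begin

text \<open>The proof never uses a flow. A point \<open>p\<close> is kept fixed by explicit diffeomorphisms whose generator
  is \<open>(t - t\<^sub>p)\<close> times an affine spatial vector field \<open>W\<close>. Differentiating diffeomorphism invariance along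
  such a family gives, for \<open>A\<^sub>i T\<close> the action of \<open>\<partial>\<^sub>i \<otimes> dt\<close> on \<open>T\<close> and \<open>\<pi>\<close> the derivative of the Lagrangian
  in the slot \<open>\<partial>\<^sub>t T\<close>, the pointwise identity that the linearized Lagrangian at the variation \<open>W\<^sup>i A\<^sub>i T\<close>
  equals \<open>- \<pi>(L\<^sub>W T) - W\<^sup>i m\<^sub>i\<close> with \<open>m\<close> twice the momentum density; the choice \<open>W = (t - t\<^sub>p) \<partial>\<^sub>i\<close> yields the
  gauge identity \<open>\<pi>(A\<^sub>i T) = 0\<close>. Inserting \<open>W = \<beta>(t) \<delta>X\<close> with a bump function \<open>\<beta>\<close> into stationarity
  and letting \<open>\<beta>\<close> concentrate at \<open>t\<close> gives the integral identity on the slice, with \<open>\<pi>(L\<^sub>\<delta>\<^sub>X T)\<close> in place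
  of \<open>\<Pi>\<^sub>B(L\<^sub>\<delta>\<^sub>X B)\<close>. Finally \<open>L\<^sub>\<delta>\<^sub>X B\<close> is the decomposition of \<open>L\<^sub>\<delta>\<^sub>X T\<close> up to terms \<open>A\<^sub>i T\<close> coming from
  \<open>[\<delta>X, \<partial>\<^sub>t - X]\<close>, which \<open>\<pi>\<close> annihilates.\<close>

subsection \<open>Smooth functions\<close>

text \<open>Why invariance at one point suffices: for \<open>\<xi> = (t - t_p) W\<close> the Lie
  derivative of T is (t - t_p) L_W T + W^i A_i T, so its 1-jet at p is that of W^i A_i T with L_W T
  added in the slot of the time derivative, and the Lie derivative of g at p is the symmetrization
  of dt \<otimes> g(W, .) without the factor 1/2. Since \<xi> vanishes at p and, W being spatial,
  has no divergence there, the top form adds no term of its own. The Lagrangian sees T, its first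
  derivatives and the undifferentiated metric, hence only the 1-jet of W at p matters. This is why
  affine W, realised by closed formulas with an explicit inverse, can stand in for arbitrary W. The
  obstacle in the localization is that \<beta>' blows up when \<beta> concentrates. But \<beta>'
  multiplies nothing except \<pi>(A_i T), which the gauge identity makes zero, so \<beta> enters
  undifferentiated. A sign argument on a short time interval then replaces a delta sequence.\<close>

lemma has_derivative_frechet:
  "f differentiable (at x) \<Longrightarrow> (f has_derivative frechet_derivative f (at x)) (at x)"
  by (simp add: frechet_derivative_works)

lemma pdir_eqI: "(f has_derivative f') (at x) \<Longrightarrow> pdir v f x = f' v"
  unfolding pdir_def by (metis frechet_derivative_at)

text \<open>\<open>frechet_derivative\<close> is a choice among all derivatives at the point.
  Functions that agree near the point have the same derivatives, so the choices coincide even where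
  no derivative exists.\<close>

lemma pdir_cong_open:
  assumes "open U" "x \<in> U" "\<And>y. y \<in> U \<Longrightarrow> f y = g y"
  shows "pdir v f x = pdir v g x"
proof -
  have "(f has_derivative f') (at x) \<longleftrightarrow> (g has_derivative f') (at x)" for f'
    using assms has_derivative_transform_within_open[of f f' x UNIV U g]
      has_derivative_transform_within_open[of g f' x UNIV U f] by auto
  then show ?thesis by (simp add: pdir_def frechet_derivative_def)
qed

lemma differentiable_cong_open:
  assumes "open U" "x \<in> U" "\<And>y. y \<in> U \<Longrightarrow> f y = g y" "f differentiable (at x)"
  shows "g differentiable (at x)"
  using assms unfolding differentiable_def
  by (metis has_derivative_transform_within_open)

lemma Csmooth_on_subset: "Csmooth_on U f \<Longrightarrow> V \<subseteq> U \<Longrightarrow> Csmooth_on V f"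
  unfolding Csmooth_on_def using differentiable_on_subset by blast

lemma Csmooth_on_differentiable:
  assumes "Csmooth_on U f" "open U" "x \<in> U"
  shows "f differentiable (at x)"
proof -
  have "itpd [] f differentiable_on U"
    using assms(1) unfolding Csmooth_on_def by (metis empty_set empty_subsetI)
  then show ?thesis
    using assms by (simp add: differentiable_on_eq_differentiable_at)
qed

lemma itpd_append: "itpd (vs @ ws) f = itpd vs (itpd ws f)"
  by (induction vs) auto

lemma Csmooth_on_pdir:
  assumes "Csmooth_on U f" "b \<in> Basis"
  shows "Csmooth_on U (pdir b f)"
  unfolding Csmooth_on_def
proof (intro allI impI)
  fix vs :: "'a list" assume "set vs \<subseteq> Basis"
  then have "itpd (vs @ [b]) f differentiable_on U"
    using assms unfolding Csmooth_on_def by auto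
  then show "itpd vs (pdir b f) differentiable_on U"
    by (simp add: itpd_append)
qed

lemma Csmooth_on_continuous:
  assumes "Csmooth_on U f" "open U" shows "continuous_on U f"
proof -
  have "isCont f x" if "x \<in> U" for x
    using Csmooth_on_differentiable[OF assms that] differentiable_imp_continuous_within by blast
  then show ?thesis by (simp add: continuous_at_imp_continuous_on)
qed

text \<open>Coinduction for smoothness: if a class of differentiable functions is stable under
  coordinate derivatives, up to agreement on U, then iterated derivatives never leave it. Smoothness
  proofs thus reduce to finding a stable class, with no Leibniz formula of higher order.\<close>

lemma Csmooth_on_coinduct:
  assumes U: "open U" and f: "f \<in> F"
    and diff: "\<And>f x. f \<in> F \<Longrightarrow> x \<in> U \<Longrightarrow> f differentiable (at x)"
    and step: "\<And>f b. f \<in> F \<Longrightarrow> b \<in> Basis \<Longrightarrow> \<exists>f'\<in>F. \<forall>x\<in>U. pdir b f x = f' x"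
  shows "Csmooth_on U f"
  unfolding Csmooth_on_def
proof (intro allI impI)
  fix vs :: "'a list" assume "set vs \<subseteq> Basis"
  then have "\<exists>f'\<in>F. \<forall>x\<in>U. itpd vs f x = f' x"
  proof (induction vs)
    case (Cons v vs)
    then obtain f' where f': "f' \<in> F" "\<forall>x\<in>U. itpd vs f x = f' x" by auto
    obtain f'' where f'': "f'' \<in> F" "\<forall>x\<in>U. pdir v f' x = f'' x"
      using step[of f' v] f' Cons.prems by auto
    have "pdir v (itpd vs f) x = pdir v f' x" if "x \<in> U" for x
      by (rule pdir_cong_open[OF U that]) (use f' in auto)
    then show ?case using f'' by auto
  qed (use f in auto)
  then obtain f' where f': "f' \<in> F" "\<forall>x\<in>U. itpd vs f x = f' x" by auto
  have "itpd vs f differentiable (at x)" if "x \<in> U" for x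
    by (rule differentiable_cong_open[OF U that, of f']) (use f' diff that in auto)
  then show "itpd vs f differentiable_on U"
    by (simp add: U differentiable_on_eq_differentiable_at)
qed

lemma Csmooth_on_const: "open U \<Longrightarrow> Csmooth_on U (\<lambda>x. c)"
proof (rule Csmooth_on_coinduct[where F = "range (\<lambda>c x. c)"])
  have "pdir b (\<lambda>x. d) x = 0" for b x :: 'a and d
    by (rule pdir_eqI[of _ "\<lambda>_. 0", simplified]) simp
  then show "\<exists>f'\<in>range (\<lambda>c x. c). \<forall>x\<in>U. pdir b f x = f' x"
    if "f \<in> range (\<lambda>c x. c)" for f and b :: 'a
    using that by auto
qed auto

lemma Csmooth_on_bounded_linear:
  assumes "open U" "bounded_linear f"
  shows "Csmooth_on U f"
proof (rule Csmooth_on_coinduct[OF assms(1), where F = "insert f (range (\<lambda>c x. c))"])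
  fix h and b :: 'a assume h: "h \<in> insert f (range (\<lambda>c x. c))"
  have "pdir b f x = f b" for x
    by (rule pdir_eqI[OF bounded_linear_imp_has_derivative[OF assms(2)]])
  moreover have "pdir b (\<lambda>x. d) x = 0" for d and x :: 'a
    by (rule pdir_eqI[of _ "\<lambda>_. 0", simplified]) simp
  ultimately show "\<exists>f'\<in>insert f (range (\<lambda>c x. c)). \<forall>x\<in>U. pdir b h x = f' x"
    using h by auto
next
  fix h x assume "h \<in> insert f (range (\<lambda>c x. c))"
  then show "h differentiable (at x)"
    using bounded_linear_imp_differentiable[OF assms(2)] by auto
qed simp

text \<open>The stable class for composition and multiplication at once. A derivative of f o \<Phi>
  is a sum of products of composites with smooth functions on U, so composites alone are not stable,
  but the algebra generated by both kinds is.\<close>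

inductive_set smooth_alg :: "'a::euclidean_space set \<Rightarrow> 'b::euclidean_space set \<Rightarrow> ('a \<Rightarrow> 'b) \<Rightarrow> ('a \<Rightarrow> real) set"
  for U V \<Phi> where
  base: "Csmooth_on U f \<Longrightarrow> f \<in> smooth_alg U V \<Phi>"
| comp: "Csmooth_on V f \<Longrightarrow> (\<lambda>x. f (\<Phi> x)) \<in> smooth_alg U V \<Phi>"
| add: "f \<in> smooth_alg U V \<Phi> \<Longrightarrow> g \<in> smooth_alg U V \<Phi> \<Longrightarrow> (\<lambda>x. f x + g x) \<in> smooth_alg U V \<Phi>"
| mult: "f \<in> smooth_alg U V \<Phi> \<Longrightarrow> g \<in> smooth_alg U V \<Phi> \<Longrightarrow> (\<lambda>x. f x * g x) \<in> smooth_alg U V \<Phi>"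

lemma smooth_alg_sum:
  assumes "open U" "finite A" "\<And>a. a \<in> A \<Longrightarrow> f a \<in> smooth_alg U V \<Phi>"
  shows "(\<lambda>x. \<Sum>a\<in>A. f a x) \<in> smooth_alg U V \<Phi>"
  using assms(2,3)
proof (induction A rule: finite_induct)
  case empty
  show ?case using smooth_alg.base[OF Csmooth_on_const[OF assms(1)]] by simp
next
  case (insert a A)
  then show ?case using smooth_alg.add[of "f a" U V \<Phi>] by simp
qed

lemma pdir_comp:
  fixes \<Phi> :: "'a::euclidean_space \<Rightarrow> 'b::euclidean_space"
  assumes "\<And>b. b \<in> Basis \<Longrightarrow> (\<lambda>x. \<Phi> x \<bullet> b) differentiable (at x)" "f differentiable (at (\<Phi> x))"
  shows "(\<lambda>x. f (\<Phi> x)) differentiable (at x)"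
    "pdir v (\<lambda>x. f (\<Phi> x)) x = (\<Sum>b\<in>Basis. pdir b f (\<Phi> x) * pdir v (\<lambda>x. \<Phi> x \<bullet> b) x)"
proof -
  have d\<Phi>: "\<Phi> differentiable (at x)"
    using assms(1) differentiable_componentwise_within[of \<Phi> x UNIV] by auto
  define D where "D = frechet_derivative \<Phi> (at x)"
  define f' where "f' = frechet_derivative f (at (\<Phi> x))"
  have D: "(\<Phi> has_derivative D) (at x)" unfolding D_def using has_derivative_frechet[OF d\<Phi>] .
  have f': "(f has_derivative f') (at (\<Phi> x))" unfolding f'_def using has_derivative_frechet[OF assms(2)] .
  have c: "((\<lambda>x. f (\<Phi> x)) has_derivative (\<lambda>h. f' (D h))) (at x)"
    using has_derivative_compose[OF D f'] .
  then show "(\<lambda>x. f (\<Phi> x)) differentiable (at x)" by (auto simp: differentiable_def)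
  have "pdir v (\<lambda>x. f (\<Phi> x)) x = f' (D v)" using pdir_eqI[OF c] .
  also have "\<dots> = f' (\<Sum>b\<in>Basis. (D v \<bullet> b) *\<^sub>R b)" by (simp add: euclidean_representation)
  also have "\<dots> = (\<Sum>b\<in>Basis. (D v \<bullet> b) * f' b)"
  proof -
    have l: "linear f'" using f' has_derivative_linear by blast
    show ?thesis by (simp add: linear_sum[OF l] linear_cmul[OF l])
  qed
  also have "\<dots> = (\<Sum>b\<in>Basis. pdir b f (\<Phi> x) * pdir v (\<lambda>x. \<Phi> x \<bullet> b) x)"
  proof (rule sum.cong)
    fix b :: 'b assume "b \<in> Basis"
    have "((\<lambda>x. \<Phi> x \<bullet> b) has_derivative (\<lambda>h. D h \<bullet> b)) (at x)"
      using D by (auto intro!: derivative_eq_intros)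
    then show "D v \<bullet> b * f' b = pdir b f (\<Phi> x) * pdir v (\<lambda>x. \<Phi> x \<bullet> b) x"
      using pdir_eqI pdir_eqI[OF f'] by (metis mult.commute)
  qed simp
  finally show "pdir v (\<lambda>x. f (\<Phi> x)) x = (\<Sum>b\<in>Basis. pdir b f (\<Phi> x) * pdir v (\<lambda>x. \<Phi> x \<bullet> b) x)" .
qed

lemma smooth_alg_Csmooth:
  fixes \<Phi> :: "'a::euclidean_space \<Rightarrow> 'b::euclidean_space"
  assumes U: "open U" and V: "open V"
    and \<Phi>: "\<And>b. b \<in> Basis \<Longrightarrow> Csmooth_on U (\<lambda>x. \<Phi> x \<bullet> b)" "\<And>x. x \<in> U \<Longrightarrow> \<Phi> x \<in> V"
    and f: "f \<in> smooth_alg U V \<Phi>"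
  shows "Csmooth_on U f"
proof (rule Csmooth_on_coinduct[OF U f])
  have d\<Phi>: "(\<lambda>x. \<Phi> x \<bullet> b) differentiable (at x)" if "b \<in> Basis" "x \<in> U" for b x
    by (rule Csmooth_on_differentiable[OF \<Phi>(1)[OF that(1)] U that(2)])
  show diff: "f differentiable (at x)" if "f \<in> smooth_alg U V \<Phi>" "x \<in> U" for f x
    using that
  proof induction
    case (base f)
    then show ?case using Csmooth_on_differentiable[OF _ U] by simp
  next
    case (comp f)
    show ?case
      by (rule pdir_comp(1)[OF d\<Phi>[OF _ comp(2)] Csmooth_on_differentiable[OF comp(1) V \<Phi>(2)[OF comp(2)]]])
  qed (simp_all add: differentiable_add differentiable_mult)
  fix f and v :: 'a assume "f \<in> smooth_alg U V \<Phi>" and v: "v \<in> Basis"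
  from this(1) show "\<exists>f'\<in>smooth_alg U V \<Phi>. \<forall>x\<in>U. pdir v f x = f' x"
  proof induction
    case (base f)
    show ?case
      by (rule bexI[OF _ smooth_alg.base[OF Csmooth_on_pdir[OF base v]]]) simp
  next
    case (comp f)
    show ?case
    proof (rule bexI, rule ballI)
      fix x assume x: "x \<in> U"
      show "pdir v (\<lambda>x. f (\<Phi> x)) x = (\<Sum>b\<in>Basis. pdir b f (\<Phi> x) * pdir v (\<lambda>x. \<Phi> x \<bullet> b) x)"
        by (rule pdir_comp(2)[OF d\<Phi>[OF _ x] Csmooth_on_differentiable[OF comp(1) V \<Phi>(2)[OF x]]])
    next
      show "(\<lambda>x. \<Sum>b\<in>Basis. pdir b f (\<Phi> x) * pdir v (\<lambda>x. \<Phi> x \<bullet> b) x) \<in> smooth_alg U V \<Phi>"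
        by (intro smooth_alg_sum[OF U finite_Basis] smooth_alg.mult smooth_alg.comp[OF Csmooth_on_pdir]
          smooth_alg.base[OF Csmooth_on_pdir] comp \<Phi> v)
    qed
  next
    case (add f g)
    from add.IH(1) obtain f' where f': "f' \<in> smooth_alg U V \<Phi>" "\<forall>x\<in>U. pdir v f x = f' x" ..
    from add.IH(2) obtain g' where g': "g' \<in> smooth_alg U V \<Phi>" "\<forall>x\<in>U. pdir v g x = g' x" ..
    show ?case
    proof (rule bexI[OF _ smooth_alg.add[OF f'(1) g'(1)]], rule ballI)
      fix x assume x: "x \<in> U"
      have "((\<lambda>x. f x + g x) has_derivative (\<lambda>h. frechet_derivative f (at x) h + frechet_derivative g (at x) h)) (at x)"
        by (intro has_derivative_add has_derivative_frechet diff add x)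
      from pdir_eqI[OF this] show "pdir v (\<lambda>x. f x + g x) x = f' x + g' x"
        using f'(2) g'(2) x by (simp add: pdir_def)
    qed
  next
    case (mult f g)
    from mult.IH(1) obtain f' where f': "f' \<in> smooth_alg U V \<Phi>" "\<forall>x\<in>U. pdir v f x = f' x" ..
    from mult.IH(2) obtain g' where g': "g' \<in> smooth_alg U V \<Phi>" "\<forall>x\<in>U. pdir v g x = g' x" ..
    show ?case
    proof (rule bexI[OF _ smooth_alg.add[OF smooth_alg.mult[OF mult.hyps(1) g'(1)] smooth_alg.mult[OF f'(1) mult.hyps(2)]]], rule ballI)
      fix x assume x: "x \<in> U"
      have "((\<lambda>x. f x * g x) has_derivative (\<lambda>h. f x * frechet_derivative g (at x) h + frechet_derivative f (at x) h * g x)) (at x)"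
        by (intro has_derivative_mult has_derivative_frechet diff mult x)
      from pdir_eqI[OF this] show "pdir v (\<lambda>x. f x * g x) x = f x * g' x + f' x * g x"
        using f'(2) g'(2) x by (simp add: pdir_def)
    qed
  qed
qed

lemma Csmooth_on_comp:
  fixes \<Phi> :: "'a::euclidean_space \<Rightarrow> 'b::euclidean_space"
  assumes "open U" "open V" "Csmooth_on V f"
    "\<And>b. b \<in> Basis \<Longrightarrow> Csmooth_on U (\<lambda>x. \<Phi> x \<bullet> b)" "\<And>x. x \<in> U \<Longrightarrow> \<Phi> x \<in> V"
  shows "Csmooth_on U (\<lambda>x. f (\<Phi> x))"
  by (rule smooth_alg_Csmooth[OF assms(1,2,4,5)]) (auto intro: smooth_alg.comp assms)

text \<open>Closure of smooth functions under sums and products is the case where the inner map is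
  the identity.\<close>

lemma smooth_alg_id_Csmooth: "open U \<Longrightarrow> f \<in> smooth_alg U U (\<lambda>x. x) \<Longrightarrow> Csmooth_on U f"
  by (rule smooth_alg_Csmooth) (auto intro!: Csmooth_on_bounded_linear bounded_linear_inner_left)

lemma Csmooth_on_add: "open U \<Longrightarrow> Csmooth_on U f \<Longrightarrow> Csmooth_on U g \<Longrightarrow> Csmooth_on U (\<lambda>x. f x + g x)"
  by (rule smooth_alg_id_Csmooth) (auto intro: smooth_alg.intros)

lemma Csmooth_on_mult: "open U \<Longrightarrow> Csmooth_on U f \<Longrightarrow> Csmooth_on U g \<Longrightarrow> Csmooth_on U (\<lambda>x. f x * g x)"
  by (rule smooth_alg_id_Csmooth) (auto intro: smooth_alg.intros)

lemma Csmooth_on_minus: "open U \<Longrightarrow> Csmooth_on U f \<Longrightarrow> Csmooth_on U (\<lambda>x. - f x)"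
  using Csmooth_on_mult[of U "\<lambda>x. -1" f] Csmooth_on_const[of U "-1"] by simp

lemma Csmooth_on_diff: "open U \<Longrightarrow> Csmooth_on U f \<Longrightarrow> Csmooth_on U g \<Longrightarrow> Csmooth_on U (\<lambda>x. f x - g x)"
  using Csmooth_on_add[of U f "\<lambda>x. - g x"] Csmooth_on_minus[of U g] by simp

lemma Csmooth_on_sum:
  assumes "open U" "finite A" "\<And>a. a \<in> A \<Longrightarrow> Csmooth_on U (f a)"
  shows "Csmooth_on U (\<lambda>x. \<Sum>a\<in>A. f a x)"
  using assms by (intro smooth_alg_id_Csmooth smooth_alg_sum) (auto intro: smooth_alg.intros)

lemma Csmooth_on_comp_linear:
  fixes A :: "'a::euclidean_space \<Rightarrow> 'b::euclidean_space"
  assumes "open U" "open V" "Csmooth_on V f" "bounded_linear A" "\<And>x. x \<in> U \<Longrightarrow> A x \<in> V"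
  shows "Csmooth_on U (\<lambda>x. f (A x))"
  by (rule Csmooth_on_comp[OF assms(1-3) _ assms(5)])
    (auto intro!: Csmooth_on_bounded_linear assms bounded_linear_compose[OF bounded_linear_inner_left])

lemma Csmooth_on_comp_real:
  assumes "open U" "Csmooth_on UNIV (f::real \<Rightarrow> real)" "Csmooth_on U \<phi>"
  shows "Csmooth_on U (\<lambda>x. f (\<phi> x))"
  by (rule Csmooth_on_comp[OF assms(1) open_UNIV assms(2)]) (use assms in auto)

section \<open>The exponential and a compactly supported bump function\<close>

lemma Csmooth_exp: "Csmooth_on UNIV (exp :: real \<Rightarrow> real)"
proof (rule Csmooth_on_coinduct[where F = "{exp}"])
  have *: "(exp has_derivative (\<lambda>h. exp x * h)) (at x)" for x :: real
    using DERIV_exp[of x] by (simp add: has_field_derivative_def)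
  show "\<And>f x. f \<in> {exp :: real \<Rightarrow> real} \<Longrightarrow> x \<in> UNIV \<Longrightarrow> f differentiable (at x)"
    using * by (auto simp: differentiable_def)
  show "\<And>f b. f \<in> {exp :: real \<Rightarrow> real} \<Longrightarrow> b \<in> Basis \<Longrightarrow> \<exists>f'\<in>{exp}. \<forall>x\<in>UNIV. pdir b f x = f' x"
    by (auto simp: pdir_eqI[OF *])
qed auto

text \<open>The classical exp(-1/x), preceded by a polynomial in 1/x. With this factor the family is
  stable under differentiation, which acts on polynomials by P \<mapsto> y^2 (P - P').\<close>

definition flat :: "real poly \<Rightarrow> real \<Rightarrow> real" where
  "flat P x = (if x > 0 then poly P (1/x) * exp (- (1/x)) else 0)"

lemma poly_exp_at_top: "((\<lambda>y. poly P y * exp (- y)) \<longlongrightarrow> 0) (at_top :: real filter)"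
proof -
    have "((\<lambda>y. \<Sum>k\<le>degree P. coeff P k * (y ^ k / exp y)) \<longlongrightarrow> (\<Sum>k\<le>degree P. coeff P k * 0)) (at_top :: real filter)"
      by (intro tendsto_sum tendsto_mult tendsto_const tendsto_power_div_exp_0)
    moreover have "poly P y * exp (- y) = (\<Sum>k\<le>degree P. coeff P k * (y ^ k / exp y))" for y
      by (simp only: poly_altdef sum_distrib_right exp_minus divide_inverse mult.assoc)
    ultimately show ?thesis by simp
qed

lemma flat_at_0: "((\<lambda>x. flat P x) \<longlongrightarrow> 0) (at 0)"
proof -
  have "((\<lambda>x. flat P x) \<longlongrightarrow> 0) (at_right 0)"
  proof -
    have "((\<lambda>x. poly P (inverse x) * exp (- inverse x)) \<longlongrightarrow> 0) (at_right (0::real))"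
      using filterlim_compose[OF poly_exp_at_top filterlim_inverse_at_top_right] .
    then show ?thesis
      by (rule Lim_transform_eventually)
        (simp add: flat_def eventually_at_right_field inverse_eq_divide, rule exI[of _ 1], simp)
  qed
  moreover have "((\<lambda>x. flat P x) \<longlongrightarrow> 0) (at_left 0)"
    by (rule Lim_transform_eventually[OF tendsto_const])
      (simp add: flat_def eventually_at_left_field, rule exI[of _ "-1"], simp)
  ultimately show ?thesis by (simp add: filterlim_split_at)
qed

lemma flat_deriv:
  "(flat P has_field_derivative flat (monom 1 2 * (P - pderiv P)) x) (at x)"
proof -
  consider "x > 0" | "x < 0" | "x = 0" by linarith
  then show ?thesis
  proof cases
    case 1
    have "((\<lambda>x. poly P (1/x) * exp (- (1/x))) has_field_derivative
        flat (monom 1 2 * (P - pderiv P)) x) (at x)"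
    proof -
      have i: "((\<lambda>x. 1/x) has_field_derivative - ((1/x)^2)) (at x)"
        using DERIV_inverse[of x] 1 by (simp add: inverse_eq_divide power2_eq_square)
      have p: "((\<lambda>x. poly P (1/x)) has_field_derivative poly (pderiv P) (1/x) * - ((1/x)^2)) (at x)"
        by (rule DERIV_chain2[OF poly_DERIV i])
      have e: "((\<lambda>x. exp (- (1/x))) has_field_derivative exp (- (1/x)) * - (- ((1/x)^2))) (at x)"
        by (rule DERIV_chain2[OF DERIV_exp DERIV_minus[OF i]])
      from DERIV_mult[OF p e] show ?thesis
        by (rule DERIV_cong) (use 1 in \<open>simp add: flat_def poly_monom algebra_simps\<close>)
    qed
    then show ?thesis
      by (rule has_field_derivative_transform_within_open[where S = "{0<..}"]) (use 1 in \<open>auto simp: flat_def\<close>)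
  next
    case 2
    have "((\<lambda>x. 0) has_field_derivative flat (monom 1 2 * (P - pderiv P)) x) (at x)"
      using 2 by (simp add: flat_def)
    then show ?thesis
      by (rule has_field_derivative_transform_within_open[where S = "{..<0}"]) (use 2 in \<open>auto simp: flat_def\<close>)
  next
    case 3
    \<comment> \<open>At 0 the difference quotient divides by h, which multiplies the polynomial by
      its variable. It is therefore again a function of the family and tends to 0.\<close>
    have "((\<lambda>h. flat (monom 1 1 * P) h) \<longlongrightarrow> 0) (at 0)" by (rule flat_at_0)
    then have "((\<lambda>h. (flat P (0 + h) - flat P 0) / h) \<longlongrightarrow> 0) (at 0)"
      by (rule Lim_transform_eventually)
        (simp add: flat_def poly_monom eventually_at_filter)
    then show ?thesis using 3 by (simp add: DERIV_def flat_def)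
  qed
qed

lemma Csmooth_flat: "Csmooth_on UNIV (flat P)"
proof (rule Csmooth_on_coinduct[where F = "range flat"])
  have *: "(flat P has_derivative (*) (flat (monom 1 2 * (P - pderiv P)) x)) (at x)" for P x
    using flat_deriv[of P x] by (simp add: has_field_derivative_def)
  show "\<And>f x. f \<in> range flat \<Longrightarrow> x \<in> UNIV \<Longrightarrow> f differentiable (at x)"
    using * by (auto simp: differentiable_def)
  show "\<And>f b. f \<in> range flat \<Longrightarrow> b \<in> Basis \<Longrightarrow> \<exists>f'\<in>range flat. \<forall>x\<in>UNIV. pdir b f x = f' x"
    by (auto simp: pdir_eqI[OF *])
qed auto

text \<open>A product of two one-sided functions, positive exactly for |x - c| < r. It is not
  normalised, because the localization to a slice argues by sign.\<close>

definition bump :: "real \<Rightarrow> real \<Rightarrow> real \<Rightarrow> real" where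
  "bump c r x = flat 1 (x - (c - r)) * flat 1 ((c + r) - x)"

lemma Csmooth_bump: "Csmooth_on UNIV (bump c r)"
  unfolding bump_def
  by (intro Csmooth_on_mult Csmooth_on_comp_real[OF _ Csmooth_flat] Csmooth_on_diff Csmooth_on_const
      Csmooth_on_bounded_linear[OF _ bounded_linear_ident] open_UNIV)

lemma bump_nonneg: "bump c r x \<ge> 0"
  by (simp add: bump_def flat_def)

lemma bump_pos_iff: "bump c r x > 0 \<longleftrightarrow> \<bar>x - c\<bar> < r"
  by (auto simp: bump_def flat_def)

subsection \<open>The chain rule on jet space and the Lorentzian cone\<close>

text \<open>Stated without an order on a and b, since an increment along a curve may have either
  sign. The bound makes the intermediate point tend to a when b does.\<close>

lemma mean_value_between:
  fixes f :: "real \<Rightarrow> real"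
  assumes "\<And>y. min a b \<le> y \<Longrightarrow> y \<le> max a b \<Longrightarrow> (f has_field_derivative f' y) (at y)"
  shows "\<exists>y. \<bar>y - a\<bar> \<le> \<bar>b - a\<bar> \<and> f b - f a = (b - a) * f' y"
proof -
  consider "a < b" | "b < a" | "a = b" by linarith
  then show ?thesis
  proof cases
    case 1
    then obtain z where z: "z > a" "z < b" "f b - f a = (b - a) * f' z"
      using MVT2[of a b f f'] assms by (auto simp: min_def max_def)
    then show ?thesis by (intro exI[of _ z]) auto
  next
    case 2
    then obtain z where z: "z > b" "z < a" "f a - f b = (a - b) * f' z"
      using MVT2[of b a f f'] assms by (auto simp: min_def max_def)
    then show ?thesis by (intro exI[of _ z]) (auto simp: algebra_simps)
  qed auto
qed

lemma csmooth_coord_deriv: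
  assumes "csmooth C U F" "c \<in> C" "v(c := y) \<in> U"
  shows "((\<lambda>y. F (v(c := y))) has_field_derivative cpd c F (v(c := y))) (at y)"
proof -
  let ?w = "v(c := y)"
  have "(\<lambda>s. itcpd [] F (?w(c := ?w c + s))) differentiable (at 0)"
    using assms unfolding csmooth_def by (metis empty_set empty_subsetI)
  then have "((\<lambda>s. F (?w(c := ?w c + s))) has_field_derivative cpd c F ?w) (at 0)"
    unfolding cpd_def using DERIV_deriv_iff_real_differentiable by auto
  then have "((\<lambda>s. F (v(c := s + y))) has_field_derivative cpd c F ?w) (at 0)"
    by (simp add: add.commute)
  then show ?thesis
    using DERIV_shift[of "\<lambda>y. F (v(c := y))" "cpd c F ?w" 0 y] by simp
qed

text \<open>\<open>csmooth\<close> supplies continuous partial derivatives only, so the chain rule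
  is proved by letting the coordinates move one at a time: the induction is over the set D of
  coordinates already moving. Each new one contributes an increment that the mean value theorem
  expresses by a partial derivative at an intermediate point, and continuity of that partial
  derivative gives the limit. The curve itself need only be differentiable at 0.\<close>

lemma csmooth_chain_aux:
  fixes F :: "('c \<Rightarrow> real) \<Rightarrow> real" and v :: "real \<Rightarrow> 'c \<Rightarrow> real"
  assumes cs: "csmooth C U F" and d: "d > 0"
    and nb: "\<And>w. (\<And>c. c \<in> C \<Longrightarrow> \<bar>w c - v 0 c\<bar> < d) \<Longrightarrow> (\<And>c. c \<notin> C \<Longrightarrow> w c = v 0 c) \<Longrightarrow> w \<in> U"
    and dv: "\<And>c. c \<in> C \<Longrightarrow> ((\<lambda>s. v s c) has_field_derivative v' c) (at 0)"
    and D: "D \<subseteq> C"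
  shows "((\<lambda>s. F (\<lambda>c. if c \<in> D then v s c else v 0 c)) has_field_derivative (\<Sum>c\<in>D. cpd c F (v 0) * v' c)) (at 0)"
proof -
  have finC: "finite C" using cs by (simp add: csmooth_def)
  have finD: "finite D" using D finC finite_subset by blast
  have v0U: "v 0 \<in> U" by (rule nb) (use d in auto)
  have close: "\<forall>\<^sub>F s in at 0. \<forall>c\<in>C. \<bar>v s c - v 0 c\<bar> < e" if "e > 0" for e
  proof -
    have "\<forall>\<^sub>F s in at 0. \<bar>v s c - v 0 c\<bar> < e" if "c \<in> C" for c
    proof -
      have "((\<lambda>s. v s c) \<longlongrightarrow> v 0 c) (at 0)"
        using DERIV_isCont[OF dv[OF that]] by (simp add: isCont_def)
      from tendstoD[OF this \<open>e > 0\<close>] show ?thesis by (simp add: dist_real_def)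
    qed
    then show ?thesis by (simp add: eventually_ball_finite_distrib[OF finC])
  qed
  show ?thesis
    using finD D
  proof (induction D rule: finite_induct)
    case empty
    show ?case by simp
  next
    case (insert a D)
    then have a: "a \<in> C" and DC: "D \<subseteq> C" by auto
    define w where "w s = (\<lambda>c. if c \<in> D then v s c else v 0 c)" for s
    have IH: "((\<lambda>s. F (w s)) has_field_derivative (\<Sum>c\<in>D. cpd c F (v 0) * v' c)) (at 0)"
      unfolding w_def by (rule insert.IH[OF DC])
    have wins: "(\<lambda>c. if c \<in> insert a D then v s c else v 0 c) = (w s)(a := v s a)" for s
      by (auto simp: w_def)
    have wa: "w s a = v 0 a" for s using insert.hyps by (simp add: w_def)
    define R where "R s = F ((w s)(a := v s a)) - F (w s)" for s
    have mv: "\<exists>y. \<bar>y - v 0 a\<bar> \<le> \<bar>v s a - v 0 a\<bar> \<and> R s = (v s a - v 0 a) * cpd a F ((w s)(a := y))"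
      if s: "\<forall>c\<in>C. \<bar>v s c - v 0 c\<bar> < d" for s
    proof -
      have "\<exists>y. \<bar>y - v 0 a\<bar> \<le> \<bar>v s a - v 0 a\<bar> \<and>
         F ((w s)(a := v s a)) - F ((w s)(a := v 0 a)) = (v s a - v 0 a) * cpd a F ((w s)(a := y))"
      proof (rule mean_value_between, rule csmooth_coord_deriv[OF cs a], rule nb)
        fix y c assume y: "min (v 0 a) (v s a) \<le> y" "y \<le> max (v 0 a) (v s a)" and c: "c \<in> C"
        have "\<bar>v s a - v 0 a\<bar> < d" using s a by auto
        then have "\<bar>y - v 0 a\<bar> < d" using y by linarith
        then show "\<bar>((w s)(a := y)) c - v 0 c\<bar> < d"
          using s c d by (auto simp: w_def)
      next
        fix y c assume "c \<notin> C" then show "((w s)(a := y)) c = v 0 c"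
          using a DC by (auto simp: w_def)
      qed
      moreover have "(w s)(a := v 0 a) = w s" using wa by auto
      ultimately show ?thesis by (simp add: R_def)
    qed
    \<comment> \<open>The intermediate point is chosen separately for each s. No regularity in s is
      known, but its distance bound is enough for the limit.\<close>
    then obtain \<xi> where \<xi>: "\<And>s. \<forall>c\<in>C. \<bar>v s c - v 0 c\<bar> < d \<Longrightarrow>
        \<bar>\<xi> s - v 0 a\<bar> \<le> \<bar>v s a - v 0 a\<bar> \<and> R s = (v s a - v 0 a) * cpd a F ((w s)(a := \<xi> s))"
      by metis
    have cc: "ccont_on C U (cpd a F)"
      using cs a unfolding csmooth_def
      by (metis empty_set empty_subsetI insert_subset itcpd.simps list.simps(15))
    have lim1: "((\<lambda>s. cpd a F ((w s)(a := \<xi> s))) \<longlongrightarrow> cpd a F (v 0)) (at 0)"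
    proof (rule tendstoI)
      fix e :: real assume e: "e > 0"
      obtain d' where d': "d' > 0" "\<And>u. u \<in> U \<Longrightarrow> \<forall>c\<in>C. \<bar>u c - v 0 c\<bar> < d' \<Longrightarrow> \<bar>cpd a F u - cpd a F (v 0)\<bar> < e"
        using cc v0U e unfolding ccont_on_def by blast
      have "\<forall>\<^sub>F s in at 0. \<forall>c\<in>C. \<bar>v s c - v 0 c\<bar> < min d d'"
        by (rule close) (use d d' in auto)
      then show "\<forall>\<^sub>F s in at 0. dist (cpd a F ((w s)(a := \<xi> s))) (cpd a F (v 0)) < e"
      proof eventually_elim
        case (elim s)
        then have s: "\<forall>c\<in>C. \<bar>v s c - v 0 c\<bar> < d" "\<forall>c\<in>C. \<bar>v s c - v 0 c\<bar> < d'" by auto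
        let ?u = "(w s)(a := \<xi> s)"
        have \<xi>s: "\<bar>\<xi> s - v 0 a\<bar> \<le> \<bar>v s a - v 0 a\<bar>" using \<xi>[OF s(1)] by blast
        have b: "\<bar>?u c - v 0 c\<bar> < d \<and> \<bar>?u c - v 0 c\<bar> < d'" if "c \<in> C" for c
          using s a that \<xi>s d d'(1) by (force simp: w_def)
        have "?u \<in> U"
          by (rule nb) (use b a DC in \<open>auto simp: w_def\<close>)
        then show ?case using d'(2)[of ?u] b by (simp add: dist_real_def)
      qed
    qed
    have lim2: "((\<lambda>s. (v s a - v 0 a) / s) \<longlongrightarrow> v' a) (at 0)"
      using dv[OF a] by (simp add: has_field_derivative_iff)
    have R0: "R 0 = 0"
    proof -
      have "(w 0)(a := v 0 a) = w 0" by (auto simp: w_def)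
      then show ?thesis by (simp add: R_def)
    qed
    have "(R has_field_derivative cpd a F (v 0) * v' a) (at 0)"
      unfolding has_field_derivative_iff
    proof (rule Lim_transform_eventually[OF tendsto_mult[OF lim1 lim2]])
      show "\<forall>\<^sub>F s in at 0. cpd a F ((w s)(a := \<xi> s)) * ((v s a - v 0 a) / s) = (R s - R 0) / (s - 0)"
        using close[OF d] by eventually_elim (use \<xi> R0 in simp)
    qed
    from DERIV_add[OF IH this]
    show ?case unfolding wins using insert.hyps
      by (simp add: R_def add.commute)
  qed
qed

lemma csmooth_chain:
  fixes F :: "('c \<Rightarrow> real) \<Rightarrow> real" and v :: "real \<Rightarrow> 'c \<Rightarrow> real"
  assumes cs: "csmooth C U F" and d: "d > 0"
    and nb: "\<And>w. (\<And>c. c \<in> C \<Longrightarrow> \<bar>w c - v 0 c\<bar> < d) \<Longrightarrow> (\<And>c. c \<notin> C \<Longrightarrow> w c = v 0 c) \<Longrightarrow> w \<in> U"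
    and dv: "\<And>c. c \<in> C \<Longrightarrow> ((\<lambda>s. v s c) has_field_derivative v' c) (at 0)"
    and off: "\<And>s c. c \<notin> C \<Longrightarrow> v s c = v 0 c"
  shows "((\<lambda>s. F (v s)) has_field_derivative (\<Sum>c\<in>C. cpd c F (v 0) * v' c)) (at 0)"
proof -
  have "(\<lambda>c. if c \<in> C then v s c else v 0 c) = v s" for s
    using off[of _ s] by auto
  moreover have "((\<lambda>s. F (\<lambda>c. if c \<in> C then v s c else v 0 c)) has_field_derivative (\<Sum>c\<in>C. cpd c F (v 0) * v' c)) (at 0)"
    by (rule csmooth_chain_aux[OF cs d nb dv subset_refl])
  ultimately show ?thesis by (simp only:)
qed

section \<open>Lorentzian and Riemannian quadratic forms, and their stability under small
  changes\<close>

lemma sum_option: "(\<Sum>a\<in>(UNIV :: 'n::finite option set). f a) = f None + (\<Sum>i\<in>UNIV. f (Some i))"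
  by (simp add: UNIV_option_conv sum.reindex)

lemma qf_spatial: "v None = 0 \<Longrightarrow> qf gv v = (\<Sum>i\<in>UNIV. \<Sum>j\<in>UNIV. gv (Some i) (Some j) * v (Some i) * v (Some j))"
  by (simp add: qf_def sum_option)

text \<open>The form is positive definite on the hyperplane of vectors without time component. Every
  plane meets this hyperplane, so no plane is negative definite. A kernel vector would be null,
  hence outside the hyperplane; subtracting a multiple of it moves v into the hyperplane without
  changing the value of the form, which contradicts that v is timelike.\<close>

lemma lorentzianI:
  fixes gv :: "'n::finite option \<Rightarrow> 'n option \<Rightarrow> real"
  assumes sym: "\<And>a b. gv a b = gv b a" and riem: "riemannian (\<lambda>i j. gv (Some i) (Some j))"
    and tl: "qf gv v < 0"
  shows "lorentzian gv"
proof -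
  have pos: "qf gv u > 0" if "u None = 0" "u \<noteq> (\<lambda>_. 0)" for u
  proof -
    have "(\<lambda>i. u (Some i)) \<noteq> (\<lambda>_. 0)"
    proof
      assume "(\<lambda>i. u (Some i)) = (\<lambda>_. 0)"
      then have "u a = 0" for a using that(1) by (cases a) (simp_all add: fun_eq_iff)
      then show False using that(2) by auto
    qed
    then show ?thesis using riem unfolding riemannian_def qf_spatial[of u, OF that(1)] by blast
  qed
  have nonneg: "qf gv u \<ge> 0" if "u None = 0" for u
    using pos[of u] that by (cases "u = (\<lambda>_. 0)") (auto simp: qf_def)
  have "det (toM gv) \<noteq> 0"
  proof
    assume "det (toM gv) = 0"
    then have "\<not> invertible (toM gv)" by (simp add: invertible_det_nz)
    then have "\<not> (\<forall>x. toM gv *v x = 0 \<longrightarrow> x = 0)"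
      unfolding invertible_left_inverse matrix_left_invertible_ker .
    then obtain w where w: "w \<noteq> 0" "toM gv *v w = 0" by auto
    then have ker: "(\<Sum>b\<in>UNIV. gv a b * w $ b) = 0" for a
      by (auto simp: toM_def matrix_vector_mult_def vec_eq_iff)
    have ker': "(\<Sum>b\<in>UNIV. gv b a * w $ b) = 0" for a
      using ker[of a] sym by simp
    have qw: "qf gv (\<lambda>a. u a + k * w $ a) = qf gv u" for u k
    proof -
      have "qf gv (\<lambda>a. u a + k * w $ a) = (\<Sum>a\<in>UNIV. \<Sum>b\<in>UNIV. gv a b * u a * u b)
         + (\<Sum>a\<in>UNIV. k * u a * (\<Sum>b\<in>UNIV. gv a b * w $ b))
         + (\<Sum>b\<in>UNIV. k * u b * (\<Sum>a\<in>UNIV. gv a b * w $ a))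
         + (\<Sum>a\<in>UNIV. k * k * w $ a * (\<Sum>b\<in>UNIV. gv a b * w $ b))"
      proof -
        have "(\<Sum>b\<in>UNIV. k * u b * (\<Sum>a\<in>UNIV. gv a b * w $ a)) = (\<Sum>a\<in>UNIV. \<Sum>b\<in>UNIV. gv a b * (k * w $ a) * u b)"
          by (subst sum.swap) (simp add: sum_distrib_left mult_ac)
        then show ?thesis
          by (simp add: qf_def distrib_left distrib_right sum.distrib sum_distrib_left mult_ac)
      qed
      then show ?thesis by (simp add: ker ker' qf_def)
    qed
    have "qf gv (\<lambda>a. w $ a) = 0" using qw[of "\<lambda>_. 0" 1] by (simp add: qf_def)
    moreover have "(\<lambda>a. w $ a) \<noteq> (\<lambda>_. 0)" using w(1) by (simp add: vec_eq_iff fun_eq_iff)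
    ultimately have "w $ None \<noteq> 0" using pos[of "\<lambda>a. w $ a"] by auto
    then have "qf gv (\<lambda>a. v a + (- v None / w $ None) * w $ a) \<ge> 0"
      by (intro nonneg) simp
    then show False using qw[of v "- v None / w $ None"] tl by simp
  qed
  moreover have "\<not> (\<exists>v w. \<forall>\<alpha> \<beta>::real. (\<alpha>, \<beta>) \<noteq> (0, 0) \<longrightarrow> qf gv (\<lambda>a. \<alpha> * v a + \<beta> * w a) < 0)"
  proof clarify
    fix v w assume *: "\<forall>\<alpha> \<beta>::real. (\<alpha>, \<beta>) \<noteq> (0, 0) \<longrightarrow> qf gv (\<lambda>a. \<alpha> * v a + \<beta> * w a) < 0"
    have "\<exists>\<alpha> \<beta>. (\<alpha>, \<beta>) \<noteq> (0, 0) \<and> \<alpha> * v None + \<beta> * w None = 0"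
    proof (cases "w None = 0")
      case True
      then show ?thesis by (intro exI[of _ 0] exI[of _ 1]) auto
    next
      case False
      then show ?thesis by (intro exI[of _ "w None"] exI[of _ "- v None"]) auto
    qed
    then obtain \<alpha> \<beta> where "(\<alpha>, \<beta>) \<noteq> (0, 0)" "\<alpha> * v None + \<beta> * w None = 0" by blast
    then show False using * nonneg[of "\<lambda>a. \<alpha> * v a + \<beta> * w a"] by (meson not_less)
  qed
  ultimately show ?thesis unfolding lorentzian_def using sym tl by blast
qed

lemma abs_bilinear_diff_le:
  fixes A B :: "'a::finite \<Rightarrow> 'a \<Rightarrow> real"
  assumes "\<And>a b. \<bar>A a b - B a b\<bar> \<le> d"
  shows "\<bar>(\<Sum>a\<in>UNIV. \<Sum>b\<in>UNIV. A a b * x a * x b) - (\<Sum>a\<in>UNIV. \<Sum>b\<in>UNIV. B a b * x a * x b)\<bar>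
     \<le> d * (\<Sum>a\<in>UNIV. \<Sum>b\<in>UNIV. \<bar>x a\<bar> * \<bar>x b\<bar>)"
proof -
  have "(\<Sum>a\<in>UNIV. \<Sum>b\<in>UNIV. A a b * x a * x b) - (\<Sum>a\<in>UNIV. \<Sum>b\<in>UNIV. B a b * x a * x b)
     = (\<Sum>a\<in>UNIV. \<Sum>b\<in>UNIV. (A a b - B a b) * (x a * x b))"
    by (simp add: sum_subtractf left_diff_distrib mult.assoc)
  also have "\<bar>\<dots>\<bar> \<le> (\<Sum>a\<in>UNIV. \<Sum>b\<in>UNIV. \<bar>(A a b - B a b) * (x a * x b)\<bar>)"
    by (rule order_trans[OF sum_abs]) (intro sum_mono sum_abs)
  also have "\<dots> \<le> (\<Sum>a\<in>UNIV. \<Sum>b\<in>UNIV. d * (\<bar>x a\<bar> * \<bar>x b\<bar>))"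
    by (intro sum_mono) (simp add: abs_mult mult_right_mono assms)
  finally show ?thesis by (simp add: sum_distrib_left)
qed

text \<open>By compactness the form has a positive minimum on the unit sphere, and a small change of
  the coefficients cannot consume it. Homogeneity then covers all nonzero vectors.\<close>

lemma riemannian_open:
  fixes hv :: "'n::finite \<Rightarrow> 'n \<Rightarrow> real"
  assumes "riemannian hv"
  shows "\<exists>d>0. \<forall>h'. (\<forall>i j. h' i j = h' j i) \<and> (\<forall>i j. \<bar>h' i j - hv i j\<bar> < d) \<longrightarrow> riemannian h'"
proof -
  define q where "q = (\<lambda>k (x :: real ^ 'n). \<Sum>i\<in>UNIV. \<Sum>j\<in>UNIV. k i j * x $ i * x $ j)"
  have "\<exists>x\<in>sphere 0 1. \<forall>y\<in>sphere 0 1. q hv x \<le> q hv y"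
  proof (rule continuous_attains_inf)
    show "sphere (0 :: real ^ 'n) 1 \<noteq> {}"
    proof -
      have "axis undefined 1 \<in> sphere (0 :: real ^ 'n) 1" by simp
      then show ?thesis by blast
    qed
    show "continuous_on (sphere 0 1) (q hv)"
      unfolding q_def by (intro continuous_intros)
  qed simp
  then obtain x where x: "norm x = 1" "\<And>y. norm y = 1 \<Longrightarrow> q hv x \<le> q hv y" by auto
  have "(\<lambda>i. x $ i) \<noteq> (\<lambda>_. 0)"
  proof
    assume "(\<lambda>i. x $ i) = (\<lambda>_. 0)"
    then have "x = 0" by (simp add: vec_eq_iff fun_eq_iff)
    then show False using x(1) by simp
  qed
  then have m: "q hv x > 0" using assms unfolding riemannian_def q_def by blast
  \<comment> \<open>There are CARD^2 products of unit-vector components, each at most 1 in absolute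
    value. The added 1 makes the total perturbation strictly smaller than the minimum.\<close>
  define n where "n = real (CARD('n) * CARD('n)) + 1"
  have n: "n > 0" unfolding n_def by (intro add_nonneg_pos) auto
  show ?thesis
  proof (intro exI[of _ "q hv x / n"] conjI allI impI)
    show "q hv x / n > 0" using m n by simp
    fix h' assume h': "(\<forall>i j. h' i j = h' j i) \<and> (\<forall>i j. \<bar>h' i j - hv i j\<bar> < q hv x / n)"
    have unit: "q h' y > 0" if y: "norm y = 1" for y
    proof -
      have "\<bar>q h' y - q hv y\<bar> \<le> q hv x / n * (\<Sum>i\<in>UNIV. \<Sum>j\<in>UNIV. \<bar>y $ i\<bar> * \<bar>y $ j\<bar>)"
        unfolding q_def using h' by (intro abs_bilinear_diff_le) (auto simp: q_def less_imp_le)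
      also have "\<dots> \<le> q hv x / n * (\<Sum>i\<in>(UNIV::'n set). \<Sum>j\<in>(UNIV::'n set). 1)"
        using m n component_le_norm_cart[of y] y
        by (intro mult_left_mono sum_mono) (auto intro!: mult_le_one)
      also have "\<dots> = q hv x / n * (n - 1)" by (simp add: n_def)
      also have "\<dots> < q hv x" using m n by (simp add: field_simps)
      finally show ?thesis using x(2)[OF y] by linarith
    qed
    show "riemannian h'"
      unfolding riemannian_def
    proof (intro conjI allI impI)
      fix v :: "'n \<Rightarrow> real" assume v: "v \<noteq> (\<lambda>_. 0)"
      define y :: "real ^ 'n" where "y = (\<chi> i. v i)"
      have y0: "norm y > 0" using v by (auto simp: y_def vec_eq_iff)
      have "0 < q h' (y /\<^sub>R norm y)" by (rule unit) (use y0 in simp)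
      also have "q h' (y /\<^sub>R norm y) = (inverse (norm y))\<^sup>2 * q h' y"
        by (simp add: q_def sum_distrib_left power2_eq_square mult_ac)
      finally have "q h' y > 0" using y0 by (simp add: zero_less_mult_iff)
      then show "0 < (\<Sum>i\<in>UNIV. \<Sum>j\<in>UNIV. h' i j * v i * v j)" by (simp add: q_def y_def)
    qed (use h' in auto)
  qed
qed

text \<open>A fixed timelike vector stays timelike and the spatial part stays Riemannian under small
  changes, so \<open>lorentzianI\<close> applies. This keeps curves of metrics through a
  slice-compatible metric inside the domain of the Lagrangian.\<close>

lemma lorentzian_open:
  fixes gv :: "'n::finite option \<Rightarrow> 'n option \<Rightarrow> real"
  assumes "lorentzian gv" "riemannian (\<lambda>i j. gv (Some i) (Some j))"
  shows "\<exists>d>0. \<forall>g'. (\<forall>a b. g' a b = g' b a) \<and> (\<forall>a b. \<bar>g' a b - gv a b\<bar> < d) \<longrightarrow> lorentzian g'"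
proof -
  obtain v where v: "qf gv v < 0" using assms(1) unfolding lorentzian_def by blast
  obtain d1 where d1: "d1 > 0" "\<And>h'. (\<forall>i j. h' i j = h' j i) \<Longrightarrow>
      (\<forall>i j. \<bar>h' i j - gv (Some i) (Some j)\<bar> < d1) \<Longrightarrow> riemannian h'"
    using riemannian_open[OF assms(2)] by blast
  define m where "m = (\<Sum>a\<in>UNIV. \<Sum>b\<in>UNIV. \<bar>v a\<bar> * \<bar>v b\<bar>) + 1"
  have m: "m > 0" unfolding m_def by (intro add_nonneg_pos sum_nonneg) auto
  define d where "d = min d1 (- qf gv v / m)"
  show ?thesis
  proof (intro exI[of _ d] conjI allI impI)
    show "d > 0" using d1 v m by (simp add: d_def divide_neg_pos)
    fix g' :: "'n option \<Rightarrow> 'n option \<Rightarrow> real"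
    assume g': "(\<forall>a b. g' a b = g' b a) \<and> (\<forall>a b. \<bar>g' a b - gv a b\<bar> < d)"
    show "lorentzian g'"
    proof (rule lorentzianI)
      show "g' a b = g' b a" for a b using g' by auto
      show "riemannian (\<lambda>i j. g' (Some i) (Some j))"
        by (rule d1(2)) (use g' in \<open>auto simp: d_def\<close>)
      have "\<bar>qf g' v - qf gv v\<bar> \<le> (- qf gv v / m) * (m - 1)"
        using abs_bilinear_diff_le[of g' gv "- qf gv v / m" v] g'
        unfolding qf_def m_def d_def by (simp add: less_imp_le)
      also have "\<dots> < - qf gv v" using m v by (simp add: field_simps)
      finally show "qf g' v < 0" by linarith
    qed
  qed
qed

subsection \<open>Matrices acting on tensors\<close>

text \<open>The common form of pullback (P the inverse Jacobian, Q the Jacobian) and of the passage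
  to the frame adapted to a shift. The two matrices are kept independent so that each can be
  differentiated separately.\<close>

definition Act :: "nat \<Rightarrow> nat \<Rightarrow> ('n::finite option \<Rightarrow> 'n option \<Rightarrow> real) \<Rightarrow> ('n option \<Rightarrow> 'n option \<Rightarrow> real)
    \<Rightarrow> 'n ten \<Rightarrow> 'n ten" where
  "Act k1 k2 P Q \<tau> us ls = (if length us = k1 \<and> length ls = k2 then
     (\<Sum>cs\<in>lists_len k1. \<Sum>ds\<in>lists_len k2. \<tau> cs ds *
        (\<Prod>i<k1. P (us ! i) (cs ! i)) * (\<Prod>j<k2. Q (ds ! j) (ls ! j))) else 0)"

text \<open>The derivative of \<open>Act\<close> at the identity matrices, in the directions B and
  C.\<close>

definition dact :: "('n::finite option \<Rightarrow> 'n option \<Rightarrow> real) \<Rightarrow> ('n option \<Rightarrow> 'n option \<Rightarrow> real)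
    \<Rightarrow> 'n ten \<Rightarrow> 'n ten" where
  "dact B C \<tau> us ls = (\<Sum>i<length us. \<Sum>e\<in>UNIV. B (us ! i) e * \<tau> (us[i := e]) ls)
     + (\<Sum>j<length ls. \<Sum>e\<in>UNIV. C e (ls ! j) * \<tau> us (ls[j := e]))"

text \<open>The algebraic part of a Lie derivative: with A a b = \<partial>_b Y^a it is what L_Y
  adds to the directional derivative along Y. For A = \<partial>_i \<otimes> dt it is the operator
  A_i of the overview.\<close>

abbreviation lact :: "('n::finite option \<Rightarrow> 'n option \<Rightarrow> real) \<Rightarrow> 'n ten \<Rightarrow> 'n ten" where
  "lact A \<equiv> dact (\<lambda>a b. - A a b) A"

definition idm :: "'a \<Rightarrow> 'a \<Rightarrow> real" where
  "idm a b = (if a = b then 1 else 0)"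

definition mm :: "('a::finite \<Rightarrow> 'a \<Rightarrow> real) \<Rightarrow> ('a \<Rightarrow> 'a \<Rightarrow> real) \<Rightarrow> 'a \<Rightarrow> 'a \<Rightarrow> real" where
  "mm P Q a b = (\<Sum>c\<in>UNIV. P a c * Q c b)"

lemma finite_lists_len [simp]: "finite (lists_len k :: 'a::finite option list set)"
  using finite_lists_length_eq[of "UNIV :: 'a option set" k] by (simp add: lists_len_def)

lemma length_lists_len: "xs \<in> lists_len k \<Longrightarrow> length xs = k"
  by (simp add: lists_len_def)

lemma lists_len_Suc: "lists_len (Suc k) = (\<lambda>(c, cs). c # cs) ` (UNIV \<times> lists_len k)"
  by (auto simp: lists_len_def length_Suc_conv image_iff)

lemma sum_idm [simp]:
  "(\<Sum>e\<in>UNIV. F e * idm e b) = (F (b :: 'a::finite) :: real)"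
  "(\<Sum>e\<in>UNIV. idm b e * F e) = F b"
  by (simp_all add: idm_def if_distrib[of "\<lambda>x. x * _"] if_distrib[of "\<lambda>x. _ * x"] cong: if_cong)

lemma mm_idm [simp]: "mm idm P = P" "mm P idm = P"
  by (auto simp: mm_def fun_eq_iff)

lemma prod_list_update:
  assumes "i < k" "length us = k"
  shows "(\<Prod>j<k. f j (us[i := e] ! j)) = f i e * (\<Prod>j\<in>{..<k} - {i}. (f j (us ! j) :: real))"
proof -
  have "(\<Prod>j<k. f j (us[i := e] ! j)) = f i (us[i := e] ! i) * (\<Prod>j\<in>{..<k} - {i}. f j (us[i := e] ! j))"
    using assms by (intro prod.remove) auto
  then show ?thesis using assms by (auto intro!: prod.cong)
qed

lemma sum_lists_prod:
  "(\<Sum>cs\<in>lists_len k. \<Prod>i<k. f i (cs ! i)) = (\<Prod>i<k. \<Sum>c\<in>(UNIV :: 'n::finite option set). (f i c :: real))"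
proof (induction k arbitrary: f)
  case 0
  have "lists_len 0 = {[] :: 'n option list}" by (auto simp: lists_len_def)
  then show ?case by simp
next
  case (Suc k)
  have "(\<Sum>cs\<in>lists_len (Suc k). \<Prod>i<Suc k. f i (cs ! i)) =
     (\<Sum>(c, cs)\<in>UNIV \<times> lists_len k. \<Prod>i<Suc k. f i ((c # cs) ! i))"
    unfolding lists_len_Suc
    by (subst sum.reindex) (auto simp: inj_on_def case_prod_unfold)
  also have "\<dots> = (\<Sum>c\<in>UNIV. \<Sum>cs\<in>lists_len k. f 0 c * (\<Prod>i<k. f (Suc i) (cs ! i)))"
    unfolding prod.lessThan_Suc_shift by (simp add: sum.cartesian_product)
  also have "\<dots> = (\<Sum>c\<in>UNIV. f 0 c) * (\<Prod>i<k. \<Sum>c\<in>UNIV. f (Suc i) c)"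
    by (simp only: sum_distrib_left[symmetric] sum_distrib_right[symmetric] Suc.IH[of "\<lambda>i. f (Suc i)"])
  finally show ?case unfolding prod.lessThan_Suc_shift .
qed

text \<open>The derivatives of P and Q are required in the forms B P and Q C, with the new factor on
  the side of the free index. Differentiating a matrix factor then amounts to acting infinitesimally
  on the already transformed tensor, which keeps the product rule short.\<close>

lemma Act_has_derivative:
  fixes p :: "'z::real_normed_vector"
  assumes dP: "\<And>a b. ((\<lambda>x. P x a b) has_derivative (\<lambda>h. \<Sum>e\<in>UNIV. B h a e * P p e b)) (at p)"
    and dQ: "\<And>a b. ((\<lambda>x. Q x a b) has_derivative (\<lambda>h. \<Sum>e\<in>UNIV. Q p a e * C h e b)) (at p)"
    and dT: "\<And>us ls. length us = k1 \<Longrightarrow> length ls = k2 \<Longrightarrow>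
      ((\<lambda>x. \<tau> x us ls) has_derivative (\<lambda>h. \<tau>' h us ls)) (at p)"
    and len: "length us = k1" "length ls = k2"
  shows "((\<lambda>x. Act k1 k2 (P x) (Q x) (\<tau> x) us ls) has_derivative
    (\<lambda>h. Act k1 k2 (P p) (Q p) (\<tau>' h) us ls + dact (B h) (C h) (Act k1 k2 (P p) (Q p) (\<tau> p)) us ls)) (at p)"
proof -
  define PP where "PP cs = (\<Prod>i<k1. P p (us ! i) (cs ! i))" for cs
  define QQ where "QQ ds = (\<Prod>j<k2. Q p (ds ! j) (ls ! j))" for ds
  define dPP where "dPP h cs = (\<Sum>i<k1. \<Sum>e\<in>UNIV. B h (us ! i) e * (\<Prod>j<k1. P p (us[i := e] ! j) (cs ! j)))" for h cs
  define dQQ where "dQQ h ds = (\<Sum>i<k2. \<Sum>e\<in>UNIV. C h e (ls ! i) * (\<Prod>j<k2. Q p (ds ! j) (ls[i := e] ! j)))" for h ds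
  have d1: "((\<lambda>x. \<Prod>i<k1. P x (us ! i) (cs ! i)) has_derivative (\<lambda>h. dPP h cs)) (at p)" for cs
  proof -
    have "((\<lambda>x. \<Prod>i<k1. P x (us ! i) (cs ! i)) has_derivative
       (\<lambda>h. \<Sum>i<k1. (\<Sum>e\<in>UNIV. B h (us ! i) e * P p e (cs ! i)) * (\<Prod>j\<in>{..<k1} - {i}. P p (us ! j) (cs ! j)))) (at p)"
      by (rule has_derivative_prod) (rule dP)
    also have "(\<lambda>h. \<Sum>i<k1. (\<Sum>e\<in>UNIV. B h (us ! i) e * P p e (cs ! i)) * (\<Prod>j\<in>{..<k1} - {i}. P p (us ! j) (cs ! j)))
        = (\<lambda>h. dPP h cs)"
      unfolding dPP_def
      by (auto simp: prod_list_update[OF _ len(1), where f = "\<lambda>j a. P p a (cs ! j)"] sum_distrib_right mult.assoc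
          intro!: sum.cong ext)
    finally show ?thesis .
  qed
  have d2: "((\<lambda>x. \<Prod>j<k2. Q x (ds ! j) (ls ! j)) has_derivative (\<lambda>h. dQQ h ds)) (at p)" for ds
  proof -
    have "((\<lambda>x. \<Prod>j<k2. Q x (ds ! j) (ls ! j)) has_derivative
       (\<lambda>h. \<Sum>i<k2. (\<Sum>e\<in>UNIV. Q p (ds ! i) e * C h e (ls ! i)) * (\<Prod>j\<in>{..<k2} - {i}. Q p (ds ! j) (ls ! j)))) (at p)"
      by (rule has_derivative_prod) (rule dQ)
    also have "(\<lambda>h. \<Sum>i<k2. (\<Sum>e\<in>UNIV. Q p (ds ! i) e * C h e (ls ! i)) * (\<Prod>j\<in>{..<k2} - {i}. Q p (ds ! j) (ls ! j)))
        = (\<lambda>h. dQQ h ds)"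
      unfolding dQQ_def
      by (auto simp: prod_list_update[OF _ len(2), where f = "\<lambda>j a. Q p (ds ! j) a"] sum_distrib_right mult_ac
          intro!: sum.cong ext)
    finally show ?thesis .
  qed
  have "((\<lambda>x. \<Sum>cs\<in>lists_len k1. \<Sum>ds\<in>lists_len k2. \<tau> x cs ds *
        (\<Prod>i<k1. P x (us ! i) (cs ! i)) * (\<Prod>j<k2. Q x (ds ! j) (ls ! j))) has_derivative
     (\<lambda>h. \<Sum>cs\<in>lists_len k1. \<Sum>ds\<in>lists_len k2. (\<tau> p cs ds * PP cs) * dQQ h ds + (\<tau> p cs ds * dPP h cs + \<tau>' h cs ds * PP cs) * QQ ds)) (at p)"
    unfolding PP_def QQ_def
    by (intro has_derivative_sum has_derivative_mult d1 d2 dT length_lists_len)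
  also have "(\<lambda>h. \<Sum>cs\<in>lists_len k1. \<Sum>ds\<in>lists_len k2. (\<tau> p cs ds * PP cs) * dQQ h ds + (\<tau> p cs ds * dPP h cs + \<tau>' h cs ds * PP cs) * QQ ds)
     = (\<lambda>h. Act k1 k2 (P p) (Q p) (\<tau>' h) us ls + dact (B h) (C h) (Act k1 k2 (P p) (Q p) (\<tau> p)) us ls)"
  proof
    fix h
    have a1: "(\<Sum>cs\<in>lists_len k1. \<Sum>ds\<in>lists_len k2. \<tau>' h cs ds * PP cs * QQ ds) = Act k1 k2 (P p) (Q p) (\<tau>' h) us ls"
      using len by (simp add: Act_def PP_def QQ_def)
    have a2: "(\<Sum>cs\<in>lists_len k1. \<Sum>ds\<in>lists_len k2. \<tau> p cs ds * dPP h cs * QQ ds)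
       = (\<Sum>i<length us. \<Sum>e\<in>UNIV. B h (us ! i) e * Act k1 k2 (P p) (Q p) (\<tau> p) (us[i := e]) ls)"
    proof -
      have "(\<Sum>cs\<in>lists_len k1. \<Sum>ds\<in>lists_len k2. \<tau> p cs ds * dPP h cs * QQ ds)
         = (\<Sum>cs\<in>lists_len k1. \<Sum>ds\<in>lists_len k2. \<Sum>i<k1. \<Sum>e\<in>UNIV.
              B h (us ! i) e * (\<tau> p cs ds * (\<Prod>j<k1. P p (us[i := e] ! j) (cs ! j)) * QQ ds))"
        by (simp add: dPP_def sum_distrib_left sum_distrib_right mult_ac)
      also have "\<dots> = (\<Sum>i<k1. \<Sum>e\<in>UNIV. \<Sum>cs\<in>lists_len k1. \<Sum>ds\<in>lists_len k2.
              B h (us ! i) e * (\<tau> p cs ds * (\<Prod>j<k1. P p (us[i := e] ! j) (cs ! j)) * QQ ds))"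
        by (simp only: sum.swap[of _ "UNIV :: _ set" "lists_len _"] sum.swap[of _ "{..<_} :: _ set" "lists_len _"])
      finally show ?thesis using len by (simp add: Act_def QQ_def sum_distrib_left)
    qed
    have a3: "(\<Sum>cs\<in>lists_len k1. \<Sum>ds\<in>lists_len k2. \<tau> p cs ds * PP cs * dQQ h ds)
       = (\<Sum>i<length ls. \<Sum>e\<in>UNIV. C h e (ls ! i) * Act k1 k2 (P p) (Q p) (\<tau> p) us (ls[i := e]))"
    proof -
      have "(\<Sum>cs\<in>lists_len k1. \<Sum>ds\<in>lists_len k2. \<tau> p cs ds * PP cs * dQQ h ds)
         = (\<Sum>cs\<in>lists_len k1. \<Sum>ds\<in>lists_len k2. \<Sum>i<k2. \<Sum>e\<in>UNIV.
              C h e (ls ! i) * (\<tau> p cs ds * PP cs * (\<Prod>j<k2. Q p (ds ! j) (ls[i := e] ! j))))"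
        by (simp add: dQQ_def sum_distrib_left sum_distrib_right mult_ac)
      also have "\<dots> = (\<Sum>i<k2. \<Sum>e\<in>UNIV. \<Sum>cs\<in>lists_len k1. \<Sum>ds\<in>lists_len k2.
              C h e (ls ! i) * (\<tau> p cs ds * PP cs * (\<Prod>j<k2. Q p (ds ! j) (ls[i := e] ! j))))"
        by (simp only: sum.swap[of _ "UNIV :: _ set" "lists_len _"] sum.swap[of _ "{..<_} :: _ set" "lists_len _"])
      finally show ?thesis using len by (simp add: Act_def PP_def sum_distrib_left)
    qed
    show "(\<Sum>cs\<in>lists_len k1. \<Sum>ds\<in>lists_len k2. (\<tau> p cs ds * PP cs) * dQQ h ds + (\<tau> p cs ds * dPP h cs + \<tau>' h cs ds * PP cs) * QQ ds)
      = Act k1 k2 (P p) (Q p) (\<tau>' h) us ls + dact (B h) (C h) (Act k1 k2 (P p) (Q p) (\<tau> p)) us ls"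
      unfolding dact_def a1[symmetric] a2[symmetric] a3[symmetric]
      by (simp add: sum.distrib distrib_right)
  qed
  finally show ?thesis using len by (simp add: Act_def)
qed

text \<open>The covariant matrices compose in reverse order because Q is contracted on its first
  index and P on its second. The sums over intermediate index lists factor slot by slot.\<close>

lemma Act_Act: "Act k1 k2 P Q (Act k1 k2 P' Q' \<tau>) = Act k1 k2 (mm P P') (mm Q' Q) \<tau>"
proof (intro ext)
  fix us ls :: "'a option list"
  show "Act k1 k2 P Q (Act k1 k2 P' Q' \<tau>) us ls = Act k1 k2 (mm P P') (mm Q' Q) \<tau> us ls"
  proof (cases "length us = k1 \<and> length ls = k2")
    case True
    have "Act k1 k2 P Q (Act k1 k2 P' Q' \<tau>) us ls =
      (\<Sum>cs\<in>lists_len k1. \<Sum>ds\<in>lists_len k2. \<Sum>es\<in>lists_len k1. \<Sum>fs\<in>lists_len k2. \<tau> es fs *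
        (\<Prod>i<k1. P (us ! i) (cs ! i) * P' (cs ! i) (es ! i)) *
        (\<Prod>j<k2. Q' (fs ! j) (ds ! j) * Q (ds ! j) (ls ! j)))"
      using True
      unfolding Act_def
      by (simp add: length_lists_len sum_distrib_left sum_distrib_right prod.distrib mult_ac cong: sum.cong)
    also have "\<dots> = (\<Sum>es\<in>lists_len k1. \<Sum>fs\<in>lists_len k2. \<Sum>cs\<in>lists_len k1. \<Sum>ds\<in>lists_len k2. \<tau> es fs *
        (\<Prod>i<k1. P (us ! i) (cs ! i) * P' (cs ! i) (es ! i)) *
        (\<Prod>j<k2. Q' (fs ! j) (ds ! j) * Q (ds ! j) (ls ! j)))" (is "?L = ?R")
    proof -
      define G where "G cs ds es fs = \<tau> es fs *
        (\<Prod>i<k1. P (us ! i) (cs ! i) * P' (cs ! i) (es ! i)) *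
        (\<Prod>j<k2. Q' (fs ! j) (ds ! j) * Q (ds ! j) (ls ! j))" for cs ds es fs
      have "?L = (\<Sum>cs\<in>lists_len k1. \<Sum>es\<in>lists_len k1. \<Sum>ds\<in>lists_len k2. \<Sum>fs\<in>lists_len k2. G cs ds es fs)"
        unfolding G_def by (rule sum.cong[OF refl], rule sum.swap)
      also have "\<dots> = (\<Sum>es\<in>lists_len k1. \<Sum>cs\<in>lists_len k1. \<Sum>ds\<in>lists_len k2. \<Sum>fs\<in>lists_len k2. G cs ds es fs)"
        by (rule sum.swap)
      also have "\<dots> = (\<Sum>es\<in>lists_len k1. \<Sum>cs\<in>lists_len k1. \<Sum>fs\<in>lists_len k2. \<Sum>ds\<in>lists_len k2. G cs ds es fs)"
        by (rule sum.cong[OF refl], rule sum.cong[OF refl], rule sum.swap)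
      also have "\<dots> = (\<Sum>es\<in>lists_len k1. \<Sum>fs\<in>lists_len k2. \<Sum>cs\<in>lists_len k1. \<Sum>ds\<in>lists_len k2. G cs ds es fs)"
        by (rule sum.cong[OF refl], rule sum.swap)
      finally show ?thesis unfolding G_def .
    qed
    also have "\<dots> = (\<Sum>es\<in>lists_len k1. \<Sum>fs\<in>lists_len k2. \<tau> es fs *
        (\<Sum>cs\<in>lists_len k1. \<Prod>i<k1. P (us ! i) (cs ! i) * P' (cs ! i) (es ! i)) *
        (\<Sum>ds\<in>lists_len k2. \<Prod>j<k2. Q' (fs ! j) (ds ! j) * Q (ds ! j) (ls ! j)))"
      by (simp add: sum_distrib_left sum_distrib_right mult_ac)
    also have "\<dots> = Act k1 k2 (mm P P') (mm Q' Q) \<tau> us ls"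
      using True
      by (simp add: Act_def mm_def sum_lists_prod[where f = "\<lambda>i c. P (us ! i) c * P' c (_ ! i)"]
          sum_lists_prod[where f = "\<lambda>j c. Q' (_ ! j) c * Q c (ls ! j)"])
    finally show ?thesis .
  qed (auto simp: Act_def)
qed

lemma prod_idm:
  assumes "length us = k" "length cs = k"
  shows "(\<Prod>i<k. idm (us ! i) (cs ! i)) = (if us = cs then 1 else 0)"
proof (cases "us = cs")
  case False
  then obtain i where "i < k" "us ! i \<noteq> cs ! i" using assms nth_equalityI by metis
  then show ?thesis using False by (auto simp: idm_def intro!: prod_zero)
qed (simp add: idm_def)

lemma Act_idm: "\<tau> \<in> tenvals k1 k2 \<Longrightarrow> Act k1 k2 idm idm \<tau> = \<tau>"
proof (intro ext)
  fix us ls :: "'a option list" assume \<tau>: "\<tau> \<in> tenvals k1 k2"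
  show "Act k1 k2 idm idm \<tau> us ls = \<tau> us ls"
  proof (cases "length us = k1 \<and> length ls = k2")
    case True
    have "Act k1 k2 idm idm \<tau> us ls = (\<Sum>cs\<in>lists_len k1. \<Sum>ds\<in>lists_len k2.
        if us = cs then if ds = ls then \<tau> cs ds else 0 else 0)"
    proof -
      have "\<tau> cs ds * (\<Prod>i<k1. idm (us ! i) (cs ! i)) * (\<Prod>j<k2. idm (ds ! j) (ls ! j)) =
          (if us = cs then if ds = ls then \<tau> cs ds else 0 else 0)"
        if "cs \<in> lists_len k1" "ds \<in> lists_len k2" for cs ds
        using True that by (simp add: prod_idm length_lists_len)
      then show ?thesis using True by (simp add: Act_def cong: sum.cong)
    qed
    also have "\<dots> = (\<Sum>cs\<in>lists_len k1. if us = cs then \<Sum>ds\<in>lists_len k2. if ds = ls then \<tau> cs ds else 0 else 0)"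
      by (rule sum.cong) simp_all
    also have "\<dots> = \<tau> us ls"
    proof -
      have "us \<in> lists_len k1" "ls \<in> lists_len k2" using True by (simp_all add: lists_len_def)
      then show ?thesis by simp
    qed
    finally show ?thesis .
  next
    case False
    then show ?thesis using \<tau> by (auto simp: Act_def tenvals_def)
  qed
qed

lemma Act_in_tenvals: "Act k1 k2 P Q \<tau> \<in> tenvals k1 k2"
  by (simp add: tenvals_def Act_def)

lemma dact_in_tenvals: "\<tau> \<in> tenvals k1 k2 \<Longrightarrow> dact B C \<tau> \<in> tenvals k1 k2"
  by (auto simp: tenvals_def dact_def)

lemma Act_add: "Act k1 k2 P Q (\<lambda>us ls. \<sigma> us ls + \<tau> us ls) us ls = Act k1 k2 P Q \<sigma> us ls + Act k1 k2 P Q \<tau> us ls"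
  by (simp add: Act_def distrib_right sum.distrib)

lemma Act_scale: "Act k1 k2 P Q (\<lambda>us ls. c * \<tau> us ls) us ls = c * Act k1 k2 P Q \<tau> us ls"
  by (simp add: Act_def sum_distrib_left mult.assoc)

lemma Act_zero: "Act k1 k2 P Q (\<lambda>us ls. 0) us ls = 0"
  by (simp add: Act_def)

lemma dact_zero: "dact (\<lambda>a b. 0) (\<lambda>a b. 0) \<tau> us ls = 0"
  by (simp add: dact_def)

lemma dact_add: "dact (\<lambda>a b. A a b + B a b) (\<lambda>a b. C a b + D a b) \<tau> us ls = dact A C \<tau> us ls + dact B D \<tau> us ls"
  by (simp add: dact_def distrib_right sum.distrib)

lemma dact_scale: "dact (\<lambda>a b. c * A a b) (\<lambda>a b. c * C a b) \<tau> us ls = c * dact A C \<tau> us ls"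
  by (simp add: dact_def sum_distrib_left mult.assoc distrib_left)

lemma dact_sum:
  "dact (\<lambda>a b. \<Sum>i\<in>J. A i a b) (\<lambda>a b. \<Sum>i\<in>J. C i a b) \<tau> us ls = (\<Sum>i\<in>J. dact (A i) (C i) \<tau> us ls)"
proof (cases "finite J")
  case True
  then show ?thesis by (induction J rule: finite_induct) (simp_all add: dact_zero dact_add)
qed (simp add: dact_zero)

lemma dact_arg_scale: "dact A C (\<lambda>us ls. c * \<tau> us ls) us ls = c * dact A C \<tau> us ls"
  by (simp add: dact_def sum_distrib_left mult_ac distrib_left)

lemma dact_has_derivative:
  assumes "\<And>us ls. ((\<lambda>x. \<tau> x us ls) has_derivative (\<lambda>h. \<tau>' h us ls)) (at p)"
  shows "((\<lambda>x. dact A C (\<tau> x) us ls) has_derivative (\<lambda>h. dact A C (\<tau>' h) us ls)) (at p)"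
  unfolding dact_def by (intro has_derivative_add has_derivative_sum has_derivative_mult_right assms)

text \<open>An intertwining rule for infinitesimal actions. The function s \<mapsto> Act P Q (Act (1
  + sA) (1 + sC) \<tau>) is differentiated at 0 in two ways: as it stands, and after merging the two
  actions by \<open>Act_Act\<close>. Uniqueness of the derivative replaces a computation with index
  lists.\<close>

lemma Act_dact:
  assumes \<tau>: "\<tau> \<in> tenvals k1 k2"
    and PA: "\<And>a b. mm P A a b = mm B P a b" and CQ: "\<And>a b. mm C Q a b = mm Q D a b"
  shows "Act k1 k2 P Q (dact A C \<tau>) = dact B D (Act k1 k2 P Q \<tau>)"
proof (intro ext)
  fix us ls :: "'a option list"
  show "Act k1 k2 P Q (dact A C \<tau>) us ls = dact B D (Act k1 k2 P Q \<tau>) us ls"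
  proof (cases "length us = k1 \<and> length ls = k2")
    case False
    then show ?thesis using dact_in_tenvals[OF Act_in_tenvals, of B D k1 k2 P Q \<tau>]
      by (auto simp: Act_def tenvals_def)
  next
    case True
    define P1 where "P1 s a b = idm a b + s * A a b" for s a b
    define Q1 where "Q1 s a b = idm a b + s * C a b" for s a b
    have i0: "P1 0 = idm" "Q1 0 = idm" by (simp_all add: P1_def Q1_def fun_eq_iff)
    have d1: "((\<lambda>s. Act k1 k2 (P1 s) (Q1 s) \<tau> us ls) has_derivative
       (\<lambda>h. Act k1 k2 (P1 0) (Q1 0) (\<lambda>_ _. 0) us ls
         + dact (\<lambda>a b. h * A a b) (\<lambda>a b. h * C a b) (Act k1 k2 (P1 0) (Q1 0) \<tau>) us ls)) (at 0)"
      if "length us = k1" "length ls = k2" for us ls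
      by (rule Act_has_derivative[OF _ _ _ that])
        (unfold i0 sum_idm, auto simp: P1_def Q1_def intro!: derivative_eq_intros)
    have d2: "((\<lambda>s. Act k1 k2 P Q (Act k1 k2 (P1 s) (Q1 s) \<tau>) us ls) has_derivative
       (\<lambda>h. Act k1 k2 P Q (\<lambda>us ls. dact (\<lambda>a b. h * A a b) (\<lambda>a b. h * C a b) \<tau> us ls) us ls
         + dact (\<lambda>a b. 0) (\<lambda>a b. 0) (Act k1 k2 P Q (Act k1 k2 (P1 0) (Q1 0) \<tau>)) us ls)) (at 0)"
      by (rule Act_has_derivative) (use True d1 in \<open>auto simp: Act_zero i0 Act_idm[OF \<tau>]\<close>)
    have d3: "((\<lambda>s. Act k1 k2 (mm P (P1 s)) (mm (Q1 s) Q) \<tau> us ls) has_derivative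
       (\<lambda>h. Act k1 k2 (mm P (P1 0)) (mm (Q1 0) Q) (\<lambda>_ _. 0) us ls
         + dact (\<lambda>a b. h * B a b) (\<lambda>a b. h * D a b) (Act k1 k2 (mm P (P1 0)) (mm (Q1 0) Q) \<tau>) us ls)) (at 0)"
    proof (rule Act_has_derivative)
      fix a b
      have "((\<lambda>s. mm P (P1 s) a b) has_derivative (\<lambda>h. h * mm P A a b)) (at 0)"
        unfolding mm_def P1_def
        by (auto intro!: derivative_eq_intros simp: sum_distrib_left mult_ac)
      then show "((\<lambda>s. mm P (P1 s) a b) has_derivative (\<lambda>h. \<Sum>e\<in>UNIV. h * B a e * mm P (P1 0) e b)) (at 0)"
        by (simp add: PA i0) (simp add: mm_def sum_distrib_left mult_ac)
      have "((\<lambda>s. mm (Q1 s) Q a b) has_derivative (\<lambda>h. h * mm C Q a b)) (at 0)"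
        unfolding mm_def Q1_def
        by (auto intro!: derivative_eq_intros simp: sum_distrib_left mult_ac)
      then show "((\<lambda>s. mm (Q1 s) Q a b) has_derivative (\<lambda>h. \<Sum>e\<in>UNIV. mm (Q1 0) Q a e * (h * D e b))) (at 0)"
        by (simp add: CQ i0) (simp add: mm_def sum_distrib_left mult_ac)
    qed (use True in auto)
    have "(\<lambda>h. Act k1 k2 P Q (\<lambda>us ls. dact (\<lambda>a b. h * A a b) (\<lambda>a b. h * C a b) \<tau> us ls) us ls
         + dact (\<lambda>a b. 0) (\<lambda>a b. 0) (Act k1 k2 P Q (Act k1 k2 (P1 0) (Q1 0) \<tau>)) us ls) =
       (\<lambda>h. Act k1 k2 (mm P (P1 0)) (mm (Q1 0) Q) (\<lambda>_ _. 0) us ls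
         + dact (\<lambda>a b. h * B a b) (\<lambda>a b. h * D a b) (Act k1 k2 (mm P (P1 0)) (mm (Q1 0) Q) \<tau>) us ls)"
      using d2 d3 unfolding Act_Act by (rule has_derivative_unique)
    from fun_cong[OF this, of 1] show ?thesis
      by (simp add: i0 Act_idm[OF \<tau>] Act_zero dact_zero)
  qed
qed

subsection \<open>Lagrangians along curves of jets\<close>

fun jetv :: "('n::finite) pt \<Rightarrow> 'n ten \<Rightarrow> ('n option \<Rightarrow> 'n ten) \<Rightarrow> ('n option \<Rightarrow> 'n option \<Rightarrow> real) \<Rightarrow> 'n jc \<Rightarrow> real" where
  "jetv p \<tau> d gv (JP a) = p $ a"
| "jetv p \<tau> d gv (JT us ls) = \<tau> us ls"
| "jetv p \<tau> d gv (JD a us ls) = d a us ls"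
| "jetv p \<tau> d gv (JG a b) = gv a b"

text \<open>A partial derivative of the Lagrangian in one jet coordinate. The coordinates
  \<open>JG a b\<close> and \<open>JG b a\<close> are independent and \<open>jet_lag\<close>
  symmetrizes them, so a variation of the metric is paired by summing over all ordered pairs,
  without a factor 2.\<close>

definition Lpart :: "nat \<Rightarrow> nat \<Rightarrow> ('n::finite) lagr \<Rightarrow> 'n pt \<Rightarrow> 'n ten \<Rightarrow> ('n option \<Rightarrow> 'n ten)
    \<Rightarrow> ('n option \<Rightarrow> 'n option \<Rightarrow> real) \<Rightarrow> 'n jc \<Rightarrow> real" where
  "Lpart k1 k2 L p \<tau> d gv c = cpd c (jet_lag k1 k2 L) (jetv p \<tau> d gv)"

definition tpair :: "nat \<Rightarrow> nat \<Rightarrow> ('n::finite) ten \<Rightarrow> 'n ten \<Rightarrow> real" where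
  "tpair k1 k2 c \<tau> = (\<Sum>us\<in>lists_len k1. \<Sum>ls\<in>lists_len k2. c us ls * \<tau> us ls)"

lemma tpair_add: "tpair k1 k2 c (\<lambda>us ls. \<sigma> us ls + \<tau> us ls) = tpair k1 k2 c \<sigma> + tpair k1 k2 c \<tau>"
  by (simp add: tpair_def distrib_left sum.distrib)

lemma tpair_scale: "tpair k1 k2 c (\<lambda>us ls. r * \<tau> us ls) = r * tpair k1 k2 c \<tau>"
  by (simp add: tpair_def sum_distrib_left mult_ac)

lemma tpair_zero: "tpair k1 k2 c (\<lambda>us ls. 0) = 0"
  by (simp add: tpair_def)

lemma tpair_sum: "tpair k1 k2 c (\<lambda>us ls. \<Sum>i\<in>J. \<tau> i us ls) = (\<Sum>i\<in>J. tpair k1 k2 c (\<tau> i))"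
proof (cases "finite J")
  case True
  then show ?thesis by (induction J rule: finite_induct) (simp_all add: tpair_zero tpair_add)
qed (simp add: tpair_zero)

lemma tpair_cong:
  "(\<And>us ls. length us = k1 \<Longrightarrow> length ls = k2 \<Longrightarrow> \<sigma> us ls = \<tau> us ls) \<Longrightarrow> tpair k1 k2 c \<sigma> = tpair k1 k2 c \<tau>"
  by (simp add: tpair_def length_lists_len cong: sum.cong)

lemma jet_lag_jetv:
  assumes "\<tau> \<in> tenvals k1 k2" "\<And>a. d a \<in> tenvals k1 k2" "\<And>a b. gv a b = gv b a"
  shows "jet_lag k1 k2 L (jetv p \<tau> d gv) = L p \<tau> d gv"
proof -
  have "(\<lambda>us ls. if length us = k1 \<and> length ls = k2 then \<tau> us ls else 0) = \<tau>"
    using assms(1) by (auto simp: tenvals_def fun_eq_iff)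
  moreover have "(\<lambda>a us ls. if length us = k1 \<and> length ls = k2 then d a us ls else 0) = d"
    using assms(2) by (auto simp: tenvals_def fun_eq_iff)
  moreover have "(\<lambda>a b. (gv a b + gv b a) / 2) = gv"
    using assms(3) by (simp add: fun_eq_iff)
  ultimately show ?thesis
    unfolding jet_lag_def jetv.simps by simp
qed

lemma jcoords_eq: "(jcoords k1 k2 :: ('n::finite) jc set) = range JP \<union> (\<lambda>(us, ls). JT us ls) ` (lists_len k1 \<times> lists_len k2)
   \<union> (\<lambda>(a, us, ls). JD a us ls) ` (UNIV \<times> lists_len k1 \<times> lists_len k2)
   \<union> (\<lambda>(a, b). JG a b) ` (UNIV \<times> UNIV)"
proof -
  have "({JT us ls |us ls. length us = k1 \<and> length ls = k2} :: 'n jc set) = (\<lambda>(us, ls). JT us ls) ` (lists_len k1 \<times> lists_len k2)"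
    by (auto simp: lists_len_def)
  moreover have "({JD a us ls |a us ls. length us = k1 \<and> length ls = k2} :: 'n jc set)
      = (\<lambda>(a, us, ls). JD a us ls) ` (UNIV \<times> lists_len k1 \<times> lists_len k2)"
    by (auto simp: lists_len_def image_iff)
  moreover have "({JG a b |a b. True} :: 'n jc set) = (\<lambda>(a, b). JG a b) ` (UNIV \<times> UNIV)"
    by auto
  ultimately show ?thesis by (simp only: jcoords_def)
qed

lemma sum_jcoords:
  fixes f :: "('n::finite) jc \<Rightarrow> real"
  shows "(\<Sum>c\<in>jcoords k1 k2. f c) = (\<Sum>a\<in>UNIV. f (JP a))
    + (\<Sum>us\<in>lists_len k1. \<Sum>ls\<in>lists_len k2. f (JT us ls))
    + (\<Sum>a\<in>UNIV. \<Sum>us\<in>lists_len k1. \<Sum>ls\<in>lists_len k2. f (JD a us ls))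
    + (\<Sum>a\<in>UNIV. \<Sum>b\<in>UNIV. f (JG a b))"
proof -
  have i: "inj_on JP (UNIV :: 'n option set)"
    "inj_on (\<lambda>(us, ls). JT us ls :: 'n jc) (lists_len k1 \<times> lists_len k2)"
    "inj_on (\<lambda>(a, us, ls). JD a us ls :: 'n jc) (UNIV \<times> lists_len k1 \<times> lists_len k2)"
    "inj_on (\<lambda>(a, b). JG a b :: 'n jc) (UNIV \<times> UNIV)"
    by (auto simp: inj_on_def)
  show ?thesis
    unfolding jcoords_eq
    apply (subst sum.union_disjoint, simp, simp, force)+
    by (simp only: sum.reindex[OF i(1)] sum.reindex[OF i(2)] sum.reindex[OF i(3)] sum.reindex[OF i(4)] o_def)
      (simp add: case_prod_unfold sum.cartesian_product)
qed

lemma jet_region_nbhd: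
  fixes gv :: "('n::finite) option \<Rightarrow> 'n option \<Rightarrow> real"
  assumes M: "open M" "p \<in> M" and gv: "lorentzian gv" "riemannian (\<lambda>i j. gv (Some i) (Some j))"
  shows "\<exists>d>0. \<forall>w. (\<forall>c\<in>jcoords k1 k2. \<bar>w c - jetv p \<tau> dd gv c\<bar> < d) \<longrightarrow>
     (\<chi> a. w (JP a)) \<in> M \<and> lorentzian (\<lambda>a b. (w (JG a b) + w (JG b a)) / 2)"
proof -
  obtain e where e: "e > 0" "ball p e \<subseteq> M" using M openE by blast
  obtain d where d: "d > 0" "\<And>g'. (\<forall>a b. g' a b = g' b a) \<Longrightarrow> (\<forall>a b. \<bar>g' a b - gv a b\<bar> < d) \<Longrightarrow> lorentzian g'"
    using lorentzian_open[OF gv] by blast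
  \<comment> \<open>The division by the number of coordinates passes from the bound on each
    coordinate to the Euclidean norm, estimated by the sum of absolute values.\<close>
  define D where "D = min d (e / real CARD('n option))"
  have D: "D > 0" "D \<le> d" "D \<le> e / real CARD('n option)" using d e by (auto simp: D_def)
  show ?thesis
  proof (intro exI[of _ D] conjI allI impI)
    fix w :: "'n jc \<Rightarrow> real" assume w: "\<forall>c\<in>jcoords k1 k2. \<bar>w c - jetv p \<tau> dd gv c\<bar> < D"
    have wp: "\<bar>w (JP a) - p $ a\<bar> < D" for a using bspec[OF w, of "JP a"] by (simp add: jcoords_def)
    have wg: "\<bar>w (JG a b) - gv a b\<bar> < D" for a b using bspec[OF w, of "JG a b"] by (simp add: jcoords_def)
    have "norm ((\<chi> a. w (JP a)) - p) \<le> (\<Sum>a\<in>UNIV. \<bar>((\<chi> a. w (JP a)) - p) $ a\<bar>)" by (rule norm_le_l1_cart)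
    also have "\<dots> < (\<Sum>a\<in>(UNIV :: 'n option set). D)"
      by (rule sum_strict_mono) (use wp in auto)
    also have "\<dots> \<le> e" using D(3) by (simp add: field_simps)
    finally show "(\<chi> a. w (JP a)) \<in> M" using e(2) by (auto simp: dist_norm norm_minus_commute)
    show "lorentzian (\<lambda>a b. (w (JG a b) + w (JG b a)) / 2)"
    proof (rule d(2))
      show "\<forall>a b. \<bar>(w (JG a b) + w (JG b a)) / 2 - gv a b\<bar> < d"
      proof (intro allI)
        fix a b
        have "gv a b = gv b a" using gv(1) by (auto simp: lorentzian_def)
        then show "\<bar>(w (JG a b) + w (JG b a)) / 2 - gv a b\<bar> < d"
          using wg[of a b] wg[of b a] D(2) by (simp only: abs_less_iff) (auto simp: field_simps)
      qed
    qed (simp add: add.commute)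
  qed (rule D)
qed

text \<open>The one differentiation rule for the Lagrangian, at a fixed point and along a curve of
  jets. The rank and symmetry conditions are imposed for all s, so that \<open>jet_lag\<close>
  agrees with L along the whole curve; a Riemannian slice part at s = 0 gives the needed
  neighbourhood.\<close>

lemma lagrangian_chain:
  fixes L :: "('n::finite) lagr"
  assumes L: "lagrangian M k1 k2 L" and M: "open M" "p \<in> M"
    and lor: "lorentzian (\<gamma> 0)" and riem: "riemannian (\<lambda>i j. \<gamma> 0 (Some i) (Some j))"
    and ten: "\<And>s. \<tau> s \<in> tenvals k1 k2" "\<And>s a. d s a \<in> tenvals k1 k2" "\<And>s a b. \<gamma> s a b = \<gamma> s b a"
    and d\<tau>: "\<And>us ls. length us = k1 \<Longrightarrow> length ls = k2 \<Longrightarrow> ((\<lambda>s. \<tau> s us ls) has_field_derivative \<tau>' us ls) (at 0)"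
    and dd: "\<And>a us ls. length us = k1 \<Longrightarrow> length ls = k2 \<Longrightarrow> ((\<lambda>s. d s a us ls) has_field_derivative d' a us ls) (at 0)"
    and dg: "\<And>a b. ((\<lambda>s. \<gamma> s a b) has_field_derivative \<gamma>' a b) (at 0)"
    and P: "P = Lpart k1 k2 L p (\<tau> 0) (d 0) (\<gamma> 0)"
  shows "((\<lambda>s. L p (\<tau> s) (d s) (\<gamma> s)) has_field_derivative
     tpair k1 k2 (\<lambda>us ls. P (JT us ls)) \<tau>' + (\<Sum>a\<in>UNIV. tpair k1 k2 (\<lambda>us ls. P (JD a us ls)) (d' a))
      + (\<Sum>a\<in>UNIV. \<Sum>b\<in>UNIV. P (JG a b) * \<gamma>' a b)) (at 0)"
proof -
  define U where "U = {v. (\<chi> a. v (JP a)) \<in> M \<and> lorentzian (\<lambda>a b. (v (JG a b) + v (JG b a)) / 2)}"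
  have cs: "csmooth (jcoords k1 k2) U (jet_lag k1 k2 L)" using L by (simp add: lagrangian_def U_def)
  define v where "v s = jetv p (\<tau> s) (d s) (\<gamma> s)" for s
  define v' where "v' = jetv 0 \<tau>' d' \<gamma>'"
  obtain r where r: "r > 0" "\<And>w. (\<forall>c\<in>jcoords k1 k2. \<bar>w c - v 0 c\<bar> < r) \<Longrightarrow> w \<in> U"
    using jet_region_nbhd[OF M lor riem, of k1 k2 "\<tau> 0" "d 0"] unfolding U_def v_def by blast
  have "((\<lambda>s. jet_lag k1 k2 L (v s)) has_field_derivative (\<Sum>c\<in>jcoords k1 k2. cpd c (jet_lag k1 k2 L) (v 0) * v' c)) (at 0)"
  proof (rule csmooth_chain[OF cs r(1)])
    show "w \<in> U" if "\<And>c. c \<in> jcoords k1 k2 \<Longrightarrow> \<bar>w c - v 0 c\<bar> < r" for w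
      using r(2) that by blast
    show "((\<lambda>s. v s c) has_field_derivative v' c) (at 0)" if "c \<in> jcoords k1 k2" for c
      using that d\<tau> dd dg by (auto simp: jcoords_def v_def v'_def)
    show "v s c = v 0 c" if "c \<notin> jcoords k1 k2" for s c
      using that ten by (cases c) (auto simp: jcoords_def v_def tenvals_def)
  qed
  moreover have "jet_lag k1 k2 L (v s) = L p (\<tau> s) (d s) (\<gamma> s)" for s
    unfolding v_def by (rule jet_lag_jetv) (use ten in auto)
  moreover have "(\<Sum>c\<in>jcoords k1 k2. cpd c (jet_lag k1 k2 L) (v 0) * v' c) =
     tpair k1 k2 (\<lambda>us ls. P (JT us ls)) \<tau>' + (\<Sum>a\<in>UNIV. tpair k1 k2 (\<lambda>us ls. P (JD a us ls)) (d' a))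
      + (\<Sum>a\<in>UNIV. \<Sum>b\<in>UNIV. P (JG a b) * \<gamma>' a b)"
    by (simp add: sum_jcoords v'_def v_def P Lpart_def tpair_def)
  ultimately show ?thesis by simp
qed

text \<open>Continuity of the coefficients in the point makes the integrands over slices continuous,
  which is what allows Fubini and the localization in time.\<close>

lemma Lpart_continuous:
  fixes L :: "('n::finite) lagr"
  assumes L: "lagrangian M k1 k2 L" and c: "c \<in> jcoords k1 k2"
    and lor: "\<And>p. p \<in> M \<Longrightarrow> lorentzian (\<gamma> p)"
    and cont: "\<And>us ls. continuous_on M (\<lambda>p. \<tau> p us ls)" "\<And>a us ls. continuous_on M (\<lambda>p. d p a us ls)"
      "\<And>a b. continuous_on M (\<lambda>p. \<gamma> p a b)"
  shows "continuous_on M (\<lambda>p. Lpart k1 k2 L p (\<tau> p) (d p) (\<gamma> p) c)"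
proof -
  define U where "U = {v. (\<chi> a. v (JP a)) \<in> M \<and> lorentzian (\<lambda>a b. (v (JG a b) + v (JG b a)) / 2)}"
  define v where "v p = jetv p (\<tau> p) (d p) (\<gamma> p)" for p
  have cs: "csmooth (jcoords k1 k2) U (jet_lag k1 k2 L)" using L by (simp add: lagrangian_def U_def)
  have fin: "finite (jcoords k1 k2 :: 'n jc set)" using cs by (simp add: csmooth_def)
  have cc: "ccont_on (jcoords k1 k2) U (cpd c (jet_lag k1 k2 L))"
    using cs c unfolding csmooth_def
    by (metis empty_set empty_subsetI insert_subset itcpd.simps list.simps(15))
  have vU: "v p \<in> U" if "p \<in> M" for p
  proof -
    have "\<gamma> p a b = \<gamma> p b a" for a b using lor[OF that] unfolding lorentzian_def by blast
    then have "(\<lambda>a b. (\<gamma> p a b + \<gamma> p b a) / 2) = \<gamma> p" by (simp add: fun_eq_iff)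
    then show ?thesis using that lor[OF that] by (simp add: U_def v_def)
  qed
  have vc: "continuous_on M (\<lambda>p. v p c)" for c
    by (cases c) (auto simp: v_def cont intro!: continuous_intros)
  show ?thesis
    unfolding continuous_on_iff Lpart_def v_def[symmetric]
  proof (intro ballI allI impI)
    fix p and e :: real assume p: "p \<in> M" and e: "e > 0"
    obtain d where d: "d > 0" "\<And>w. w \<in> U \<Longrightarrow> \<forall>c\<in>jcoords k1 k2. \<bar>w c - v p c\<bar> < d \<Longrightarrow>
        \<bar>cpd c (jet_lag k1 k2 L) w - cpd c (jet_lag k1 k2 L) (v p)\<bar> < e"
      using cc vU[OF p] e unfolding ccont_on_def by blast
    have "\<forall>\<^sub>F q in at p within M. \<forall>c\<in>jcoords k1 k2. \<bar>v q c - v p c\<bar> < d"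
    proof -
      have "\<forall>\<^sub>F q in at p within M. \<bar>v q c - v p c\<bar> < d" for c
        using vc[of c] p tendstoD[OF _ d(1), of "\<lambda>p. v p c" "v p c" "at p within M"]
        by (simp add: continuous_on_def dist_real_def)
      then show ?thesis by (simp add: eventually_ball_finite_distrib[OF fin])
    qed
    then obtain r where r: "r > 0" "\<And>q. q \<in> M \<Longrightarrow> q \<noteq> p \<Longrightarrow> dist q p < r \<Longrightarrow> \<forall>c\<in>jcoords k1 k2. \<bar>v q c - v p c\<bar> < d"
      unfolding eventually_at by blast
    show "\<exists>r>0. \<forall>q\<in>M. dist q p < r \<longrightarrow> dist (cpd c (jet_lag k1 k2 L) (v q)) (cpd c (jet_lag k1 k2 L) (v p)) < e"
    proof (intro exI[of _ r] conjI ballI impI r(1))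
      fix q assume q: "q \<in> M" "dist q p < r"
      show "dist (cpd c (jet_lag k1 k2 L) (v q)) (cpd c (jet_lag k1 k2 L) (v p)) < e"
      proof (cases "q = p")
        case False
        then show ?thesis using d(2)[OF vU[OF q(1)] r(2)[OF q(1) False q(2)]] by (simp add: dist_real_def)
      qed (use e in simp)
    qed
  qed
qed

subsection \<open>Diffeomorphisms fixing a point\<close>

lemma matrix_inv_eqI:
  fixes A B :: "real ^ 'a::finite ^ 'a"
  assumes "A ** B = mat 1" "B ** A = mat 1"
  shows "matrix_inv A = B"
proof -
  have "A ** matrix_inv A = mat 1 \<and> matrix_inv A ** A = mat 1"
    unfolding matrix_inv_def by (rule someI[where x = B]) (use assms in auto)
  then show ?thesis by (metis assms(2) matrix_mul_assoc matrix_mul_lid matrix_mul_rid)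
qed

lemma pdir_axis_sum:
  fixes f :: "real ^ 'a::finite \<Rightarrow> real"
  assumes "f differentiable (at p)"
  shows "(f has_derivative (\<lambda>h. \<Sum>c\<in>UNIV. h $ c * pdir (axis c 1) f p)) (at p)"
proof -
  let ?D = "frechet_derivative f (at p)"
  have D: "(f has_derivative ?D) (at p)" by (rule has_derivative_frechet[OF assms])
  then have l: "linear ?D" by (rule has_derivative_linear)
  have "?D h = (\<Sum>c\<in>UNIV. h $ c * pdir (axis c 1) f p)" for h
  proof -
    have "?D h = ?D (\<Sum>c\<in>UNIV. h $ c *\<^sub>R axis c 1)"
      using basis_expansion[of h] by (simp add: scalar_mult_eq_scaleR)
    also have "\<dots> = (\<Sum>c\<in>UNIV. h $ c * pdir (axis c 1) f p)"
      by (simp add: linear_sum[OF l] linear_cmul[OF l] pdir_def)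
    finally show ?thesis .
  qed
  then show ?thesis using D by presburger
qed

text \<open>A continuous sign on a connected set is constant. Hence a diffeomorphism between subsets
  of one ball preserves orientation as soon as its Jacobian determinant is positive.\<close>

lemma ball_orientation_const:
  assumes ori: "orientation M ori" and U: "ball p e \<subseteq> M" and q: "q \<in> ball p e" "q' \<in> ball p e"
  shows "ori q = ori q'"
proof -
  have "connected (ori ` ball p e)"
    using ori U unfolding orientation_def
    by (intro connected_continuous_image) (auto intro: continuous_on_subset)
  moreover have "ori ` ball p e \<subseteq> {1, -1}" using ori U unfolding orientation_def by auto
  then have "finite (ori ` ball p e)" by (rule finite_subset) simp
  ultimately obtain x where "ori ` ball p e = {x} \<or> ori ` ball p e = {}"
    using connected_finite_iff_sing[of "ori ` ball p e"] by blast
  then show ?thesis using q by (metis empty_iff imageI singletonD)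
qed

text \<open>The generator is (t - t_p) times an affine function times \<partial>_i, where
  \<open>w0\<close> is the value of the affine function at p and \<open>w\<close> its gradient.
  Constant weights will give the momentum identity, purely linear ones the relations between
  fluxes.\<close>

locale shear =
  fixes p :: "('n::finite) pt" and i :: 'n and w0 :: real and w :: "'n option \<Rightarrow> real"
begin

definition tau :: "'n pt \<Rightarrow> real" where "tau q = q $ None - p $ None"

definition aff :: "'n pt \<Rightarrow> real" where
  "aff q = tau q * (w0 + (\<Sum>b\<in>UNIV - {Some i}. w b * (q $ b - p $ b)))"

text \<open>To first order in \<open>s\<close>, \<open>fwd s\<close> moves the coordinate \<open>i\<close> by
  \<open>s (t - t\<^sub>p) (w0 + \<Sum>\<^sub>b w\<^sub>b (q\<^sub>b - p\<^sub>b))\<close>; the exponential takes care of the term \<open>b = i\<close>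
  and keeps the inverse \<open>bwd s\<close> explicit.\<close>

definition fwd :: "real \<Rightarrow> 'n pt \<Rightarrow> 'n pt" where
  "fwd s q = (\<chi> b. if b = Some i then p $ Some i + (q $ Some i - p $ Some i) * exp (s * w (Some i) * tau q) + s * aff q else q $ b)"

definition bwd :: "real \<Rightarrow> 'n pt \<Rightarrow> 'n pt" where
  "bwd s q = (\<chi> b. if b = Some i then p $ Some i + (q $ Some i - p $ Some i - s * aff q) * exp (- (s * w (Some i) * tau q)) else q $ b)"

text \<open>Neither function depends on the coordinate i, the only one that is moved. Both are
  therefore invariant under \<open>fwd\<close> and \<open>bwd\<close>, which makes these maps affine
  in that coordinate and inverse to each other.\<close>

lemma tau_aff_cong: "(\<And>b. b \<noteq> Some i \<Longrightarrow> q $ b = q' $ b) \<Longrightarrow> tau q = tau q' \<and> aff q = aff q'"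
  by (simp add: tau_def aff_def)

lemma tau_aff_fwd [simp]: "tau (fwd s q) = tau q" "aff (fwd s q) = aff q"
  using tau_aff_cong[of "fwd s q" q] by (simp_all add: fwd_def)

lemma tau_aff_bwd [simp]: "tau (bwd s q) = tau q" "aff (bwd s q) = aff q"
  using tau_aff_cong[of "bwd s q" q] by (simp_all add: bwd_def)

lemma bwd_fwd [simp]: "bwd s (fwd s q) = q"
  by (subst bwd_def) (simp add: vec_eq_iff, simp add: fwd_def exp_minus mult.assoc)

lemma fwd_bwd [simp]: "fwd s (bwd s q) = q"
  by (subst fwd_def) (simp add: vec_eq_iff, simp add: bwd_def exp_minus mult.assoc)

lemma fwd_p [simp]: "fwd s p = p"
  by (simp add: fwd_def aff_def tau_def vec_eq_iff)

lemma Csmooth_coord: "Csmooth_on UNIV (\<lambda>q. q $ b :: real)"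
  by (intro Csmooth_on_bounded_linear bounded_linear_vec_nth open_UNIV)

lemma Csmooth_tau: "Csmooth_on UNIV tau"
  unfolding tau_def by (intro Csmooth_on_diff Csmooth_coord Csmooth_on_const open_UNIV)

lemma Csmooth_aff: "Csmooth_on UNIV aff"
  unfolding aff_def
  by (intro Csmooth_on_diff Csmooth_coord Csmooth_on_const Csmooth_on_mult Csmooth_tau Csmooth_on_add
      Csmooth_on_sum open_UNIV) simp

lemma Csmooth_fwd: "Csmooth_on UNIV (\<lambda>q. fwd s q $ b)"
  unfolding fwd_def
  by (cases "b = Some i")
    (auto intro!: Csmooth_on_add Csmooth_on_mult Csmooth_on_diff Csmooth_coord Csmooth_on_const
      Csmooth_tau Csmooth_aff Csmooth_on_comp_real[OF _ Csmooth_exp])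

lemma Csmooth_bwd: "Csmooth_on UNIV (\<lambda>q. bwd s q $ b)"
  unfolding bwd_def
  by (cases "b = Some i")
    (auto intro!: Csmooth_on_add Csmooth_on_mult Csmooth_on_diff Csmooth_coord Csmooth_on_const
      Csmooth_on_minus Csmooth_tau Csmooth_aff Csmooth_on_comp_real[OF _ Csmooth_exp])

lemma continuous_fwd: "continuous_on UNIV (fwd s)" and continuous_bwd: "continuous_on UNIV (bwd s)"
proof -
  have "continuous_on UNIV (\<lambda>q. \<chi> b. fwd s q $ b)" "continuous_on UNIV (\<lambda>q. \<chi> b. bwd s q $ b)"
    by (intro continuous_on_vec_lambda Csmooth_on_continuous[OF Csmooth_fwd]
        Csmooth_on_continuous[OF Csmooth_bwd] open_UNIV)+
  then show "continuous_on UNIV (fwd s)" "continuous_on UNIV (bwd s)" by simp_all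
qed

text \<open>The gradient of the coordinate i of \<open>fwd s\<close>. It is the only row in which
  the Jacobian \<open>jacf\<close> differs from the identity, so the inverse \<open>invf\<close> is
  explicit as well.\<close>

definition grad :: "real \<Rightarrow> 'n pt \<Rightarrow> 'n option \<Rightarrow> real" where
  "grad s q b = (if b = Some i then exp (s * w (Some i) * tau q)
     else if b = None then (q $ Some i - p $ Some i) * exp (s * w (Some i) * tau q) * (s * w (Some i))
        + s * (w0 + (\<Sum>c\<in>UNIV - {Some i}. w c * (q $ c - p $ c))) + s * tau q * w None
     else s * tau q * w b)"

definition jacf :: "real \<Rightarrow> 'n pt \<Rightarrow> 'n option \<Rightarrow> 'n option \<Rightarrow> real" where
  "jacf s q c a = (if c = Some i then grad s q a else idm c a)"

definition invf :: "real \<Rightarrow> 'n pt \<Rightarrow> 'n option \<Rightarrow> 'n option \<Rightarrow> real" where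
  "invf s q c a = (if c = Some i then if a = Some i then exp (- (s * w (Some i) * tau q))
      else - grad s q a * exp (- (s * w (Some i) * tau q)) else idm c a)"

lemma jac_fwd: "jac (fwd s) q $ c $ a = jacf s q c a"
proof (cases "c = Some i")
  case True
  have d: "((\<lambda>q. fwd s q $ Some i) has_derivative (\<lambda>h. h $ Some i * exp (s * w (Some i) * tau q)
      + (q $ Some i - p $ Some i) * (exp (s * w (Some i) * tau q) * (s * w (Some i) * h $ None))
      + s * (h $ None * (w0 + (\<Sum>c\<in>UNIV - {Some i}. w c * (q $ c - p $ c)))
          + tau q * (\<Sum>c\<in>UNIV - {Some i}. w c * h $ c)))) (at q)"
    unfolding fwd_def aff_def tau_def
    by (auto intro!: derivative_eq_intros bounded_linear.has_derivative[OF bounded_linear_vec_nth]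
        simp: algebra_simps fun_eq_iff sum_distrib_left sum.distrib sum_subtractf)
  have sd: "(\<Sum>c\<in>UNIV - {Some i}. w c * axis a 1 $ c) = (if a = Some i then 0 else w a)"
    by (simp add: axis_def if_distrib[of "\<lambda>x. _ * x"] sum.delta' cong: if_cong)
  have "jac (fwd s) q $ c $ a = pdir (axis a 1) (\<lambda>q. fwd s q $ Some i) q"
    by (simp add: jac_def pd_def True)
  also have "\<dots> = grad s q a"
    unfolding pdir_eqI[OF d] sd by (simp add: grad_def axis_def algebra_simps)
  finally show ?thesis by (simp add: jacf_def True)
next
  case False
  have "jac (fwd s) q $ c $ a = pdir (axis a 1) (\<lambda>q. q $ c) q"
    using False by (simp add: jac_def pd_def fwd_def)
  also have "\<dots> = axis a 1 $ c"
    by (rule pdir_eqI) (rule bounded_linear_imp_has_derivative[OF bounded_linear_vec_nth])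
  finally show ?thesis using False by (auto simp: jacf_def axis_def idm_def)
qed

lemma invf_jacf: "mm (invf s q) (jacf s q) = idm" and jacf_invf: "mm (jacf s q) (invf s q) = idm"
proof -
  have split: "(\<Sum>c\<in>UNIV. F c) = F (Some i) + (\<Sum>c\<in>UNIV - {Some i}. F c)" for F :: "'n option \<Rightarrow> real"
    by (simp add: sum.remove)
  have sd: "(\<Sum>c\<in>UNIV - {Some i}. F c * idm c b) = (if b = Some i then 0 else F b)" for F b
    by (simp add: idm_def if_distrib[of "\<lambda>x. _ * x"] sum.delta cong: if_cong)
  have grad_i: "grad s q (Some i) = exp (s * w (Some i) * tau q)" by (simp add: grad_def)
  have *: "(\<Sum>c\<in>UNIV - {Some i}. F c * (if c = Some i then G c else H c)) = (\<Sum>c\<in>UNIV - {Some i}. F c * H c)"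
    "(\<Sum>c\<in>UNIV - {Some i}. (if c = Some i then G c else H c) * F c) = (\<Sum>c\<in>UNIV - {Some i}. H c * F c)" for F G H :: "'n option \<Rightarrow> real"
    by (auto intro!: sum.cong)
  show "mm (invf s q) (jacf s q) = idm"
  proof (intro ext)
    fix a b
    show "mm (invf s q) (jacf s q) a b = idm a b"
    proof (cases "a = Some i")
      case True
      show ?thesis
        by (simp add: mm_def split[of "\<lambda>c. _ c * _ c"] jacf_def invf_def True *)
          (simp add: sum_negf sd grad_i, simp add: idm_def exp_minus mult.assoc)
    next
      case False
      have "mm (invf s q) (jacf s q) a b = (\<Sum>c\<in>UNIV. idm a c * jacf s q c b)"
        using False by (simp add: mm_def invf_def)
      then show ?thesis using False by (simp add: jacf_def)
    qed
  qed
  show "mm (jacf s q) (invf s q) = idm"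
  proof (intro ext)
    fix a b
    show "mm (jacf s q) (invf s q) a b = idm a b"
    proof (cases "a = Some i")
      case True
      show ?thesis
        by (simp add: mm_def split[of "\<lambda>c. _ c * _ c"] jacf_def invf_def True *)
          (simp add: sum_negf sd grad_i, simp add: idm_def exp_minus mult.assoc)
    next
      case False
      have "mm (jacf s q) (invf s q) a b = (\<Sum>c\<in>UNIV. idm a c * invf s q c b)"
        using False by (simp add: mm_def jacf_def)
      then show ?thesis using False by (simp add: invf_def)
    qed
  qed
qed

lemma matrix_inv_jac: "matrix_inv (jac (fwd s) q) $ a $ b = invf s q a b"
proof -
  have "matrix_inv (jac (fwd s) q) = (\<chi> a b. invf s q a b)"
    using fun_cong[OF fun_cong[OF invf_jacf]] fun_cong[OF fun_cong[OF jacf_invf]]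
    by (intro matrix_inv_eqI) (simp_all add: matrix_matrix_mult_def vec_eq_iff jac_fwd mat_def mm_def idm_def)
  then show ?thesis by simp
qed

lemma det_jac: "det (jac (fwd s) q) = exp (s * w (Some i) * tau q)"
proof -
  define x :: "'n pt" where "x = (\<chi> a. grad s q a)"
  \<comment> \<open>The row i is written as a combination of the rows of the identity, so that the
    determinant is read off from the lemma behind Cramer's rule: it is the diagonal entry.\<close>
  have "(\<Sum>a\<in>UNIV. x $ a *s row a (mat 1 :: real ^ 'n option ^ 'n option)) = x"
    by (simp add: row_def mat_def vec_eq_iff if_distrib[of "\<lambda>x. _ * x"] cong: if_cong)
  then have "jac (fwd s) q = (\<chi> c. if c = Some i then (\<Sum>a\<in>UNIV. x $ a *s row a (mat 1))
      else row c (mat 1))"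
    by (simp add: vec_eq_iff jac_fwd jacf_def x_def row_def mat_def idm_def)
  then have "det (jac (fwd s) q) = x $ Some i * det (mat 1 :: real ^ 'n option ^ 'n option)"
    by (simp only: cramer_lemma_transpose)
  then show ?thesis by (simp add: x_def grad_def)
qed

text \<open>The point p is fixed and the Jacobian determinant there is 1, because the exponent
  carries the factor t - t_p. Invariance of the top form thus becomes equality of two values of L at
  p.\<close>

lemma invariance:
  assumes M: "open M" "p \<in> M" and ori: "orientation M ori"
    and inv: "diffeo_invariant M ori k1 k2 L"
    and T: "tfield k1 k2 M T" and g: "lor_metric M g"
  shows "L p (T p) (dT T p) (g p) =
    L p (pbT k1 k2 (fwd s) T p) (dT (pbT k1 k2 (fwd s) T) p) (pbg (fwd s) g p)"
proof -
  obtain e where e: "e > 0" "ball p e \<subseteq> M" using M openE by blast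
  \<comment> \<open>Both a point and its image stay in a ball inside M, on which the orientation
    sign is constant.\<close>
  define U1 where "U1 = ball p e \<inter> fwd s -` ball p e"
  define U2 where "U2 = ball p e \<inter> bwd s -` ball p e"
  have o: "open U1" "open U2"
    using continuous_on_open_vimage[OF open_UNIV] continuous_fwd[of s] continuous_bwd[of s]
    unfolding U1_def U2_def by (auto intro!: open_Int simp: Int_commute)
  have sub: "U1 \<subseteq> M" "U2 \<subseteq> M" using e(2) by (auto simp: U1_def U2_def)
  have "bij_betw (fwd s) U1 U2"
    by (rule bij_betwI[where g = "bwd s"]) (auto simp: U1_def U2_def)
  moreover have "\<exists>\<Phi>. (\<forall>q\<in>U2. \<Phi> q \<in> U1 \<and> fwd s (\<Phi> q) = q) \<and> (\<forall>c. Csmooth_on U2 (\<lambda>q. \<Phi> q $ c))"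
    by (intro exI[of _ "bwd s"]) (auto simp: U1_def U2_def intro: Csmooth_on_subset[OF Csmooth_bwd])
  ultimately have "diffeo U1 U2 (fwd s)"
    using o by (auto simp: diffeo_def intro: Csmooth_on_subset[OF Csmooth_fwd])
  moreover have "or_pres ori U1 (fwd s)"
    unfolding or_pres_def det_jac
  proof
    fix q assume q: "q \<in> U1"
    then have "ori (fwd s q) = ori q"
      by (intro ball_orientation_const[OF ori e(2)]) (auto simp: U1_def)
    moreover have "ori q = 1 \<or> ori q = -1" using q sub ori by (auto simp: orientation_def)
    ultimately show "0 < ori (fwd s q) * exp (s * w (Some i) * tau q) * ori q" by auto
  qed
  moreover have "tfield k1 k2 U2 T" "lor_metric U2 g"
    using T g sub Csmooth_on_subset unfolding tfield_def lor_metric_def by blast+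
  moreover have "p \<in> U1" using e(1) by (simp add: U1_def)
  ultimately have "det (jac (fwd s) p) * L (fwd s p) (T (fwd s p)) (dT T (fwd s p)) (g (fwd s p)) =
    L p (pbT k1 k2 (fwd s) T p) (dT (pbT k1 k2 (fwd s) T) p) (pbg (fwd s) g p)"
    using inv sub unfolding diffeo_invariant_def by blast
  then show ?thesis by (simp add: det_jac tau_def)
qed

end

subsection \<open>The infinitesimal invariance identity\<close>

text \<open>The elementary matrices; \<open>el (Some i) None\<close> is the endomorphism
  \<partial>_i \<otimes> dt.\<close>

definition el :: "'a \<Rightarrow> 'a \<Rightarrow> 'a \<Rightarrow> 'a \<Rightarrow> real" where
  "el a b c d = (if c = a \<and> d = b then 1 else 0)"

lemma sum_el [simp]:
  fixes F :: "'a::finite \<Rightarrow> real"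
  shows "(\<Sum>c\<in>UNIV. F c * el x y c a) = (if a = y then F x else 0)"
  by (simp add: el_def if_distrib[of "\<lambda>x. _ * x"] cong: if_cong)

lemma sum_axis: "(\<Sum>c\<in>UNIV. axis a 1 $ c * f c) = (f a :: real)"
  by (simp add: axis_def if_distrib[of "\<lambda>x. x * _"] cong: if_cong)

lemma pdir_const: "pdir v (\<lambda>x. c) x = 0"
  by (rule pdir_eqI[of _ "\<lambda>_. 0", simplified]) simp

lemma pd_comp:
  fixes \<Phi> :: "('n::finite) pt \<Rightarrow> 'n pt"
  assumes "\<And>c. (\<lambda>x. \<Phi> x $ c) differentiable (at p)" "f differentiable (at (\<Phi> p))"
  shows "(\<lambda>x. f (\<Phi> x)) differentiable (at p)"
    "pd a (\<lambda>x. f (\<Phi> x)) p = (\<Sum>c\<in>UNIV. pd c f (\<Phi> p) * jac \<Phi> p $ c $ a)"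
proof -
  have B: "(Basis :: 'n pt set) = range (\<lambda>c. axis c 1)" by (auto simp: Basis_vec_def)
  have i: "inj (\<lambda>c :: 'n option. axis c (1 :: real))" by (auto simp: inj_on_def axis_eq_axis)
  have d: "(\<lambda>x. \<Phi> x \<bullet> b) differentiable (at p)" if "b \<in> Basis" for b
    using that assms(1) by (auto simp: B inner_axis)
  show "(\<lambda>x. f (\<Phi> x)) differentiable (at p)"
    by (rule pdir_comp(1)[OF d assms(2)])
  show "pd a (\<lambda>x. f (\<Phi> x)) p = (\<Sum>c\<in>UNIV. pd c f (\<Phi> p) * jac \<Phi> p $ c $ a)"
    using pdir_comp(2)[OF d assms(2), of "axis a 1"]
    by (simp add: pd_def jac_def B sum.reindex[OF i] inner_axis)
qed

context shear
begin

text \<open>The Hessian at p of t - t_p times the affine function, contracted with h in one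
  argument. The gradient of \<open>fwd s\<close> has derivative exactly s times this at p, since the
  higher terms of the exponential vanish there.\<close>

definition rho :: "'n pt \<Rightarrow> 'n option \<Rightarrow> real" where
  "rho h b = h $ None * w b + (if b = None then \<Sum>c\<in>UNIV. w c * h $ c else 0)"

text \<open>The second derivatives of the generator at p: the derivative in direction a of its
  Jacobian, which is supported in row i.\<close>

definition rot :: "'n option \<Rightarrow> 'n option \<Rightarrow> 'n option \<Rightarrow> real" where
  "rot a c e = (if c = Some i then (if a = None then w e else 0) + (if e = None then w a else 0) else 0)"

lemma rho_axis: "(if c = Some i then rho (axis a 1) e else 0) = rot a c e"
  by (simp add: rho_def rot_def axis_def if_distrib[of "\<lambda>x. _ * x"] cong: if_cong)

lemma tau_der: "(tau has_derivative (\<lambda>h. h $ None)) (at q)"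
  unfolding tau_def
  by (auto intro!: derivative_eq_intros bounded_linear.has_derivative[OF bounded_linear_vec_nth])

lemma tau_p [simp]: "tau p = 0" by (simp add: tau_def)

lemma grad_p: "grad s p b = (if b = Some i then 1 else if b = None then s * w0 else 0)"
  by (simp add: grad_def)

lemma jacf_p: "jacf s p a b = idm a b + s * w0 * el (Some i) None a b"
  by (auto simp: jacf_def grad_p idm_def el_def)

lemma invf_p: "invf s p a b = idm a b + (- s * w0) * el (Some i) None a b"
  by (auto simp: invf_def grad_p idm_def el_def)

lemma grad_der: "((\<lambda>q. grad s q b) has_derivative (\<lambda>h. s * rho h b)) (at p)"
proof -
  have nth: "((\<lambda>q. q $ c) has_derivative (\<lambda>h. h $ c)) (at p)" for c
    by (rule bounded_linear_imp_has_derivative[OF bounded_linear_vec_nth])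
  consider "b = Some i" | "b = None" | "b \<noteq> Some i" "b \<noteq> None" by blast
  then show ?thesis
  proof cases
    case 1
    then show ?thesis
      by (auto simp: grad_def rho_def intro!: derivative_eq_intros tau_der)
  next
    case 2
    have sp: "(\<Sum>c\<in>UNIV. w c * h $ c) = w (Some i) * h $ Some i + (\<Sum>c\<in>UNIV - {Some i}. w c * h $ c)" for h :: "'n pt"
      by (rule sum.remove) auto
    show ?thesis
      by (auto simp: grad_def rho_def 2 sp algebra_simps intro!: derivative_eq_intros tau_der nth)
  next
    case 3
    have "((\<lambda>q. (s * w b) * tau q) has_derivative (\<lambda>h. (s * w b) * h $ None)) (at p)"
      by (intro has_derivative_mult_right tau_der)
    then show ?thesis using 3(1)
      by (simp add: grad_def rho_def mult_ac if_not_P[OF 3(2)] del: not_None_eq)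
  qed
qed

text \<open>The sum has the shape Q C demanded by \<open>Act_has_derivative\<close>. Multiplying by
  the Jacobian at p changes nothing, because its column i is a unit vector and the derivative is
  supported in row i.\<close>

lemma jacf_der: "((\<lambda>q. jacf s q a b) has_derivative
    (\<lambda>h. \<Sum>e\<in>UNIV. jacf s p a e * (if e = Some i then s * rho h b else 0))) (at p)"
proof -
  have "(\<Sum>e\<in>UNIV. jacf s p a e * (if e = Some i then s * rho h b else 0)) = (if a = Some i then s * rho h b else 0)" for h
    by (simp add: if_distrib[of "\<lambda>x. _ * x"] cong: if_cong) (simp add: jacf_p idm_def el_def)
  moreover have "((\<lambda>q. jacf s q a b) has_derivative (\<lambda>h. if a = Some i then s * rho h b else 0)) (at p)"
    by (cases "a = Some i") (auto simp: jacf_def grad_der)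
  ultimately show ?thesis by simp
qed

text \<open>The rule -J^{-1} J' J^{-1} for the inverse, in the shape B P: here J^{-1} J' = J', since
  J' is supported in row i and the column i of J^{-1} at p is a unit vector.\<close>

lemma invf_der: "((\<lambda>q. invf s q a b) has_derivative
    (\<lambda>h. \<Sum>e\<in>UNIV. (if a = Some i then - (s * rho h e) else 0) * invf s p e b)) (at p)"
proof (cases "a = Some i")
  case True
  have e: "(\<Sum>e\<in>UNIV. - (s * rho h e) * invf s p e b) = - (s * rho h b) + (if b = None then s * rho h (Some i) * (s * w0) else 0)" for h
    unfolding invf_p distrib_left sum.distrib mult.left_commute[of _ "- s * w0"] sum_distrib_left[symmetric]
    by (simp add: sum_negf)
  have ex: "((\<lambda>q. exp (- (s * w (Some i) * tau q))) has_derivative (\<lambda>h. - (s * w (Some i) * h $ None))) (at p)"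
    by (auto intro!: derivative_eq_intros tau_der)
  have ri: "rho h (Some i) = w (Some i) * h $ None" for h by (simp add: rho_def)
  have eq: "(\<lambda>h. \<Sum>e\<in>UNIV. (if a = Some i then - (s * rho h e) else 0) * invf s p e b)
      = (\<lambda>h. - (s * rho h b) + (if b = None then s * rho h (Some i) * (s * w0) else 0))"
    by (simp only: True simp_thms if_True e)
  show ?thesis unfolding eq
  proof (cases "b = Some i")
    case True
    then show "((\<lambda>q. invf s q a b) has_derivative
       (\<lambda>h. - (s * rho h b) + (if b = None then s * rho h (Some i) * (s * w0) else 0))) (at p)"
      using \<open>a = Some i\<close> ex by (simp add: invf_def ri mult.assoc)
  next
    case False
    have "((\<lambda>q. - grad s q b * exp (- (s * w (Some i) * tau q))) has_derivative
       (\<lambda>h. - grad s p b * - (s * w (Some i) * h $ None) + - (s * rho h b) * exp (- (s * w (Some i) * tau p)))) (at p)"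
      by (intro has_derivative_mult has_derivative_minus grad_der ex)
    then show "((\<lambda>q. invf s q a b) has_derivative
       (\<lambda>h. - (s * rho h b) + (if b = None then s * rho h (Some i) * (s * w0) else 0))) (at p)"
      by (rule has_derivative_eq_rhs[THEN back_subst[of "\<lambda>f. (f has_derivative _) _"]])
        (use \<open>a = Some i\<close> False in \<open>auto simp: invf_def ri grad_p algebra_simps\<close>)
  qed
next
  case False
  then show ?thesis by (simp add: invf_def)
qed

lemma pbT_eq: "pbT k1 k2 (fwd s) T q = Act k1 k2 (invf s q) (jacf s q) (T (fwd s q))"
  by (intro ext) (simp add: pbT_def Act_def matrix_inv_jac jac_fwd)

text \<open>Two contributions to the derivative of the pullback: the transported derivative of T,
  where \<partial>_t picks up s w0 \<partial>_i from the chain rule, and the effect of the second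
  derivatives of the shear on the pulled-back tensor.\<close>

lemma dT_pbT:
  assumes T: "\<And>us ls. (\<lambda>q. T q us ls) differentiable (at p)"
  shows "dT (pbT k1 k2 (fwd s) T) p a us ls =
     Act k1 k2 (invf s p) (jacf s p) (\<lambda>us ls. dT T p a us ls + s * ((if a = None then w0 else 0) * dT T p (Some i) us ls)) us ls
     + s * lact (rot a) (Act k1 k2 (invf s p) (jacf s p) (T p)) us ls"
proof (cases "length us = k1 \<and> length ls = k2")
  case True
  define \<tau>' where "\<tau>' h us ls = (\<Sum>c\<in>UNIV. h $ c * pdir (axis c 1) (\<lambda>q. T (fwd s q) us ls) p)" for h us ls
  have fd: "(\<lambda>q. fwd s q $ c) differentiable (at p)" for c
    by (rule Csmooth_on_differentiable[OF Csmooth_fwd]) auto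
  have comp: "(\<lambda>q. T (fwd s q) us ls) differentiable (at p)"
    "pd a (\<lambda>q. T (fwd s q) us ls) p = dT T p a us ls + s * ((if a = None then w0 else 0) * dT T p (Some i) us ls)" for a us ls
  proof -
    show "(\<lambda>q. T (fwd s q) us ls) differentiable (at p)"
      using pd_comp(1)[OF fd, of "\<lambda>q. T q us ls"] T by simp
    show "pd a (\<lambda>q. T (fwd s q) us ls) p = dT T p a us ls + s * ((if a = None then w0 else 0) * dT T p (Some i) us ls)"
      using pd_comp(2)[OF fd, of "\<lambda>q. T q us ls" a] T
      unfolding jac_fwd jacf_p fwd_p
      by (simp add: distrib_left sum.distrib mult.left_commute[of _ "s * w0"] sum_distrib_left[symmetric] dT_def)
  qed
  have "((\<lambda>q. Act k1 k2 (invf s q) (jacf s q) (T (fwd s q)) us ls) has_derivative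
     (\<lambda>h. Act k1 k2 (invf s p) (jacf s p) (\<tau>' h) us ls +
       dact (\<lambda>c e. if c = Some i then - (s * rho h e) else 0) (\<lambda>c e. if c = Some i then s * rho h e else 0)
         (Act k1 k2 (invf s p) (jacf s p) (T (fwd s p))) us ls)) (at p)"
  proof (rule Act_has_derivative[OF invf_der jacf_der])
    show "((\<lambda>q. T (fwd s q) us ls) has_derivative (\<lambda>h. \<tau>' h us ls)) (at p)" for us ls
      unfolding \<tau>'_def by (rule pdir_axis_sum[OF comp(1)])
  qed (use True in auto)
  from pdir_eqI[OF this, of "axis a 1"]
  have "dT (pbT k1 k2 (fwd s) T) p a us ls = Act k1 k2 (invf s p) (jacf s p) (\<tau>' (axis a 1)) us ls +
       dact (\<lambda>c e. if c = Some i then - (s * rho (axis a 1) e) else 0) (\<lambda>c e. if c = Some i then s * rho (axis a 1) e else 0)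
         (Act k1 k2 (invf s p) (jacf s p) (T p)) us ls"
    by (simp add: dT_def pd_def pbT_eq)
  moreover have "\<tau>' (axis a 1) = (\<lambda>us ls. dT T p a us ls + s * ((if a = None then w0 else 0) * dT T p (Some i) us ls))"
    by (intro ext) (simp add: \<tau>'_def sum_axis comp(2)[unfolded pd_def])
  moreover have "(\<lambda>c e. if c = Some i then - (s * rho (axis a 1) e) else 0) = (\<lambda>c e. s * - rot a c e)"
    "(\<lambda>c e. if c = Some i then s * rho (axis a 1) e else 0) = (\<lambda>c e. s * rot a c e)"
    unfolding rho_axis[symmetric] by (auto simp: fun_eq_iff)
  ultimately show ?thesis by (simp only: dact_scale)
next
  case False
  then have "lact (rot a) (Act k1 k2 (invf s p) (jacf s p) (T p)) us ls = 0"
    using dact_in_tenvals[OF Act_in_tenvals[of k1 k2 "invf s p" "jacf s p" "T p"], of "\<lambda>b c. - rot a b c" "rot a"]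
    by (simp add: tenvals_def)
  moreover have "dT (pbT k1 k2 (fwd s) T) p a us ls = 0"
    unfolding dT_def pbT_eq pd_def
    using False by (auto simp: Act_def pdir_const)
  ultimately show ?thesis using False by (auto simp: Act_def)
qed

text \<open>By \<open>invariance\<close> the Lagrangian is constant along the pulled-back jets, so
  its derivative at s = 0 vanishes. The terms with \<open>w0\<close> come from the first derivatives
  of the generator at p and affect field, derivatives and metric; the terms with \<open>rot\<close>
  come from its second derivatives and reach only the derivatives of the field.\<close>

lemma noether:
  assumes M: "open M" "p \<in> M" and ori: "orientation M ori"
    and L: "lagrangian M k1 k2 L" and inv: "diffeo_invariant M ori k1 k2 L"
    and T: "tfield k1 k2 M T" and g: "lor_metric M g" and riem: "riemannian (\<lambda>i j. g p (Some i) (Some j))"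
    and P: "P = Lpart k1 k2 L p (T p) (dT T p) (g p)"
  shows "w0 * (tpair k1 k2 (\<lambda>us ls. P (JT us ls)) (lact (el (Some i) None) (T p))
      + (\<Sum>a\<in>UNIV. tpair k1 k2 (\<lambda>us ls. P (JD a us ls)) (lact (el (Some i) None) (dT T p a)))
      + tpair k1 k2 (\<lambda>us ls. P (JD None us ls)) (dT T p (Some i))
      + ((\<Sum>b\<in>UNIV. P (JG None b) * g p (Some i) b) + (\<Sum>a\<in>UNIV. P (JG a None) * g p a (Some i))))
    + (\<Sum>a\<in>UNIV. tpair k1 k2 (\<lambda>us ls. P (JD a us ls)) (lact (rot a) (T p))) = 0"
proof -
  have Tten: "T p \<in> tenvals k1 k2" using T by (simp add: tfield_def)
  have Tdiff: "(\<lambda>q. T q us ls) differentiable (at p)" for us ls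
    using T Csmooth_on_differentiable M unfolding tfield_def by blast
  have dTten: "dT T p a \<in> tenvals k1 k2" for a
  proof -
    have "dT T p a us ls = 0" if "\<not> (length us = k1 \<and> length ls = k2)" for us ls
    proof -
      have "T q us ls = 0" for q using T that by (auto simp: tfield_def tenvals_def)
      then show ?thesis
        by (simp add: dT_def pd_def pdir_const)
    qed
    then show ?thesis by (auto simp: tenvals_def)
  qed
  have lor: "lorentzian (g p)" using g M by (simp add: lor_metric_def)
  have sym: "g p a b = g p b a" for a b using lor unfolding lorentzian_def by blast
  define N where "N = (el (Some i) None :: 'n option \<Rightarrow> 'n option \<Rightarrow> real)"
  define A where "A s = Act k1 k2 (invf s p) (jacf s p)" for s
  define D where "D s a = (\<lambda>us ls. dT T p a us ls + s * ((if a = None then w0 else 0) * dT T p (Some i) us ls))" for s a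
  define \<tau> where "\<tau> s = A s (T p)" for s
  define d where "d s a = (\<lambda>us ls. A s (D s a) us ls + s * lact (rot a) (A s (T p)) us ls)" for s a
  define \<gamma> where "\<gamma> s a b = (\<Sum>c\<in>UNIV. \<Sum>e\<in>UNIV. g p c e * jacf s p c a * jacf s p e b)" for s a b
  have z: "invf 0 p = idm" "jacf 0 p = idm" by (simp_all add: fun_eq_iff invf_p jacf_p)
  have A0: "A 0 \<sigma> = \<sigma>" if "\<sigma> \<in> tenvals k1 k2" for \<sigma>
    using Act_idm[OF that] by (simp add: A_def z)
  have \<tau>0: "\<tau> 0 = T p" by (simp add: \<tau>_def A0 Tten)
  have D0: "D 0 a = dT T p a" for a by (simp add: D_def)
  have d0: "d 0 = dT T p" by (simp add: d_def D0 A0 dTten fun_eq_iff)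
  have \<gamma>0: "\<gamma> 0 = g p"
    by (intro ext) (simp add: \<gamma>_def z)
  have Ader: "((\<lambda>s. A s (\<sigma> s) us ls) has_derivative (\<lambda>h. h * (\<sigma>' us ls + w0 * lact N (\<sigma> 0) us ls))) (at 0)"
    if ls: "length us = k1" "length ls = k2" and \<sigma>0: "\<sigma> 0 \<in> tenvals k1 k2" and \<sigma>': "\<sigma>' \<in> tenvals k1 k2"
      and d: "\<And>us ls. ((\<lambda>s. \<sigma> s us ls) has_derivative (\<lambda>h. h * \<sigma>' us ls)) (at 0)" for \<sigma> \<sigma>' us ls
  proof -
    have "((\<lambda>s. Act k1 k2 (invf s p) (jacf s p) (\<sigma> s) us ls) has_derivative
      (\<lambda>h. Act k1 k2 (invf 0 p) (jacf 0 p) (\<lambda>us ls. h * \<sigma>' us ls) us ls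
         + dact (\<lambda>a b. (h * w0) * - N a b) (\<lambda>a b. (h * w0) * N a b) (Act k1 k2 (invf 0 p) (jacf 0 p) (\<sigma> 0)) us ls)) (at 0)"
      by (rule Act_has_derivative[OF _ _ d ls], unfold z sum_idm, unfold invf_p jacf_p N_def)
        (auto intro!: derivative_eq_intros)
    then show ?thesis
      unfolding dact_scale Act_scale z Act_idm[OF \<sigma>0] Act_idm[OF \<sigma>']
      by (simp add: A_def algebra_simps)
  qed
  have Aconst: "((\<lambda>s. A s \<sigma> us ls) has_derivative (\<lambda>h. h * (w0 * lact N \<sigma> us ls))) (at 0)"
    if \<sigma>: "\<sigma> \<in> tenvals k1 k2" for \<sigma> us ls
  proof (cases "length us = k1 \<and> length ls = k2")
    case True
    then show ?thesis using Ader[of us ls "\<lambda>_. \<sigma>" "\<lambda>_ _. 0"] \<sigma> by (simp add: tenvals_def)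
  next
    case False
    then have "A s \<sigma> us ls = 0" "lact N \<sigma> us ls = 0" for s
      using dact_in_tenvals[OF \<sigma>, of "\<lambda>a b. - N a b" N] by (auto simp: A_def Act_def tenvals_def)
    then show ?thesis by simp
  qed
  have "((\<lambda>s. L p (\<tau> s) (d s) (\<gamma> s)) has_field_derivative
     tpair k1 k2 (\<lambda>us ls. P (JT us ls)) (\<lambda>us ls. w0 * lact N (T p) us ls)
      + (\<Sum>a\<in>UNIV. tpair k1 k2 (\<lambda>us ls. P (JD a us ls))
          (\<lambda>us ls. ((if a = None then w0 else 0) * dT T p (Some i) us ls + w0 * lact N (dT T p a) us ls) + lact (rot a) (T p) us ls))
      + (\<Sum>a\<in>UNIV. \<Sum>b\<in>UNIV. P (JG a b) * (w0 * ((if a = None then g p (Some i) b else 0) + (if b = None then g p a (Some i) else 0))))) (at 0)"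
  proof (rule lagrangian_chain[OF L M])
    show "lorentzian (\<gamma> 0)" "riemannian (\<lambda>i j. \<gamma> 0 (Some i) (Some j))"
      using lor riem by (simp_all add: \<gamma>0)
    show "P = Lpart k1 k2 L p (\<tau> 0) (d 0) (\<gamma> 0)" by (simp add: P \<tau>0 d0 \<gamma>0)
    show "\<tau> s \<in> tenvals k1 k2" for s by (simp add: \<tau>_def A_def Act_in_tenvals)
    show "d s a \<in> tenvals k1 k2" for s a
      using Act_in_tenvals[of k1 k2 "invf s p" "jacf s p" "D s a"]
        dact_in_tenvals[OF Act_in_tenvals[of k1 k2 "invf s p" "jacf s p" "T p"], of "\<lambda>b c. - rot a b c" "rot a"]
      by (simp add: d_def A_def tenvals_def)
    show "\<gamma> s a b = \<gamma> s b a" for s a b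
      unfolding \<gamma>_def by (subst sum.swap) (simp add: sym mult_ac)
    show "((\<lambda>s. \<tau> s us ls) has_field_derivative w0 * lact N (T p) us ls) (at 0)" for us ls
      using Aconst[OF Tten] by (simp add: \<tau>_def has_field_derivative_def mult_commute_abs)
    show "((\<lambda>s. d s a us ls) has_field_derivative
        ((if a = None then w0 else 0) * dT T p (Some i) us ls + w0 * lact N (dT T p a) us ls) + lact (rot a) (T p) us ls) (at 0)"
      if ls: "length us = k1" "length ls = k2" for a us ls
    proof -
      have "((\<lambda>s. A s (D s a) us ls) has_derivative
          (\<lambda>h. h * ((if a = None then w0 else 0) * dT T p (Some i) us ls + w0 * lact N (D 0 a) us ls))) (at 0)"
        by (rule Ader[OF ls, where \<sigma>' = "\<lambda>us ls. (if a = None then w0 else 0) * dT T p (Some i) us ls"])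
          (use dTten in \<open>auto simp: D0 tenvals_def\<close>, auto simp: D_def intro!: derivative_eq_intros)
      then have 1: "((\<lambda>s. A s (D s a) us ls) has_field_derivative
          (if a = None then w0 else 0) * dT T p (Some i) us ls + w0 * lact N (dT T p a) us ls) (at 0)"
        by (simp add: D0 has_field_derivative_def mult_commute_abs)
      have "((\<lambda>s. lact (rot a) (A s (T p)) us ls) has_derivative
          (\<lambda>h. lact (rot a) (\<lambda>us ls. h * (w0 * lact N (T p) us ls)) us ls)) (at 0)"
        by (rule dact_has_derivative) (rule Aconst[OF Tten])
      then have 2: "((\<lambda>s. lact (rot a) (A s (T p)) us ls) has_field_derivative
          lact (rot a) (\<lambda>us ls. w0 * lact N (T p) us ls) us ls) (at 0)"
        unfolding dact_arg_scale by (simp add: has_field_derivative_def mult_commute_abs)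
      have 3: "((\<lambda>s. s * lact (rot a) (A s (T p)) us ls) has_field_derivative lact (rot a) (T p) us ls) (at 0)"
        using DERIV_mult[OF DERIV_ident 2] by (simp add: A0 Tten)
      show ?thesis unfolding d_def by (rule DERIV_add[OF 1 3])
    qed
    show "((\<lambda>s. \<gamma> s a b) has_field_derivative
       w0 * ((if a = None then g p (Some i) b else 0) + (if b = None then g p a (Some i) else 0))) (at 0)" for a b
    proof -
      have j: "((\<lambda>s. jacf s p c e) has_field_derivative w0 * N c e) (at 0)" for c e
        unfolding jacf_p N_def by (auto intro!: derivative_eq_intros)
      have "((\<lambda>s. \<gamma> s a b) has_field_derivative (\<Sum>c\<in>UNIV. \<Sum>e\<in>UNIV.
          (0 * jacf 0 p c a + w0 * N c a * g p c e) * jacf 0 p e b + w0 * N e b * (g p c e * jacf 0 p c a))) (at 0)"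
        unfolding \<gamma>_def by (intro DERIV_sum DERIV_mult DERIV_const j)
      also have "(\<Sum>c\<in>UNIV. \<Sum>e\<in>UNIV. (0 * jacf 0 p c a + w0 * N c a * g p c e) * jacf 0 p e b + w0 * N e b * (g p c e * jacf 0 p c a))
        = (\<Sum>c\<in>UNIV. \<Sum>e\<in>UNIV. w0 * (N c a * (g p c e * idm e b))) + (\<Sum>e\<in>UNIV. \<Sum>c\<in>UNIV. w0 * (N e b * (g p c e * idm c a)))"
        unfolding sum.distrib z by (subst (2) sum.swap) (simp add: mult_ac)
      also have "\<dots> = w0 * (\<Sum>c\<in>UNIV. g p c b * N c a) + w0 * (\<Sum>e\<in>UNIV. g p a e * N e b)"
        by (simp add: sum_distrib_left[symmetric] mult.commute[of "N _ _"] sum_distrib_right[symmetric])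
      also have "\<dots> = w0 * ((if a = None then g p (Some i) b else 0) + (if b = None then g p a (Some i) else 0))"
        unfolding N_def sum_el by (simp add: distrib_left)
      finally show ?thesis .
    qed
  qed
  moreover have "L p (\<tau> s) (d s) (\<gamma> s) = L p (T p) (dT T p) (g p)" for s
  proof -
    have "pbT k1 k2 (fwd s) T p = \<tau> s" by (simp add: pbT_eq \<tau>_def A_def)
    moreover have "dT (pbT k1 k2 (fwd s) T) p = d s"
      by (intro ext) (simp add: dT_pbT[OF Tdiff] d_def A_def D_def)
    moreover have "pbg (fwd s) g p = \<gamma> s" by (intro ext) (simp add: pbg_def \<gamma>_def jac_fwd)
    ultimately show ?thesis using invariance[OF M ori inv T g, of s] by simp
  qed
  ultimately have 0: "tpair k1 k2 (\<lambda>us ls. P (JT us ls)) (\<lambda>us ls. w0 * lact N (T p) us ls)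
      + (\<Sum>a\<in>UNIV. tpair k1 k2 (\<lambda>us ls. P (JD a us ls))
          (\<lambda>us ls. ((if a = None then w0 else 0) * dT T p (Some i) us ls + w0 * lact N (dT T p a) us ls) + lact (rot a) (T p) us ls))
      + (\<Sum>a\<in>UNIV. \<Sum>b\<in>UNIV. P (JG a b) * (w0 * ((if a = None then g p (Some i) b else 0) + (if b = None then g p a (Some i) else 0)))) = 0"
    by (simp add: DERIV_unique[OF _ DERIV_const])
  have "(\<Sum>a\<in>UNIV. (if a = None then w0 else 0) * tpair k1 k2 (\<lambda>us ls. P (JD a us ls)) (dT T p (Some i)))
     = w0 * tpair k1 k2 (\<lambda>us ls. P (JD None us ls)) (dT T p (Some i))"
    by (simp add: if_distrib[of "\<lambda>x. x * _"] cong: if_cong)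
  moreover have "(\<Sum>a\<in>UNIV. \<Sum>b\<in>UNIV. P (JG a b) * (w0 * ((if a = None then g p (Some i) b else 0) + (if b = None then g p a (Some i) else 0))))
     = w0 * ((\<Sum>b\<in>UNIV. P (JG None b) * g p (Some i) b) + (\<Sum>a\<in>UNIV. P (JG a None) * g p a (Some i)))"
  proof -
    have "P (JG a b) * (w0 * ((if a = None then g p (Some i) b else 0) + (if b = None then g p a (Some i) else 0)))
      = w0 * (if a = None then P (JG a b) * g p (Some i) b else 0) + w0 * (if b = None then P (JG a b) * g p a (Some i) else 0)" for a b
      by (simp add: algebra_simps)
    moreover have "(\<Sum>a\<in>UNIV. \<Sum>b\<in>UNIV. if a = None then P (JG a b) * g p (Some i) b else 0) = (\<Sum>b\<in>UNIV. P (JG None b) * g p (Some i) b)"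
      by (subst sum.swap) simp
    moreover have "(\<Sum>a\<in>UNIV. \<Sum>b\<in>UNIV. if b = None then P (JG a b) * g p a (Some i) else 0) = (\<Sum>a\<in>UNIV. P (JG a None) * g p a (Some i))"
      by simp
    ultimately show ?thesis by (simp only: sum.distrib sum_distrib_left[symmetric] distrib_left)
  qed
  ultimately show ?thesis
    using 0 unfolding tpair_add tpair_scale sum.distrib N_def
    by (simp add: sum_distrib_left[symmetric] algebra_simps)
qed

end

subsection \<open>Stationarity\<close>

text \<open>The setting of the off-shell identities. Stationarity enters as a hypothesis of
  \<open>stationary_variation\<close>.\<close>

locale matter =
  fixes M :: "('n::finite) pt set" and ori :: "'n pt \<Rightarrow> real" and k1 k2 :: nat and L :: "'n lagr"
    and g :: "'n pt \<Rightarrow> 'n option \<Rightarrow> 'n option \<Rightarrow> real" and T :: "'n pt \<Rightarrow> 'n ten"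
  assumes open_M: "open M" and ori: "orientation M ori" and lagr: "lagrangian M k1 k2 L"
    and inv: "diffeo_invariant M ori k1 k2 L" and metric: "slice_compatible M g"
    and T: "tfield k1 k2 M T"
begin

definition EL :: "'n pt \<Rightarrow> 'n jc \<Rightarrow> real" where
  "EL p = Lpart k1 k2 L p (T p) (dT T p) (g p)"

text \<open>\<open>force p \<sigma> + (\<Sum>a. flux p a (dT \<sigma> p a))\<close> is the linearization of the Lagrangian at \<open>p\<close> under the
  variation \<open>\<sigma>\<close> of the field.\<close>

definition force :: "'n pt \<Rightarrow> 'n ten \<Rightarrow> real" where
  "force p = tpair k1 k2 (\<lambda>us ls. EL p (JT us ls))"

definition flux :: "'n pt \<Rightarrow> 'n option \<Rightarrow> 'n ten \<Rightarrow> real" where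
  "flux p a = tpair k1 k2 (\<lambda>us ls. EL p (JD a us ls))"

text \<open>The derivative of the Lagrangian in the metric along dt \<otimes> g(\<partial>_i, .)
  plus its transpose, the change of g under the shear \<partial>_i \<otimes> dt.\<close>

definition mom :: "'n pt \<Rightarrow> 'n \<Rightarrow> real" where
  "mom p i = (\<Sum>b\<in>UNIV. EL p (JG None b) * g p (Some i) b) + (\<Sum>a\<in>UNIV. EL p (JG a None) * g p a (Some i))"

lemma lor_metric: "lor_metric M g" and riem: "p \<in> M \<Longrightarrow> riemannian (\<lambda>i j. g p (Some i) (Some j))"
  using metric by (auto simp: slice_compatible_def)

lemma lorentzian: "p \<in> M \<Longrightarrow> lorentzian (g p)"
  using lor_metric by (simp add: lor_metric_def)

lemma g_sym: "p \<in> M \<Longrightarrow> g p a b = g p b a"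
  using lorentzian[of p] unfolding lorentzian_def by blast

lemma T_tenvals: "T p \<in> tenvals k1 k2"
  using T by (simp add: tfield_def)

lemma T_smooth: "Csmooth_on M (\<lambda>p. T p us ls)"
  using T by (simp add: tfield_def)

lemma T_diff: "p \<in> M \<Longrightarrow> (\<lambda>p. T p us ls) differentiable (at p)"
  by (rule Csmooth_on_differentiable[OF T_smooth open_M])

lemma dT_tenvals:
  fixes D :: "'n pt \<Rightarrow> 'n ten"
  assumes "\<And>p. D p \<in> tenvals k1 k2" shows "dT D p a \<in> tenvals k1 k2"
  unfolding tenvals_def
proof (intro CollectI allI impI)
  fix us ls :: "'n option list" assume "\<not> (length us = k1 \<and> length ls = k2)"
  then have "D q us ls = 0" for q using assms by (auto simp: tenvals_def)
  then show "dT D p a us ls = 0" by (simp add: dT_def pd_def pdir_const)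
qed

lemma noether_at:
  assumes "p \<in> M"
  shows "w0 * (force p (lact (el (Some i) None) (T p))
      + (\<Sum>a\<in>UNIV. flux p a (lact (el (Some i) None) (dT T p a)))
      + flux p None (dT T p (Some i)) + mom p i)
    + (\<Sum>a\<in>UNIV. flux p a (lact (shear.rot i w a) (T p))) = 0"
  using shear.noether[OF open_M assms ori lagr inv T lor_metric riem[OF assms] EL_def]
  unfolding force_def flux_def mom_def .

text \<open>The constant weight, w0 = 1 and w = 0. It trades the linearized Lagrangian on the
  algebraic variation for the time flux of \<partial>_i T and the momentum.\<close>

lemma noether_momentum:
  assumes "p \<in> M"
  shows "force p (lact (el (Some i) None) (T p))
      + (\<Sum>a\<in>UNIV. flux p a (lact (el (Some i) None) (dT T p a)))
      + flux p None (dT T p (Some i)) + mom p i = 0"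
proof -
  have "shear.rot i (\<lambda>_. 0) a = (\<lambda>_ _. 0)" for a by (simp add: shear.rot_def fun_eq_iff)
  moreover have "dact (\<lambda>_ _. 0) (\<lambda>_ _. 0) (T p) = (\<lambda>_ _. 0)" by (intro ext) (rule dact_zero)
  ultimately show ?thesis
    using noether_at[OF assms, of 1 i "\<lambda>_. 0"] by (simp add: flux_def tpair_zero)
qed

text \<open>The weight vanishing at p whose gradient is the coordinate covector b. It moves a flux
  in direction b of A_i T into the time flux of the action of \<partial>_i \<otimes> dx^b, the piece
  needed to complete a Lie derivative under \<pi>.\<close>

lemma noether_flux:
  assumes "p \<in> M"
  shows "flux p None (lact (el (Some i) b) (T p)) + flux p b (lact (el (Some i) None) (T p)) = 0"
proof -
  define w where "w = (\<lambda>e. if e = b then 1 else 0 :: real)"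
  have "lact (shear.rot i w a) (T p) us ls =
      (if a = None then 1 else 0) * lact (el (Some i) b) (T p) us ls + (if a = b then 1 else 0) * lact (el (Some i) None) (T p) us ls" for a us ls
  proof -
    have r: "shear.rot i w a = (\<lambda>c e. (if a = None then 1 else 0) * el (Some i) b c e + (if a = b then 1 else 0) * el (Some i) None c e)"
      by (auto simp: shear.rot_def w_def el_def fun_eq_iff)
    have "lact (shear.rot i w a) (T p) us ls = dact
       (\<lambda>c e. (if a = None then 1 else 0) * - el (Some i) b c e + (if a = b then 1 else 0) * - el (Some i) None c e)
       (\<lambda>c e. (if a = None then 1 else 0) * el (Some i) b c e + (if a = b then 1 else 0) * el (Some i) None c e) (T p) us ls"
      unfolding r by simp
    then show ?thesis unfolding dact_add dact_scale .
  qed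
  then have "flux p a (lact (shear.rot i w a) (T p)) =
      (if a = None then 1 else 0) * flux p a (lact (el (Some i) b) (T p)) + (if a = b then 1 else 0) * flux p a (lact (el (Some i) None) (T p))" for a
    unfolding flux_def tpair_scale[symmetric] tpair_add[symmetric] by (intro tpair_cong) simp
  then have "(\<Sum>a\<in>UNIV. flux p a (lact (shear.rot i w a) (T p))) =
     flux p None (lact (el (Some i) b) (T p)) + flux p b (lact (el (Some i) None) (T p))"
    by (simp add: sum.distrib if_distrib[of "\<lambda>x. x * _"] cong: if_cong)
  then show ?thesis using noether_at[OF assms, of 0 i w] by simp
qed

text \<open>For b = None the two terms of \<open>noether_flux\<close> coincide.\<close>

lemma flux_gauge: "p \<in> M \<Longrightarrow> flux p None (lact (el (Some i) None) (T p)) = 0"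
  using noether_flux[of p i None] by simp

lemma Csmooth_dact: "Csmooth_on M (\<lambda>p. dact A C (T p) us ls)"
  unfolding dact_def
  by (intro Csmooth_on_add Csmooth_on_sum Csmooth_on_mult Csmooth_on_const T_smooth open_M) auto

text \<open>Stationarity is tested on the affine path T + s D with D = W^i A_i T, which has compact
  support because W does. The Noether identities remove the force and all spatial fluxes, so only
  \<pi> and the momentum remain.\<close>

lemma stationary_variation:
  assumes stat: "stationary M ori k1 k2 L g T"
    and W: "\<And>i. Csmooth_on M (\<lambda>p. W p i)"
    and K: "compact K" "K \<subseteq> M" "\<And>p i. p \<in> M - K \<Longrightarrow> W p i = 0"
  shows "integral M (\<lambda>p. ori p * ((\<Sum>i\<in>UNIV. W p i * (flux p None (dT T p (Some i)) + mom p i))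
     + (\<Sum>i\<in>UNIV. \<Sum>a\<in>UNIV. pd a (\<lambda>q. W q i) p * flux p None (lact (el (Some i) a) (T p))))) = 0"
proof -
  define N where "N i = (el (Some i) None :: 'n option \<Rightarrow> 'n option \<Rightarrow> real)" for i
  define D where "D p us ls = (\<Sum>i\<in>UNIV. W p i * lact (N i) (T p) us ls)" for p us ls
  define Ts where "Ts s p us ls = T p us ls + s * D p us ls" for s p us ls
  have Dten: "D p \<in> tenvals k1 k2" for p
    using dact_in_tenvals[OF T_tenvals] unfolding D_def by (auto simp: tenvals_def)
  have Dsm: "Csmooth_on M (\<lambda>p. D p us ls)" for us ls
    unfolding D_def by (intro Csmooth_on_sum Csmooth_on_mult W Csmooth_dact open_M) auto
  have path: "smooth_path M k1 k2 Ts"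
    unfolding smooth_path_def
  proof (intro conjI allI)
    show "Ts s p \<in> tenvals k1 k2" for s p
      using T_tenvals Dten unfolding Ts_def by (auto simp: tenvals_def)
    fix us ls
    have oU: "open ((UNIV :: real set) \<times> M)" by (intro open_Times open_M open_UNIV)
    have "Csmooth_on (UNIV \<times> M) (\<lambda>z. T (snd z) us ls + fst z * D (snd z) us ls)"
      by (intro Csmooth_on_add Csmooth_on_mult oU Csmooth_on_comp_linear[OF oU open_M T_smooth bounded_linear_snd]
          Csmooth_on_comp_linear[OF oU open_M Dsm bounded_linear_snd] Csmooth_on_bounded_linear[OF oU bounded_linear_fst]) auto
    then show "Csmooth_on (UNIV \<times> M) (\<lambda>(s, p). Ts s p us ls)"
      by (simp add: Ts_def case_prod_unfold)
  qed
  have "intM M ori (\<lambda>p. deriv (\<lambda>s. L p (Ts s p) (dT (Ts s) p) (g p)) 0) = 0"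
  proof -
    have "deriv (\<lambda>s. Ts s p us ls) 0 = 0" if "p \<in> M - K" for p us ls
    proof -
      have "Ts s p us ls = T p us ls" for s using K(3)[OF that] by (simp add: Ts_def D_def)
      then show ?thesis by simp
    qed
    moreover have "Ts 0 p = T p" for p by (simp add: Ts_def fun_eq_iff)
    ultimately show ?thesis
      using stat path K(1,2) unfolding stationary_def by blast
  qed
  moreover have "ori p * deriv (\<lambda>s. L p (Ts s p) (dT (Ts s) p) (g p)) 0 =
     - (ori p * ((\<Sum>i\<in>UNIV. W p i * (flux p None (dT T p (Some i)) + mom p i))
     + (\<Sum>i\<in>UNIV. \<Sum>a\<in>UNIV. pd a (\<lambda>q. W q i) p * flux p None (lact (el (Some i) a) (T p)))))"
    if p: "p \<in> M" for p
  proof -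
    have Wd: "(\<lambda>q. W q i) differentiable (at p)" for i
      by (rule Csmooth_on_differentiable[OF W open_M p])
    have dTs: "dT (Ts s) p a us ls = dT T p a us ls + s * dT D p a us ls" for s a us ls
    proof -
      have "((\<lambda>q. T q us ls + s * D q us ls) has_derivative
          (\<lambda>h. frechet_derivative (\<lambda>q. T q us ls) (at p) h + s * frechet_derivative (\<lambda>q. D q us ls) (at p) h)) (at p)"
        by (intro has_derivative_add has_derivative_mult_right has_derivative_frechet
            T_diff p Csmooth_on_differentiable[OF Dsm open_M])
      from pdir_eqI[OF this, of "axis a 1"] show ?thesis by (simp add: dT_def pd_def Ts_def pdir_def)
    qed
    have dD: "dT D p a us ls = (\<Sum>i\<in>UNIV. pd a (\<lambda>q. W q i) p * lact (N i) (T p) us ls + W p i * lact (N i) (dT T p a) us ls)" for a us ls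
    proof -
      have t: "((\<lambda>q. T q us ls) has_derivative (\<lambda>h. frechet_derivative (\<lambda>q. T q us ls) (at p) h)) (at p)" for us ls
        by (intro has_derivative_frechet T_diff p)
      have "((\<lambda>q. D q us ls) has_derivative
        (\<lambda>h. \<Sum>i\<in>UNIV. W p i * lact (N i) (\<lambda>us ls. frechet_derivative (\<lambda>q. T q us ls) (at p) h) us ls
            + frechet_derivative (\<lambda>q. W q i) (at p) h * lact (N i) (T p) us ls)) (at p)"
        unfolding D_def
        by (intro has_derivative_sum has_derivative_mult dact_has_derivative has_derivative_frechet[OF Wd] t)
      from pdir_eqI[OF this, of "axis a 1"] show ?thesis by (simp add: dT_def pd_def pdir_def add.commute)
    qed
    have "((\<lambda>s. L p (Ts s p) (dT (Ts s) p) (g p)) has_field_derivative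
       tpair k1 k2 (\<lambda>us ls. EL p (JT us ls)) (D p) + (\<Sum>a\<in>UNIV. tpair k1 k2 (\<lambda>us ls. EL p (JD a us ls)) (dT D p a))
        + (\<Sum>a\<in>UNIV. \<Sum>b\<in>UNIV. EL p (JG a b) * 0)) (at 0)"
    proof (rule lagrangian_chain[OF lagr open_M p lorentzian[OF p] riem[OF p]])
      show "Ts s p \<in> tenvals k1 k2" for s using path by (simp add: smooth_path_def)
      show "dT (Ts s) p a \<in> tenvals k1 k2" for s a
        by (rule dT_tenvals) (use path in \<open>simp add: smooth_path_def\<close>)
      show "((\<lambda>s. Ts s p us ls) has_field_derivative D p us ls) (at 0)" for us ls
        unfolding Ts_def by (auto intro!: derivative_eq_intros)
      show "((\<lambda>s. dT (Ts s) p a us ls) has_field_derivative dT D p a us ls) (at 0)" for a us ls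
        unfolding dTs by (auto intro!: derivative_eq_intros)
      have "Ts 0 p = T p" "dT (Ts 0) p = dT T p" by (simp_all add: Ts_def dTs fun_eq_iff)
      then show "EL p = Lpart k1 k2 L p (Ts 0 p) (dT (Ts 0) p) (g p)" by (simp add: EL_def)
    qed (simp_all add: g_sym[OF p])
    then have 1: "deriv (\<lambda>s. L p (Ts s p) (dT (Ts s) p) (g p)) 0 = force p (D p) + (\<Sum>a\<in>UNIV. flux p a (dT D p a))"
      by (simp add: DERIV_imp_deriv force_def flux_def)
    have 2: "force p (D p) = (\<Sum>i\<in>UNIV. W p i * force p (lact (N i) (T p)))"
      unfolding D_def force_def tpair_sum tpair_scale ..
    have 3: "flux p a (dT D p a) = (\<Sum>i\<in>UNIV. pd a (\<lambda>q. W q i) p * flux p a (lact (N i) (T p)) + W p i * flux p a (lact (N i) (dT T p a)))" for a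
    proof -
      have "dT D p a = (\<lambda>us ls. \<Sum>i\<in>UNIV. pd a (\<lambda>q. W q i) p * lact (N i) (T p) us ls + W p i * lact (N i) (dT T p a) us ls)"
        by (intro ext dD)
      then show ?thesis by (simp only: flux_def tpair_sum tpair_add tpair_scale)
    qed
    have "force p (D p) + (\<Sum>a\<in>UNIV. flux p a (dT D p a)) =
       (\<Sum>i\<in>UNIV. W p i * (force p (lact (N i) (T p)) + (\<Sum>a\<in>UNIV. flux p a (lact (N i) (dT T p a)))))
       + (\<Sum>i\<in>UNIV. \<Sum>a\<in>UNIV. pd a (\<lambda>q. W q i) p * flux p a (lact (N i) (T p)))"
      unfolding 2 3 sum.swap[of _ UNIV "UNIV :: 'n option set"]
      by (simp add: sum.distrib distrib_left sum_distrib_left)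
    \<comment> \<open>The momentum identity rewrites the terms with W itself, the flux identity
      those with its derivatives.\<close>
    also have "\<dots> = (\<Sum>i\<in>UNIV. W p i * - (flux p None (dT T p (Some i)) + mom p i))
       + (\<Sum>i\<in>UNIV. \<Sum>a\<in>UNIV. pd a (\<lambda>q. W q i) p * - flux p None (lact (el (Some i) a) (T p)))"
    proof -
      have "force p (lact (N i) (T p)) + (\<Sum>a\<in>UNIV. flux p a (lact (N i) (dT T p a))) = - (flux p None (dT T p (Some i)) + mom p i)" for i
        using noether_momentum[OF p, of i] by (simp add: N_def)
      moreover have "flux p a (lact (N i) (T p)) = - flux p None (lact (el (Some i) a) (T p))" for a i
        using noether_flux[OF p, of i a] by (simp add: N_def)
      ultimately show ?thesis by simp
    qed
    finally show ?thesis unfolding 1 by (simp only: mult_minus_right sum_negf) (simp add: algebra_simps)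
  qed
  ultimately have "integral M (\<lambda>p. - (ori p * ((\<Sum>i\<in>UNIV. W p i * (flux p None (dT T p (Some i)) + mom p i))
     + (\<Sum>i\<in>UNIV. \<Sum>a\<in>UNIV. pd a (\<lambda>q. W q i) p * flux p None (lact (el (Some i) a) (T p)))))) = 0"
    unfolding intM_def by (simp cong: integral_cong)
  then show ?thesis by simp
qed

end

subsection \<open>Integration over slices\<close>

definition sp :: "('n::finite) pt \<Rightarrow> real ^ 'n" where
  "sp p = (\<chi> i. p $ Some i)"

lemma sp_nth [simp]: "sp p $ i = p $ Some i"
  by (simp add: sp_def)

lemma mk_nth [simp]: "mk x t $ None = t" "mk x t $ Some i = x $ i"
  by (simp_all add: mk_def)

lemma sp_mk [simp]: "sp (mk x t) = x"
  by (simp add: vec_eq_iff)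

lemma mk_sp: "mk (sp p) (p $ None) = p"
proof -
  have "mk (sp p) (p $ None) $ a = p $ a" for a by (cases a) auto
  then show ?thesis by (simp add: vec_eq_iff)
qed

lemma Mset_iff: "p \<in> Mset S I \<longleftrightarrow> sp p \<in> S \<and> p $ None \<in> I"
  by (simp add: Mset_def sp_def)

lemma mk_in_Mset [simp]: "mk x t \<in> Mset S I \<longleftrightarrow> x \<in> S \<and> t \<in> I"
  by (simp add: Mset_iff)

lemma bounded_linear_sp: "bounded_linear sp"
  by (rule linear_bounded_pos[THEN exE, of sp]; (rule linear_conv_bounded_linear[THEN iffD1])?)
    (auto intro!: linearI simp: vec_eq_iff)

lemma continuous_sp: "continuous_on A sp"
  by (rule linear_continuous_on[OF bounded_linear_sp])

lemma bounded_linear_mk: "bounded_linear (\<lambda>(t, x). mk x t)"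
proof -
  have "linear (\<lambda>(t, x). mk x t :: 'a pt)"
  proof (rule linearI; clarsimp simp: vec_eq_iff)
    show "mk (b + ba) (a + aa) $ i = mk b a $ i + mk ba aa $ i" for a aa b ba and i :: "'a option"
      by (cases i) auto
    show "mk (r *\<^sub>R b) (r * a) $ i = r * mk b a $ i" for r a b and i :: "'a option"
      by (cases i) auto
  qed
  then show ?thesis by (simp add: linear_conv_bounded_linear)
qed

lemma continuous_mk: "continuous_on A (\<lambda>(t, x). mk x t)"
  by (rule linear_continuous_on[OF bounded_linear_mk])

lemma open_Mset: "open S \<Longrightarrow> open I \<Longrightarrow> open (Mset S I)"
proof -
  assume o: "open S" "open I"
  have "Mset S I = sp -` S \<inter> (\<lambda>p. p $ None) -` I" by (auto simp: Mset_iff)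
  moreover have "open (sp -` S)" "open ((\<lambda>p. p $ None) -` I)"
    using o by (auto intro!: open_vimage continuous_sp continuous_intros)
  ultimately show ?thesis by auto
qed

section \<open>Fubini on the product of space and time, and localization to one slice\<close>

lemma prod_Basis_cart: "(\<Prod>b\<in>Basis. (x :: real ^ 'a::finite) \<bullet> b) = (\<Prod>a\<in>UNIV. x $ a)"
proof -
  have B: "(Basis :: (real ^ 'a) set) = range (\<lambda>c. axis c 1)" by (auto simp: Basis_vec_def)
  have i: "inj (\<lambda>c :: 'a. axis c (1 :: real))" by (auto simp: inj_on_def axis_eq_axis)
  show ?thesis unfolding B by (subst prod.reindex[OF i]) (simp add: inner_axis)
qed

text \<open>Spacetime points are vectors indexed by an option type, not pairs. Comparing the
  measures of boxes transports Lebesgue measure, and with it Fubini, from the product.\<close>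

lemma lborel_mk: "lborel = distr lborel borel (\<lambda>(t, x). mk x t :: ('n::finite) pt)"
proof (rule lborel_eqI)
  have meas: "(\<lambda>(t, x). mk x t :: 'n pt) \<in> borel_measurable borel"
    by (rule borel_measurable_continuous_onI[OF continuous_mk])
  fix l u :: "'n pt" assume "\<And>b. b \<in> Basis \<Longrightarrow> l \<bullet> b \<le> u \<bullet> b"
  then have le: "l $ a \<le> u $ a" for a
    by (metis axis_in_Basis_iff inner_axis mult.right_neutral real_inner_1_right inner_real_def zero_neq_one one_neq_zero Basis_real_def singletonI)
  have "(\<lambda>(t, x). mk x t) -` box l u = box (l $ None) (u $ None) \<times> box (sp l) (sp u)"
    by (auto simp: mem_box_cart split: option.splits) (metis mk_nth(1) mk_nth(2) not_None_eq)+
  then have "emeasure (distr lborel borel (\<lambda>(t, x). mk x t)) (box l u) =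
      emeasure (lborel \<Otimes>\<^sub>M lborel) (box (l $ None) (u $ None) \<times> box (sp l) (sp u))"
    using meas by (simp add: emeasure_distr lborel_prod)
  also have "\<dots> = emeasure lborel (box (l $ None) (u $ None)) * emeasure lborel (box (sp l) (sp u))"
    by (rule lborel.emeasure_pair_measure_Times) auto
  also have "emeasure lborel (box (sp l) (sp u)) = (\<Prod>b\<in>Basis. (sp u - sp l) \<bullet> b)"
    by (rule emeasure_lborel_box) (use le in \<open>auto simp: Basis_vec_def inner_axis\<close>)
  also have "emeasure lborel (box (l $ None) (u $ None)) = ennreal (u $ None - l $ None)"
    using emeasure_lborel_box[of "l $ None" "u $ None"] le by simp
  also have "ennreal (u $ None - l $ None) * ennreal (\<Prod>b\<in>Basis. (sp u - sp l) \<bullet> b) =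
      ennreal (\<Prod>b\<in>Basis. (u - l) \<bullet> b)"
  proof -
    have "(\<Prod>b\<in>Basis. (u - l) \<bullet> b) = (u $ None - l $ None) * (\<Prod>b\<in>Basis. (sp u - sp l) \<bullet> b)"
      unfolding prod_Basis_cart by (simp add: UNIV_option_conv prod.reindex)
    then show ?thesis using le by (simp add: ennreal_mult' )
  qed
  finally show "emeasure (distr lborel borel (\<lambda>(t, x). mk x t)) (box l u) = ennreal (\<Prod>b\<in>Basis. (u - l) \<bullet> b)" .
qed simp

text \<open>The bump confines time and K confines space, so everything happens on one compact box
  after extension by zero. A spatial box independent of t also makes the inner integral continuous
  in t.\<close>

lemma integral_Mset_bump:
  fixes G :: "('n::finite) pt \<Rightarrow> real"
  assumes S: "open S" and I: "open I" and K: "compact K" "K \<subseteq> S"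
    and G: "continuous_on (Mset S I) G" "\<And>p. p \<in> Mset S I \<Longrightarrow> sp p \<notin> K \<Longrightarrow> G p = 0"
    and r: "{c - r..c + r} \<subseteq> I"
  shows "integral (Mset S I) (\<lambda>p. bump c r (p $ None) * G p) =
      integral {c - r..c + r} (\<lambda>t. bump c r t * integral S (\<lambda>x. G (mk x t)))"
    and "continuous_on I (\<lambda>t. integral S (\<lambda>x. G (mk x t)))"
proof -
  define G0 where "G0 t x = (if x \<in> S then G (mk x t) else 0)" for t x
  obtain a b where box: "K \<subseteq> cbox a b"
    using bounded_subset_cbox_symmetric[OF compact_imp_bounded[OF K(1)]] by blast
  \<comment> \<open>The extension is continuous on two open pieces, over S and over the complement
    of K, where it is zero on the latter. They cover all of space because K lies in S.\<close>
  have G0cont: "continuous_on (I \<times> UNIV) (\<lambda>(t, x). G0 t x)"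
  proof -
    have "continuous_on (I \<times> S) (\<lambda>z. G ((\<lambda>(t, x). mk x t) z))"
      by (rule continuous_on_compose2[OF G(1) continuous_mk]) auto
    then have 1: "continuous_on (I \<times> S) (\<lambda>(t, x). G0 t x)"
      by (rule continuous_on_eq) (auto simp: G0_def)
    have 2: "continuous_on (I \<times> - K) (\<lambda>(t, x). G0 t x)"
      by (rule continuous_on_eq[of _ "\<lambda>_. 0"]) (auto simp: G0_def G(2))
    have "continuous_on (I \<times> S \<union> I \<times> - K) (\<lambda>(t, x). G0 t x)"
      using 1 2 by (intro continuous_on_open_Un open_Times S I open_Compl compact_imp_closed K)
    moreover have "I \<times> S \<union> I \<times> - K = I \<times> UNIV" using K(2) by auto
    ultimately show ?thesis by simp
  qed
  define F where "F t = integral (cbox a b) (G0 t)" for t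
  have Fcont: "continuous_on I F"
    unfolding F_def by (rule integral_continuous_on_param) (rule continuous_on_subset[OF G0cont], auto)
  have F: "integral S (\<lambda>x. G (mk x t)) = F t" if "t \<in> I" for t
  proof -
    have "integral S (\<lambda>x. G (mk x t)) = integral UNIV (G0 t)"
      unfolding G0_def by (rule Henstock_Kurzweil_Integration.integral_restrict_UNIV[symmetric])
    also have "G0 t = (\<lambda>x. if x \<in> cbox a b then G0 t x else 0)"
    proof
      fix x show "G0 t x = (if x \<in> cbox a b then G0 t x else 0)"
        using G(2)[of "mk x t"] that box by (auto simp: G0_def)
    qed
    also have "integral UNIV \<dots> = F t"
      unfolding F_def by (rule Henstock_Kurzweil_Integration.integral_restrict_UNIV)
    finally show ?thesis .
  qed
  define \<beta> where "\<beta> = bump c r"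
  have \<beta>c: "continuous_on A \<beta>" for A
    using Csmooth_on_continuous[OF Csmooth_bump open_UNIV] continuous_on_subset unfolding \<beta>_def by blast
  have \<beta>0: "\<beta> t = 0" if "t \<notin> {c - r..c + r}" for t
    using that bump_nonneg[of c r t] bump_pos_iff[of c r t] unfolding \<beta>_def by force
  define H where "H p = (if p \<in> Mset S I then \<beta> (p $ None) * G p else 0)" for p
  define B where "B = cbox (c - r, a) (c + r, b)"
  have oM: "open (Mset S I)" by (rule open_Mset[OF S I])
  have Hm: "H \<in> borel_measurable borel"
  proof -
    have "(\<lambda>p. indicator (Mset S I) p *\<^sub>R (\<beta> (p $ None) * G p)) \<in> borel_measurable borel"
      using oM by (intro borel_measurable_continuous_on_indicator continuous_on_mult G(1)
          continuous_on_compose2[OF \<beta>c[of UNIV]] continuous_intros) auto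
    also have "(\<lambda>p. indicator (Mset S I) p *\<^sub>R (\<beta> (p $ None) * G p)) = H"
      by (auto simp: H_def indicator_def)
    finally show ?thesis .
  qed
  have Bcont: "continuous_on B (\<lambda>(t, x). \<beta> t * G0 t x)"
  proof -
    have "continuous_on B (\<lambda>z. \<beta> (fst z) * (case z of (t, x) \<Rightarrow> G0 t x))"
      by (intro continuous_on_mult continuous_on_compose2[OF \<beta>c[of UNIV]] continuous_intros
          continuous_on_subset[OF G0cont]) (use r in \<open>auto simp: B_def cbox_Pair_eq\<close>)
    then show ?thesis by (simp add: case_prod_unfold)
  qed
  have HB: "H (mk x t) = indicator B (t, x) *\<^sub>R (\<beta> t * G0 t x)" for t x
  proof (cases "(t, x) \<in> B")
    case True
    then have "t \<in> I" using r by (auto simp: B_def cbox_Pair_eq)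
    then show ?thesis using True by (simp add: H_def G0_def)
  next
    case False
    then consider "t \<notin> {c - r..c + r}" | "x \<notin> cbox a b" by (auto simp: B_def cbox_Pair_eq)
    then have "H (mk x t) = 0"
    proof cases
      case 2
      then have "x \<notin> K" using box by auto
      then show ?thesis using G(2)[of "mk x t"] by (auto simp: H_def)
    qed (simp add: H_def \<beta>0)
    then show ?thesis using False by simp
  qed
  have int2: "integrable lborel (\<lambda>z. indicator B z *\<^sub>R (case z of (t, x) \<Rightarrow> \<beta> t * G0 t x))"
    by (rule borel_integrable_compact[OF _ Bcont]) (simp add: B_def)
  have HBz: "H (case z of (t, x) \<Rightarrow> mk x t) = indicator B z *\<^sub>R (case z of (t, x) \<Rightarrow> \<beta> t * G0 t x)" for z
    by (cases z) (simp add: HB)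
  have mm: "(\<lambda>(t, x). mk x t :: 'n pt) \<in> measurable lborel borel"
    using borel_measurable_continuous_onI[OF continuous_mk] by simp
  have intH: "integrable lborel H"
    by (subst lborel_mk, subst integrable_distr_eq[OF mm Hm]) (use int2 in \<open>simp add: HBz\<close>)
  have "integral (Mset S I) (\<lambda>p. bump c r (p $ None) * G p) = integral UNIV H"
    using Henstock_Kurzweil_Integration.integral_restrict_UNIV[of "Mset S I" "\<lambda>p. \<beta> (p $ None) * G p"]
    by (simp add: H_def[abs_def] \<beta>_def)
  also have "\<dots> = (\<integral>p. H p \<partial>lborel)" by (rule integral_lborel[OF intH])
  also have "\<dots> = (\<integral>z. H (case z of (t, x) \<Rightarrow> mk x t) \<partial>lborel)"
    by (subst (1) lborel_mk, subst integral_distr[OF mm Hm]) simp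
  also have "\<dots> = integral UNIV (\<lambda>z. indicator B z *\<^sub>R (case z of (t, x) \<Rightarrow> \<beta> t * G0 t x))"
    unfolding HBz by (rule integral_lborel[OF int2, symmetric])
  also have "\<dots> = integral UNIV (\<lambda>z. if z \<in> B then (case z of (t, x) \<Rightarrow> \<beta> t * G0 t x) else 0)"
    by (rule arg_cong[where f = "integral UNIV"]) (auto simp: indicator_def)
  also have "\<dots> = integral B (\<lambda>(t, x). \<beta> t * G0 t x)"
    by (rule Henstock_Kurzweil_Integration.integral_restrict_UNIV)
  also have "\<dots> = integral (cbox (c - r) (c + r)) (\<lambda>t. integral (cbox a b) (\<lambda>x. \<beta> t * G0 t x))"
    using integral_prod_continuous[OF Bcont[unfolded B_def]] by (simp add: B_def)
  also have "\<dots> = integral {c - r..c + r} (\<lambda>t. \<beta> t * F t)"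
    by (simp add: F_def)
  also have "\<dots> = integral {c - r..c + r} (\<lambda>t. bump c r t * integral S (\<lambda>x. G (mk x t)))"
    by (rule integral_cong) (use F r in \<open>auto simp: \<beta>_def\<close>)
  finally show "integral (Mset S I) (\<lambda>p. bump c r (p $ None) * G p) =
      integral {c - r..c + r} (\<lambda>t. bump c r t * integral S (\<lambda>x. G (mk x t)))" .
  show "continuous_on I (\<lambda>t. integral S (\<lambda>x. G (mk x t)))"
    by (rule continuous_on_eq[OF Fcont]) (simp add: F)
qed

text \<open>If the slice integral were nonzero at c, by continuity it would keep its sign on a short
  interval, and its integral against a bump that is positive at c could not vanish.\<close>

lemma slice_integral_zero:
  fixes G :: "('n::finite) pt \<Rightarrow> real"
  assumes S: "open S" and I: "open I" and c: "c \<in> I" and K: "compact K" "K \<subseteq> S"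
    and G: "continuous_on (Mset S I) G" "\<And>p. p \<in> Mset S I \<Longrightarrow> sp p \<notin> K \<Longrightarrow> G p = 0"
    and zero: "\<And>r. r > 0 \<Longrightarrow> {c - r..c + r} \<subseteq> I \<Longrightarrow> integral (Mset S I) (\<lambda>p. bump c r (p $ None) * G p) = 0"
  shows "integral S (\<lambda>x. G (mk x c)) = 0"
proof (rule ccontr)
  define F where "F t = integral S (\<lambda>x. G (mk x t))" for t
  assume "integral S (\<lambda>x. G (mk x c)) \<noteq> 0"
  then have Fc: "F c \<noteq> 0" by (simp add: F_def)
  obtain e where e: "e > 0" "cball c e \<subseteq> I" using I c open_contains_cball by blast
  have eq: "{c - s..c + s} = cball c s" for s :: real by (simp add: cball_eq_atLeastAtMost)
  have Fcont: "continuous_on I F"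
    unfolding F_def using integral_Mset_bump(2)[OF S I K G, of c e] e(2) unfolding eq by simp
  then obtain d where d: "d > 0" "\<And>t. t \<in> I \<Longrightarrow> dist t c < d \<Longrightarrow> dist (F t) (F c) < \<bar>F c\<bar>"
    using c Fc unfolding continuous_on_iff by (meson zero_less_abs_iff)
  \<comment> \<open>Half of d, because the closed interval of radius r must lie in the open ball of
    radius d.\<close>
  define r where "r = min e (d / 2)"
  have r: "r > 0" "{c - r..c + r} \<subseteq> I" using e d by (auto simp: r_def eq subset_iff)
  define f where "f t = bump c r t * (F t * sgn (F c))" for t
  have "integral {c - r..c + r} f = integral {c - r..c + r} (\<lambda>t. bump c r t * F t) * sgn (F c)"
    by (simp add: f_def[abs_def] mult.assoc[symmetric])
  also have "\<dots> = 0"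
    using integral_Mset_bump(1)[OF S I K G r(2)] zero[OF r] by (simp add: F_def)
  finally have "integral {c - r..c + r} f = 0" .
  moreover have "continuous_on {c - r..c + r} f"
    unfolding f_def
    by (intro continuous_on_mult continuous_intros continuous_on_subset[OF Fcont r(2)]
        continuous_on_subset[OF Csmooth_on_continuous[OF Csmooth_bump open_UNIV]]) auto
  moreover have "f t \<ge> 0" if t: "t \<in> {c - r..c + r}" for t
  proof -
    have "\<bar>F t - F c\<bar> < \<bar>F c\<bar>"
      using d(2)[of t] t r(2) d(1) by (auto simp: dist_real_def r_def subset_iff abs_le_iff)
    then have "F t * sgn (F c) \<ge> 0" by (auto simp: sgn_if)
    then show ?thesis by (simp add: f_def bump_nonneg)
  qed
  ultimately have "f c = 0" using integral_eq_0_iff[of "c - r" "c + r" f] r(1) by auto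
  moreover have "bump c r c > 0" using r(1) by (simp add: bump_pos_iff)
  ultimately show False using Fc by (simp add: f_def sgn_zero_iff)
qed

text \<open>Needed to split the slice integral of a sum, which requires each summand to be
  integrable.\<close>

lemma integrable_on_compact_support:
  fixes f :: "'a::euclidean_space \<Rightarrow> real"
  assumes "continuous_on S f" "compact K" "K \<subseteq> S" "\<And>x. x \<in> S - K \<Longrightarrow> f x = 0"
  shows "f integrable_on S"
proof -
  have "integrable lborel (\<lambda>x. indicator K x *\<^sub>R f x)"
    by (rule borel_integrable_compact[OF assms(2) continuous_on_subset[OF assms(1,3)]])
  then have "(\<lambda>x. indicator K x *\<^sub>R f x) integrable_on UNIV"
    using has_integral_integral_lborel by blast
  also have "(\<lambda>x. indicator K x *\<^sub>R f x) = (\<lambda>x. if x \<in> S then f x else 0)"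
    using assms(3,4) by (auto simp: indicator_def fun_eq_iff)
  finally show ?thesis by (simp add: integrable_restrict_UNIV)
qed

subsection \<open>Decomposed tensors\<close>

text \<open>\<open>Mx X\<close> has as rows the coframe \<open>dt\<close>, \<open>dx\<^sup>i + X\<^sup>i dt\<close>; the columns of \<open>Mx (- X)\<close> are the dual
  frame \<open>\<partial>\<^sub>t - X\<close>, \<open>\<partial>\<^sub>i\<close>.\<close>

definition Mx :: "real ^ ('n::finite) \<Rightarrow> 'n option \<Rightarrow> 'n option \<Rightarrow> real" where
  "Mx Y a b = idm a b + (if b = None then case a of None \<Rightarrow> 0 | Some j \<Rightarrow> Y $ j else 0)"

text \<open>Restores the full index list of a component from the pattern of normal and spatial slots
  and the spatial indices. Normal slots receive \<open>None\<close>; the last clause is a default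
  for an index list that is too short and keeps the length right.\<close>

fun mrg :: "bool list \<Rightarrow> 'n option list \<Rightarrow> 'n option list" where
  "mrg [] is = []"
| "mrg (True # cs) is = None # mrg cs is"
| "mrg (False # cs) (i # is) = i # mrg cs is"
| "mrg (False # cs) [] = None # mrg cs []"

text \<open>Pure bookkeeping: it sorts the components in a given frame by which slots are normal.
  The dependence on the shift is left to a change of frame.\<close>

definition dec :: "nat \<Rightarrow> nat \<Rightarrow> ('n::finite) ten \<Rightarrow> 'n dten" where
  "dec k1 k2 \<tau> cu cl us ls = (if length cu = k1 \<and> length cl = k2 \<and>
      length us = count_list cu False \<and> length ls = count_list cl False \<and> None \<notin> set us \<and> None \<notin> set ls
     then \<tau> (mrg cu us) (mrg cl ls) else 0)"

lemma length_mrg [simp]: "length (mrg cs is) = length cs"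
  by (induction cs "is" rule: mrg.induct) auto

lemma upco_mrg:
  "None \<notin> set us \<Longrightarrow> length us = count_list cs False \<Longrightarrow> upco Y cs us = map (Mx Y) (mrg cs us)"
proof (induction Y cs us rule: upco.induct)
  case (2 Xv cs "is")
  then show ?case by (auto simp: Mx_def idm_def fun_eq_iff)
next
  case (3 Xv cs i "is")
  then show ?case by (cases i) (auto simp: Mx_def idm_def fun_eq_iff pxco_def)
qed auto

lemma lowv_mrg:
  "None \<notin> set ls \<Longrightarrow> length ls = count_list cs False \<Longrightarrow> lowv Y cs ls = map (\<lambda>j b. Mx (- Y) b j) (mrg cs ls)"
proof (induction Y cs ls rule: lowv.induct)
  case (2 Xv cs "is")
  then show ?case by (auto simp: Mx_def idm_def fun_eq_iff split: option.splits)
next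
  case (3 Xv cs i "is")
  then show ?case by (cases i) (auto simp: Mx_def idm_def fun_eq_iff)
qed auto

lemma length_upco [simp]: "length (upco Y cs us) = length cs"
  by (induction Y cs us rule: upco.induct) auto

lemma length_lowv [simp]: "length (lowv Y cs ls) = length cs"
  by (induction Y cs ls rule: lowv.induct) auto

text \<open>A stray \<open>None\<close> in a spatial slot inserts the zero covector, matching the
  components that \<open>dec\<close> sets to zero.\<close>

lemma upco_None: "None \<in> set us \<Longrightarrow> length us = count_list cs False \<Longrightarrow> (\<lambda>a. 0) \<in> set (upco Y cs us)"
  by (induction Y cs us rule: upco.induct) (auto simp: pxco_def)

lemma lowv_None: "None \<in> set ls \<Longrightarrow> length ls = count_list cs False \<Longrightarrow> (\<lambda>a. 0) \<in> set (lowv Y cs ls)"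
  by (induction Y cs ls rule: lowv.induct) auto

lemma contract_zero:
  assumes "(\<lambda>a. 0) \<in> set \<theta>s \<and> length \<theta>s = k1 \<or> (\<lambda>a. 0) \<in> set vs \<and> length vs = k2"
  shows "contract k1 k2 \<tau> \<theta>s vs = 0"
  unfolding contract_def
proof (intro sum.neutral ballI)
  fix as bs
  have "(\<Prod>i<k1. (\<theta>s ! i) (as ! i)) = 0 \<or> (\<Prod>j<k2. (vs ! j) (bs ! j)) = 0"
    using assms
  proof (elim disjE conjE)
    assume "(\<lambda>a. 0) \<in> set \<theta>s" "length \<theta>s = k1"
    then obtain i where "i < k1" "\<theta>s ! i = (\<lambda>a. 0)" by (metis in_set_conv_nth)
    then have "(\<Prod>i<k1. (\<theta>s ! i) (as ! i)) = 0" by (intro prod_zero bexI[of _ i]) auto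
    then show ?thesis ..
  next
    assume "(\<lambda>a. 0) \<in> set vs" "length vs = k2"
    then obtain i where "i < k2" "vs ! i = (\<lambda>a. 0)" by (metis in_set_conv_nth)
    then have "(\<Prod>j<k2. (vs ! j) (bs ! j)) = 0" by (intro prod_zero bexI[of _ i]) auto
    then show ?thesis ..
  qed
  then show "\<tau> as bs * (\<Prod>i<k1. (\<theta>s ! i) (as ! i)) * (\<Prod>j<k2. (vs ! j) (bs ! j)) = 0" by auto
qed

text \<open>The factorization on which the treatment of decomposed tensors rests: a change of frame
  depending on the shift, followed by re-indexing that does not.\<close>

lemma Sdec_eq: "Sdec k1 k2 Y \<tau> = dec k1 k2 (Act k1 k2 (Mx Y) (Mx (- Y)) \<tau>)"
proof (intro ext)
  fix cu cl us ls
  show "Sdec k1 k2 Y \<tau> cu cl us ls = dec k1 k2 (Act k1 k2 (Mx Y) (Mx (- Y)) \<tau>) cu cl us ls"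
  proof (cases "length cu = k1 \<and> length cl = k2 \<and> length us = count_list cu False \<and> length ls = count_list cl False")
    case True
    show ?thesis
    proof (cases "None \<notin> set us \<and> None \<notin> set ls")
      case False
      then have "contract k1 k2 \<tau> (upco Y cu us) (lowv Y cl ls) = 0"
        using True upco_None[of us cu Y] lowv_None[of ls cl Y] by (intro contract_zero) auto
      then show ?thesis using True False by (auto simp: Sdec_def dec_def)
    next
      case none: True
      then show ?thesis
        using True by (simp add: Sdec_def dec_def contract_def Act_def upco_mrg lowv_mrg)
    qed
  qed (auto simp: Sdec_def dec_def)
qed

lemma Mx_inverse: "mm (Mx Y) (Mx (- Y)) = idm"
proof (intro ext)
  fix a b
  have "mm (Mx Y) (Mx (- Y)) a b = (\<Sum>c\<in>UNIV. idm a c * Mx (- Y) c b) +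
      (\<Sum>c\<in>UNIV. if c = None then (case a of None \<Rightarrow> 0 | Some j \<Rightarrow> Y $ j) * Mx (- Y) c b else 0)"
    unfolding mm_def sum.distrib[symmetric] by (intro sum.cong refl) (auto simp: Mx_def[of Y] distrib_right)
  also have "\<dots> = idm a b"
    by simp (auto simp: Mx_def idm_def split: option.splits)
  finally show "mm (Mx Y) (Mx (- Y)) a b = idm a b" .
qed

lemma Act_Mx_inverse:
  assumes "\<tau> \<in> tenvals k1 k2"
  shows "Act k1 k2 (Mx Y) (Mx (- Y)) (Act k1 k2 (Mx (- Y)) (Mx Y) \<tau>) = \<tau>"
    "Act k1 k2 (Mx (- Y)) (Mx Y) (Act k1 k2 (Mx Y) (Mx (- Y)) \<tau>) = \<tau>"
  using Mx_inverse[of Y] Mx_inverse[of "- Y"] by (simp_all add: Act_Act Act_idm assms)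

lemma mrg_split: "mrg (map (\<lambda>a. a = None) as) (filter (\<lambda>a. a \<noteq> None) as) = as"
  by (induction as) auto

lemma count_split: "length (filter (\<lambda>a. a \<noteq> None) as) = count_list (map (\<lambda>a. a = None) as) False"
  by (induction as) auto

lemma dec_inj:
  assumes "\<sigma> \<in> tenvals k1 k2" "\<tau> \<in> tenvals k1 k2" "dec k1 k2 \<sigma> = dec k1 k2 \<tau>"
  shows "\<sigma> = \<tau>"
proof (intro ext)
  fix us ls :: "'a option list"
  show "\<sigma> us ls = \<tau> us ls"
  proof (cases "length us = k1 \<and> length ls = k2")
    case True
    \<comment> \<open>Every full index list is recovered from its own pattern of time indices, so no
      component is lost.\<close>
    have "dec k1 k2 \<rho> (map (\<lambda>a. a = None) us) (map (\<lambda>a. a = None) ls)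
        (filter (\<lambda>a. a \<noteq> None) us) (filter (\<lambda>a. a \<noteq> None) ls) = \<rho> us ls" for \<rho>
      using True unfolding dec_def mrg_split by (simp only: count_split length_map) auto
    then show ?thesis using assms(3) by metis
  next
    case False
    then show ?thesis using assms(1,2) by (auto simp: tenvals_def)
  qed
qed

lemma Sinv_dec:
  assumes "\<tau> \<in> tenvals k1 k2"
  shows "Sinv k1 k2 Y (dec k1 k2 \<tau>) = Act k1 k2 (Mx (- Y)) (Mx Y) \<tau>"
  unfolding Sinv_def
proof (rule inv_into_f_eq)
  show "inj_on (Sdec k1 k2 Y) (tenvals k1 k2)"
  proof (rule inj_onI)
    fix \<sigma> \<rho> :: "'a ten" assume *: "\<sigma> \<in> tenvals k1 k2" "\<rho> \<in> tenvals k1 k2" "Sdec k1 k2 Y \<sigma> = Sdec k1 k2 Y \<rho>"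
    then have "Act k1 k2 (Mx Y) (Mx (- Y)) \<sigma> = Act k1 k2 (Mx Y) (Mx (- Y)) \<rho>"
      by (intro dec_inj) (simp_all add: Act_in_tenvals Sdec_eq)
    then show "\<sigma> = \<rho>" using Act_Mx_inverse(2)[OF *(1), of Y] Act_Mx_inverse(2)[OF *(2), of Y] by metis
  qed
qed (simp_all add: Act_in_tenvals Sdec_eq Act_Mx_inverse assms)

text \<open>Replacing a spatial index is the same as replacing the corresponding entry of the merged
  list; normal slots contribute nothing. A general f is carried through the induction because the
  merged list grows in front.\<close>

lemma sum_mrg_update:
  fixes f :: "'n option list \<Rightarrow> 'n option \<Rightarrow> real"
  assumes "None \<notin> set us" "length us = count_list cs False"
  shows "(\<Sum>i<length us. f (mrg cs (us[i := x])) (us ! i)) =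
    (\<Sum>k<length cs. if mrg cs us ! k = None then 0 else f ((mrg cs us)[k := x]) (mrg cs us ! k))"
  using assms
proof (induction cs us arbitrary: f rule: mrg.induct)
  case (2 cs "is")
  then show ?case using "2.IH"[of "\<lambda>l. f (None # l)"] unfolding length_Cons sum.lessThan_Suc_shift by (simp cong: if_cong)
next
  case (3 cs i "is")
  then show ?case using "3.IH"[of "\<lambda>l. f (i # l)"] unfolding length_Cons sum.lessThan_Suc_shift by (auto cong: if_cong)
qed auto

text \<open>The Jacobian of Y regarded as a spatial vector field on spacetime that does not depend
  on time; hence the row and column of \<open>None\<close> vanish.\<close>

definition vjac :: "(real ^ ('n::finite) \<Rightarrow> real ^ 'n) \<Rightarrow> real ^ 'n \<Rightarrow> 'n option \<Rightarrow> 'n option \<Rightarrow> real" where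
  "vjac Y x a b = (case a of None \<Rightarrow> 0 | Some j \<Rightarrow> (case b of None \<Rightarrow> 0 | Some c \<Rightarrow> spd c (\<lambda>y. Y y $ j) x))"

lemma spd_const: "spd c (\<lambda>y. k) x = 0"
  by (simp add: spd_def pdir_const)

text \<open>A Lie derivative taken on each spatial component separately is given by the usual
  coordinate formula applied to the frame components, because normal slots behave as scalars and
  \<open>vjac\<close> annihilates the time index.\<close>

lemma dLie_dec:
  fixes \<tau> :: "real ^ ('n::finite) \<Rightarrow> 'n ten"
  assumes "\<And>y. \<tau> y \<in> tenvals k1 k2"
  shows "dLie Y (\<lambda>y. dec k1 k2 (\<tau> y)) x =
    dec k1 k2 (\<lambda>us ls. (\<Sum>c\<in>UNIV. Y x $ c * spd c (\<lambda>y. \<tau> y us ls) x) + lact (vjac Y x) (\<tau> x) us ls)"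
proof (intro ext)
  fix cu cl and us ls :: "'n option list"
  let ?ok = "length cu = k1 \<and> length cl = k2 \<and> length us = count_list cu False \<and> length ls = count_list cl False"
  let ?R = "\<lambda>us ls. (\<Sum>c\<in>UNIV. Y x $ c * spd c (\<lambda>y. \<tau> y us ls) x) + lact (vjac Y x) (\<tau> x) us ls"
  consider "None \<in> set us \<or> None \<in> set ls" | "\<not> ?ok" "None \<notin> set us \<and> None \<notin> set ls"
    | "?ok" "None \<notin> set us" "None \<notin> set ls" by blast
  then show "dLie Y (\<lambda>y. dec k1 k2 (\<tau> y)) x cu cl us ls = dec k1 k2 ?R cu cl us ls"
  proof cases
    case 1
    then show ?thesis by (auto simp: dLie_def sLie_def dec_def)
  next
    case 2
    have *: "\<not> ?ok \<Longrightarrow> dec k1 k2 (\<tau> y) cu cl us' ls' = 0" if "length us' = length us" "length ls' = length ls" for y us' ls'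
      using that by (auto simp: dec_def)
    have "dec k1 k2 (\<tau> y) cu cl us ls = 0" "dec k1 k2 (\<tau> y) cu cl (us[i := e]) ls = 0"
      "dec k1 k2 (\<tau> y) cu cl us (ls[i := e]) = 0" for y i e
      using 2(1) by (simp_all add: *)
    then have "dLie Y (\<lambda>y. dec k1 k2 (\<tau> y)) x cu cl us ls = 0"
      by (simp add: dLie_def sLie_def spd_const)
    then show ?thesis using 2(1) by (auto simp: dec_def)
  next
    case 3
    let ?u = "mrg cu us" and ?l = "mrg cl ls"
    have nu: "None \<notin> set (us[i := Some c])" for i c
      using set_update_subset_insert[of us i "Some c"] 3(2) by auto
    have nl: "None \<notin> set (ls[i := Some c])" for i c
      using set_update_subset_insert[of ls i "Some c"] 3(3) by auto
    have d0: "dec k1 k2 (\<tau> y) cu cl us ls = \<tau> y ?u ?l" for y using 3 by (simp add: dec_def)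
    have d1: "dec k1 k2 (\<tau> y) cu cl (us[i := Some c]) ls = \<tau> y (mrg cu (us[i := Some c])) ?l" for y i c
      using 3 nu by (simp add: dec_def)
    have d2: "dec k1 k2 (\<tau> y) cu cl us (ls[i := Some c]) = \<tau> y ?u (mrg cl (ls[i := Some c]))" for y i c
      using 3 nl by (simp add: dec_def)
    have s1: "(\<Sum>i<length us. \<Sum>c\<in>UNIV. \<tau> x (mrg cu (us[i := Some c])) ?l * spd c (\<lambda>y. Y y $ the (us ! i)) x)
      = (\<Sum>k<length ?u. \<Sum>e\<in>UNIV. vjac Y x (?u ! k) e * \<tau> x (?u[k := e]) ?l)"
    proof -
      have "(\<Sum>i<length us. \<Sum>c\<in>UNIV. \<tau> x (mrg cu (us[i := Some c])) ?l * spd c (\<lambda>y. Y y $ the (us ! i)) x)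
        = (\<Sum>c\<in>UNIV. \<Sum>k<length cu. if ?u ! k = None then 0 else \<tau> x (?u[k := Some c]) ?l * spd c (\<lambda>y. Y y $ the (?u ! k)) x)"
        by (subst sum.swap, rule sum.cong[OF refl])
          (use sum_mrg_update[of us cu "\<lambda>l a. \<tau> x l ?l * spd _ (\<lambda>y. Y y $ the a) x"] 3 in simp)
      also have "\<dots> = (\<Sum>k<length cu. \<Sum>c\<in>UNIV. if ?u ! k = None then 0 else \<tau> x (?u[k := Some c]) ?l * spd c (\<lambda>y. Y y $ the (?u ! k)) x)"
        by (rule sum.swap)
      also have "\<dots> = (\<Sum>k<length ?u. \<Sum>e\<in>UNIV. vjac Y x (?u ! k) e * \<tau> x (?u[k := e]) ?l)"
        unfolding sum_option length_mrg
        by (rule sum.cong[OF refl], rename_tac k, case_tac "?u ! k") (simp_all add: vjac_def mult.commute)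
      finally show ?thesis .
    qed
    have s2: "(\<Sum>j<length ls. \<Sum>c\<in>UNIV. \<tau> x ?u (mrg cl (ls[j := Some c])) * spd (the (ls ! j)) (\<lambda>y. Y y $ c) x)
      = (\<Sum>k<length ?l. \<Sum>e\<in>UNIV. vjac Y x e (?l ! k) * \<tau> x ?u (?l[k := e]))"
    proof -
      have "(\<Sum>j<length ls. \<Sum>c\<in>UNIV. \<tau> x ?u (mrg cl (ls[j := Some c])) * spd (the (ls ! j)) (\<lambda>y. Y y $ c) x)
        = (\<Sum>c\<in>UNIV. \<Sum>k<length cl. if ?l ! k = None then 0 else \<tau> x ?u (?l[k := Some c]) * spd (the (?l ! k)) (\<lambda>y. Y y $ c) x)"
        by (subst sum.swap, rule sum.cong[OF refl])
          (use sum_mrg_update[of ls cl "\<lambda>l a. \<tau> x ?u l * spd (the a) (\<lambda>y. Y y $ _) x"] 3 in simp)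
      also have "\<dots> = (\<Sum>k<length cl. \<Sum>c\<in>UNIV. if ?l ! k = None then 0 else \<tau> x ?u (?l[k := Some c]) * spd (the (?l ! k)) (\<lambda>y. Y y $ c) x)"
        by (rule sum.swap)
      also have "\<dots> = (\<Sum>k<length ?l. \<Sum>e\<in>UNIV. vjac Y x e (?l ! k) * \<tau> x ?u (?l[k := e]))"
        unfolding sum_option length_mrg
        by (rule sum.cong[OF refl], rename_tac k, case_tac "?l ! k") (simp_all add: vjac_def mult.commute)
      finally show ?thesis .
    qed
    have "dLie Y (\<lambda>y. dec k1 k2 (\<tau> y)) x cu cl us ls = (\<Sum>c\<in>UNIV. Y x $ c * spd c (\<lambda>y. \<tau> y ?u ?l) x)
        - (\<Sum>i<length us. \<Sum>c\<in>UNIV. \<tau> x (mrg cu (us[i := Some c])) ?l * spd c (\<lambda>y. Y y $ the (us ! i)) x)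
        + (\<Sum>j<length ls. \<Sum>c\<in>UNIV. \<tau> x ?u (mrg cl (ls[j := Some c])) * spd (the (ls ! j)) (\<lambda>y. Y y $ c) x)"
      unfolding dLie_def sLie_def d0 d1 d2 using 3(2,3) by simp
    also have "\<dots> = ?R ?u ?l"
      unfolding s1 s2 dact_def by (simp add: sum_negf)
    also have "\<dots> = dec k1 k2 ?R cu cl us ls" using 3 by (simp add: dec_def)
    finally show ?thesis .
  qed
qed

text \<open>the endomorphism \<open>v \<otimes> dt\<close>\<close>

definition vt :: "('n::finite \<Rightarrow> real) \<Rightarrow> 'n option \<Rightarrow> 'n option \<Rightarrow> real" where
  "vt v a b = (if b = None then case a of None \<Rightarrow> 0 | Some j \<Rightarrow> v j else 0)"

lemma vt_el: "vt v a b = (\<Sum>j\<in>UNIV. v j * el (Some j) None a (b :: 'n::finite option))"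
  by (cases a) (auto simp: vt_def el_def if_distrib[of "\<lambda>x. _ * x"] cong: if_cong)

text \<open>Displays the action of v \<otimes> dt as a combination of the A_j, the terms on which
  the gauge identity applies.\<close>

lemma lact_vt: "lact (vt v) \<tau> us ls = (\<Sum>j\<in>UNIV. v j * lact (el (Some j) None) \<tau> us ls)"
proof -
  have "lact (vt v) \<tau> us ls = dact (\<lambda>a b. \<Sum>j\<in>UNIV. v j * - el (Some j) None a b)
      (\<lambda>a b. \<Sum>j\<in>UNIV. v j * el (Some j) None a b) \<tau> us ls"
    by (simp add: vt_el[abs_def] sum_negf)
  then show ?thesis by (simp only: dact_sum dact_scale)
qed

lemma Mx_vt: "Mx Y a b = idm a b + vt (\<lambda>j. Y $ j) a b"
  by (simp add: Mx_def vt_def)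

lemma sum_vt:
  "(\<Sum>e\<in>UNIV. F e * vt v e b) = (if b = None then \<Sum>j\<in>UNIV. F (Some j) * v j else 0)"
  "(\<Sum>e\<in>UNIV. vt v a e * F e) = (case a of None \<Rightarrow> 0 | Some j \<Rightarrow> v j * F None)"
  by (auto simp: sum_option vt_def split: option.splits)

text \<open>Since dt annihilates spatial vectors, (v \<otimes> dt)(Y \<otimes> dt) = 0, and v
  \<otimes> dt is unchanged by a factor 1 + Y \<otimes> dt on either side.\<close>

lemma mm_vt_Mx: "mm (vt v) (Mx Y) a b = vt v a b" "mm (Mx Y) (vt v) a b = vt v a b"
proof -
  show "mm (vt v) (Mx Y) a b = vt v a b"
    unfolding mm_def sum_vt by (auto simp: vt_def Mx_def idm_def split: option.splits)
  show "mm (Mx Y) (vt v) a b = vt v a b"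
    unfolding mm_def Mx_vt distrib_right sum.distrib sum_idm
    by (simp add: sum_vt) (auto simp: vt_def split: option.splits)
qed

text \<open>Varying the shift changes the frame matrix by D \<otimes> dt, which by
  \<open>mm_vt_Mx\<close> already has the shape required by \<open>Act_has_derivative\<close>. The
  correction is thus a combination of the A_j.\<close>

lemma Act_Mx_has_derivative:
  fixes Z :: "'z::real_normed_vector \<Rightarrow> real ^ ('n::finite)"
  assumes Z: "\<And>j. ((\<lambda>y. Z y $ j) has_derivative (\<lambda>h. D h j)) (at x)"
    and \<tau>: "\<And>us ls. ((\<lambda>y. \<tau> y us ls) has_derivative (\<lambda>h. \<tau>' h us ls)) (at x)"
    and ls: "length us = k1" "length ls = k2"
  shows "((\<lambda>y. Act k1 k2 (Mx (Z y)) (Mx (- Z y)) (\<tau> y) us ls) has_derivative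
    (\<lambda>h. Act k1 k2 (Mx (Z x)) (Mx (- Z x)) (\<tau>' h) us ls
      - lact (vt (D h)) (Act k1 k2 (Mx (Z x)) (Mx (- Z x)) (\<tau> x)) us ls)) (at x)"
proof -
  have d: "((\<lambda>y. Mx (Z y) a b) has_derivative (\<lambda>h. vt (D h) a b)) (at x)" for a b
    by (cases a; cases "b = None") (auto simp: Mx_def vt_def intro!: derivative_eq_intros Z)
  have d': "((\<lambda>y. Mx (- Z y) a b) has_derivative (\<lambda>h. - vt (D h) a b)) (at x)" for a b
    by (cases a; cases "b = None") (auto simp: Mx_def vt_def intro!: derivative_eq_intros Z)
  have "((\<lambda>y. Act k1 k2 (Mx (Z y)) (Mx (- Z y)) (\<tau> y) us ls) has_derivative
    (\<lambda>h. Act k1 k2 (Mx (Z x)) (Mx (- Z x)) (\<tau>' h) us ls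
      + dact (vt (D h)) (\<lambda>a b. - vt (D h) a b) (Act k1 k2 (Mx (Z x)) (Mx (- Z x)) (\<tau> x)) us ls)) (at x)"
  proof (rule Act_has_derivative[OF _ _ \<tau> ls])
    show "((\<lambda>y. Mx (Z y) a b) has_derivative (\<lambda>h. \<Sum>e\<in>UNIV. vt (D h) a e * Mx (Z x) e b)) (at x)" for a b
      using d[of a b] mm_vt_Mx(1)[of _ "Z x" a b] by (simp add: mm_def)
    show "((\<lambda>y. Mx (- Z y) a b) has_derivative (\<lambda>h. \<Sum>e\<in>UNIV. Mx (- Z x) a e * - vt (D h) e b)) (at x)" for a b
      using d'[of a b] mm_vt_Mx(2)[of "- Z x" _ a b] by (simp add: mm_def sum_negf)
  qed
  moreover have "dact (vt v) (\<lambda>a b. - vt v a b) \<sigma> us ls = - lact (vt v) \<sigma> us ls" for v \<sigma>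
    by (simp add: dact_def sum_negf)
  ultimately show ?thesis by (simp only: diff_conv_add_uminus)
qed

text \<open>Conjugating A by the frame change gives A + (A Y) \<otimes> dt: the factor on one side
  is absorbed because A takes spatial values, the factor on the other contributes A Y.\<close>

lemma Act_Mx_lact:
  fixes A :: "'n::finite option \<Rightarrow> 'n option \<Rightarrow> real"
  assumes "\<tau> \<in> tenvals k1 k2" and A: "\<And>b. A None b = 0"
  shows "Act k1 k2 (Mx (- Y)) (Mx Y) (lact A \<tau>) =
     lact (\<lambda>a b. A a b + vt (\<lambda>i. \<Sum>j\<in>UNIV. A (Some i) (Some j) * Y $ j) a b) (Act k1 k2 (Mx (- Y)) (Mx Y) \<tau>)"
proof (rule Act_dact[OF assms(1)])
  define v where "v = (\<lambda>i. \<Sum>j\<in>UNIV. A (Some i) (Some j) * Y $ j)"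
  have AM: "mm A (Mx Z) a b = A a b + (if b = None then \<Sum>j\<in>UNIV. A a (Some j) * Z $ j else 0)" for Z a b
    unfolding mm_def Mx_vt distrib_left sum.distrib sum_vt by simp
  have AM': "mm A (Mx Y) a b = A a b + vt v a b" for a b
    unfolding AM vt_def v_def by (auto simp: A split: option.splits)
  have MA: "mm (Mx Z) F a b = F a b" if "\<And>b. F None b = 0" for F :: "'n option \<Rightarrow> 'n option \<Rightarrow> real" and Z a b
    unfolding mm_def Mx_vt distrib_right sum.distrib sum_vt using that by (auto split: option.splits)
  show "mm A (Mx Y) a b = mm (Mx Y) (\<lambda>a b. A a b + vt v a b) a b" for a b
    unfolding AM' by (rule MA[symmetric]) (simp add: A vt_def)
  have "mm (\<lambda>a b. A a b + vt v a b) (Mx (- Y)) a b = mm A (Mx (- Y)) a b + mm (vt v) (Mx (- Y)) a b" for a b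
    by (simp add: mm_def distrib_right sum.distrib)
  then have 1: "mm (\<lambda>a b. A a b + vt v a b) (Mx (- Y)) a b = A a b" for a b
    unfolding AM mm_vt_Mx by (auto simp: vt_def v_def A sum_negf split: option.splits)
  show "mm (Mx (- Y)) (\<lambda>a b. - A a b) a b = mm (\<lambda>a b. - (A a b + vt v a b)) (Mx (- Y)) a b" for a b
  proof -
    have "mm (Mx (- Y)) (\<lambda>a b. - A a b) a b = - mm (Mx (- Y)) A a b"
      "mm (\<lambda>a b. - (A a b + vt v a b)) (Mx (- Y)) a b = - mm (\<lambda>a b. A a b + vt v a b) (Mx (- Y)) a b"
      by (simp_all only: mm_def mult_minus_left mult_minus_right sum_negf)
    then show ?thesis using 1[of a b] MA[of A "- Y" a b, OF A] by simp
  qed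
qed

text \<open>With \<open>Z\<close> the shift and \<open>Y\<close> extended independently of time, the sum involving \<open>v\<close> is the
  contribution of \<open>[Y, \<partial>\<^sub>t - Z]\<close>.\<close>

lemma Act_Lie:
  fixes \<tau> :: "real ^ ('n::finite) \<Rightarrow> 'n ten" and Z Y :: "real ^ 'n \<Rightarrow> real ^ 'n"
  assumes ten: "\<And>y. \<tau> y \<in> tenvals k1 k2"
    and d\<tau>: "\<And>us ls. (\<lambda>y. \<tau> y us ls) differentiable (at x)"
    and dZ: "\<And>j. (\<lambda>y. Z y $ j) differentiable (at x)"
  defines "\<tau>' \<equiv> \<lambda>y. Act k1 k2 (Mx (Z y)) (Mx (- Z y)) (\<tau> y)"
  shows "\<exists>v. Act k1 k2 (Mx (- Z x)) (Mx (Z x))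
      (\<lambda>us ls. (\<Sum>c\<in>UNIV. Y x $ c * spd c (\<lambda>y. \<tau>' y us ls) x) + lact (vjac Y x) (\<tau>' x) us ls)
    = (\<lambda>us ls. (\<Sum>c\<in>UNIV. Y x $ c * spd c (\<lambda>y. \<tau> y us ls) x) + lact (vjac Y x) (\<tau> x) us ls
        + (\<Sum>j\<in>UNIV. v j * lact (el (Some j) None) (\<tau> x) us ls))"
proof -
  define D where "D h j = frechet_derivative (\<lambda>y. Z y $ j) (at x) h" for h j
  have D: "((\<lambda>y. Z y $ j) has_derivative (\<lambda>h. D h j)) (at x)" for j
    unfolding D_def by (rule has_derivative_frechet[OF dZ])
  have D': "((\<lambda>y. (- Z y) $ j) has_derivative (\<lambda>h. - D h j)) (at x)" for j
    using has_derivative_minus[OF D] by simp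
  have \<tau>_der: "((\<lambda>y. \<tau> y us ls) has_derivative frechet_derivative (\<lambda>y. \<tau> y us ls) (at x)) (at x)" for us ls
    by (rule has_derivative_frechet[OF d\<tau>])
  have \<tau>'ten: "\<tau>' y \<in> tenvals k1 k2" for y by (simp add: \<tau>'_def Act_in_tenvals)
  have \<tau>'_diff: "(\<lambda>y. \<tau>' y us ls) differentiable (at x)" for us ls
  proof (cases "length us = k1 \<and> length ls = k2")
    case True
    show ?thesis
      unfolding \<tau>'_def differentiable_def
      by (rule exI, rule Act_Mx_has_derivative[OF D \<tau>_der]) (use True in auto)
  next
    case False
    then have "(\<lambda>y. \<tau>' y us ls) = (\<lambda>y. 0)" by (auto simp: \<tau>'_def Act_def)
    then show ?thesis by simp
  qed
  define E where "E h us ls = (\<Sum>c\<in>UNIV. h $ c * spd c (\<lambda>y. \<tau>' y us ls) x)" for h us ls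
  have E: "((\<lambda>y. \<tau>' y us ls) has_derivative (\<lambda>h. E h us ls)) (at x)" for us ls
    unfolding E_def spd_def by (rule pdir_axis_sum[OF \<tau>'_diff])
  have inverse: "Act k1 k2 (Mx (- Z y)) (Mx (Z y)) (\<tau>' y) = \<tau> y" for y
    unfolding \<tau>'_def by (rule Act_Mx_inverse(2)[OF ten])
  have step: "Act k1 k2 (Mx (- Z x)) (Mx (Z x)) (E (Y x)) us ls =
      (\<Sum>c\<in>UNIV. Y x $ c * spd c (\<lambda>y. \<tau> y us ls) x) - lact (vt (D (Y x))) (\<tau> x) us ls" for us ls
  proof (cases "length us = k1 \<and> length ls = k2")
    case True
    \<comment> \<open>The frame change is undone by the one with shift -Z, so differentiating the
      product returns the derivative of \<tau>; comparing the two expressions isolates the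
      transformed derivative of \<tau>'.\<close>
    have "((\<lambda>y. Act k1 k2 (Mx (- Z y)) (Mx (- (- Z y))) (\<tau>' y) us ls) has_derivative
      (\<lambda>h. Act k1 k2 (Mx (- Z x)) (Mx (- (- Z x))) (E h) us ls
        - lact (vt (\<lambda>j. - D h j)) (Act k1 k2 (Mx (- Z x)) (Mx (- (- Z x))) (\<tau>' x)) us ls)) (at x)"
      by (rule Act_Mx_has_derivative[OF D' E]) (use True in auto)
    then have "((\<lambda>y. \<tau> y us ls) has_derivative
      (\<lambda>h. Act k1 k2 (Mx (- Z x)) (Mx (Z x)) (E h) us ls - lact (vt (\<lambda>j. - D h j)) (\<tau> x) us ls)) (at x)"
      by (simp add: inverse)
    moreover have "((\<lambda>y. \<tau> y us ls) has_derivative (\<lambda>h. \<Sum>c\<in>UNIV. h $ c * spd c (\<lambda>y. \<tau> y us ls) x)) (at x)"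
      unfolding spd_def by (rule pdir_axis_sum[OF d\<tau>])
    ultimately have "(\<lambda>h. Act k1 k2 (Mx (- Z x)) (Mx (Z x)) (E h) us ls - lact (vt (\<lambda>j. - D h j)) (\<tau> x) us ls)
      = (\<lambda>h. \<Sum>c\<in>UNIV. h $ c * spd c (\<lambda>y. \<tau> y us ls) x)"
      by (rule has_derivative_unique)
    from fun_cong[OF this, of "Y x"] show ?thesis by (simp add: lact_vt sum_negf)
  next
    case False
    have "\<tau> y us ls = 0" for y using ten[of y] False by (auto simp: tenvals_def)
    moreover have "lact (vt (D (Y x))) (\<tau> x) us ls = 0"
      using dact_in_tenvals[OF ten[of x], of "\<lambda>a b. - vt (D (Y x)) a b" "vt (D (Y x))"] False by (auto simp: tenvals_def)
    ultimately show ?thesis using False by (auto simp: Act_def spd_const)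
  qed
  define u where "u = (\<lambda>i. \<Sum>j\<in>UNIV. vjac Y x (Some i) (Some j) * Z x $ j)"
  have rotated: "Act k1 k2 (Mx (- Z x)) (Mx (Z x)) (lact (vjac Y x) (\<tau>' x)) us ls =
     lact (vjac Y x) (\<tau> x) us ls + lact (vt u) (\<tau> x) us ls" for us ls
  proof -
    have v0: "vjac Y x None b = 0" for b by (simp add: vjac_def)
    have e1: "Act k1 k2 (Mx (- Z x)) (Mx (Z x)) (lact (vjac Y x) (\<tau>' x)) = lact (\<lambda>a b. vjac Y x a b + vt u a b) (\<tau> x)"
      using Act_Mx_lact[OF \<tau>'ten[of x], of "vjac Y x" "Z x", OF v0] unfolding inverse u_def .
    have e2: "lact (\<lambda>a b. vjac Y x a b + vt u a b) (\<tau> x) us ls = dact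
      (\<lambda>a b. - vjac Y x a b + - vt u a b) (\<lambda>a b. vjac Y x a b + vt u a b) (\<tau> x) us ls"
      by simp
    show ?thesis by (simp only: e1 e2 dact_add)
  qed
  show ?thesis
    unfolding E_def[symmetric]
    \<comment> \<open>The witness is the derivative of Y along Z minus that of Z along Y, that is,
      -[Y, Z].\<close>
    by (intro exI[of _ "\<lambda>j. u j - D (Y x) j"] ext)
      (simp add: Act_add step rotated lact_vt left_diff_distrib sum_subtractf)
qed

subsection \<open>Lapse, shift and unit normal\<close>

lemma riemannian_det:
  fixes hv :: "'n::finite \<Rightarrow> 'n \<Rightarrow> real"
  assumes "riemannian hv"
  shows "det (\<chi> i j. hv i j) \<noteq> 0"
proof -
  have "x = 0" if "(\<chi> i j. hv i j) *v x = 0" for x :: "real ^ 'n"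
  proof (rule ccontr)
    assume "x \<noteq> 0"
    then have "(\<lambda>i. x $ i) \<noteq> (\<lambda>_. 0)" by (auto simp: vec_eq_iff fun_eq_iff)
    then have "(\<Sum>i\<in>UNIV. \<Sum>j\<in>UNIV. hv i j * x $ i * x $ j) > 0"
      using assms unfolding riemannian_def by blast
    moreover have "(\<Sum>j\<in>UNIV. hv i j * x $ j) = 0" for i
      using that by (simp add: matrix_vector_mult_def vec_eq_iff)
    then have "(\<Sum>i\<in>UNIV. x $ i * (\<Sum>j\<in>UNIV. hv i j * x $ j)) = 0" by simp
    then have "(\<Sum>i\<in>UNIV. \<Sum>j\<in>UNIV. hv i j * x $ i * x $ j) = 0"
      by (simp add: sum_distrib_left mult_ac)
    ultimately show False by simp
  qed
  then show ?thesis
    by (simp add: invertible_det_nz[symmetric] invertible_left_inverse matrix_left_invertible_ker)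
qed

text \<open>Cramer's rule for h X = g(\<partial>_t, .). The shift is given only through the unit
  normal, and this formula makes its dependence on the metric visibly differentiable.\<close>

definition shift_of :: "('n::finite option \<Rightarrow> 'n option \<Rightarrow> real) \<Rightarrow> real ^ 'n" where
  "shift_of gv = (\<chi> k. det (\<chi> i j. if j = k then gv None (Some i) else gv (Some i) (Some j)) / det (\<chi> i j. gv (Some i) (Some j)))"

lemma shift_of_iff:
  fixes gv :: "'n::finite option \<Rightarrow> 'n option \<Rightarrow> real"
  assumes "riemannian (\<lambda>i j. gv (Some i) (Some j))"
  shows "(\<forall>i. (\<Sum>j\<in>UNIV. gv (Some i) (Some j) * Y $ j) = gv None (Some i)) \<longleftrightarrow> Y = shift_of gv"
proof -
  have "(\<forall>i. (\<Sum>j\<in>UNIV. gv (Some i) (Some j) * Y $ j) = gv None (Some i)) \<longleftrightarrow>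
      (\<chi> i j. gv (Some i) (Some j)) *v Y = (\<chi> i. gv None (Some i))"
    by (simp add: matrix_vector_mult_def vec_eq_iff)
  also have "\<dots> \<longleftrightarrow> Y = shift_of gv"
    unfolding cramer[OF riemannian_det[OF assms]] shift_of_def by (simp cong: if_cong)
  finally show ?thesis .
qed

text \<open>The vector \<partial>_t - X is orthogonal to the slices, and every normal is a multiple
  of it. It is timelike: a timelike v is a multiple of it plus an orthogonal spatial vector, and the
  spatial part has nonnegative square. The number n is the lapse. Uniqueness matters because
  \<open>nu\<close> is a definite description.\<close>

lemma unit_normal_iff:
  fixes gv :: "'n::finite option \<Rightarrow> 'n option \<Rightarrow> real"
  assumes lor: "lorentzian gv" and riem: "riemannian (\<lambda>i j. gv (Some i) (Some j))"
  obtains n where "n > 0" "n\<^sup>2 = - qf gv (case_option 1 (\<lambda>i. - shift_of gv $ i))"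
    "\<And>\<nu>. is_unit_normal gv \<nu> \<longleftrightarrow> \<nu> = (\<lambda>a. case_option 1 (\<lambda>i. - shift_of gv $ i) a / n)"
proof -
  have sym: "gv a b = gv b a" for a b using lor unfolding lorentzian_def by blast
  define m where "m = case_option 1 (\<lambda>i. - shift_of gv $ i)"
  have mN: "m None = 1" "m (Some i) = - shift_of gv $ i" for i by (simp_all add: m_def)
  have sh: "(\<Sum>j\<in>UNIV. gv (Some i) (Some j) * shift_of gv $ j) = gv None (Some i)" for i
    using shift_of_iff[OF riem] by blast
  have orth: "(\<Sum>a\<in>UNIV. gv a (Some i) * m a) = 0" for i
    using sh[of i] by (simp add: sum_option mN sum_negf sym)
  have qs: "qf gv (\<lambda>a. c * m a) = c\<^sup>2 * qf gv m" for c
    by (simp add: qf_def sum_distrib_left power2_eq_square mult_ac)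
  have nn: "qf gv u \<ge> 0" if "u None = 0" for u
  proof (cases "(\<lambda>i. u (Some i)) = (\<lambda>_. 0)")
    case True
    then show ?thesis using fun_cong[OF True] by (simp add: qf_spatial[where v = u, OF that])
  next
    case False
    then show ?thesis using riem unfolding riemannian_def qf_spatial[where v = u, OF that] by (meson less_imp_le)
  qed
  have "qf gv m < 0"
  proof -
    obtain v where v: "qf gv v < 0" using lor unfolding lorentzian_def by blast
    define c where "c = v None"
    define u where "u a = v a - c * m a" for a
    have uN: "u None = 0" by (simp add: u_def c_def mN)
    have "(\<Sum>a\<in>UNIV. \<Sum>b\<in>UNIV. gv a b * m a * u b) = (\<Sum>b\<in>UNIV. u b * (\<Sum>a\<in>UNIV. gv a b * m a))"
      by (subst sum.swap) (simp add: sum_distrib_left mult_ac)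
    also have "\<dots> = 0" by (simp add: sum_option[of "\<lambda>b. u b * _ b"] uN orth)
    finally have c1: "(\<Sum>a\<in>UNIV. \<Sum>b\<in>UNIV. gv a b * m a * u b) = 0" .
    have c2: "(\<Sum>a\<in>UNIV. \<Sum>b\<in>UNIV. gv a b * u a * m b) = 0"
      using c1 by (subst sum.swap) (simp add: sym mult_ac)
    have "v a = u a + c * m a" for a by (simp add: u_def)
    then have "qf gv v = qf gv u + c * (\<Sum>a\<in>UNIV. \<Sum>b\<in>UNIV. gv a b * m a * u b)
        + c * (\<Sum>a\<in>UNIV. \<Sum>b\<in>UNIV. gv a b * u a * m b) + c\<^sup>2 * qf gv m"
      by (simp add: qf_def distrib_left distrib_right sum.distrib sum_distrib_left power2_eq_square mult_ac)
    then have "c\<^sup>2 * qf gv m < 0" using v nn[of u, OF uN] c1 c2 by simp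
    then show ?thesis by (simp add: mult_less_0_iff)
  qed
  define n where "n = sqrt (- qf gv m)"
  have n: "n > 0" "n\<^sup>2 = - qf gv m" using \<open>qf gv m < 0\<close> by (simp_all add: n_def)
  have "is_unit_normal gv \<nu> \<longleftrightarrow> \<nu> = (\<lambda>a. m a / n)" for \<nu>
  proof
    assume \<nu>: "is_unit_normal gv \<nu>"
    then have p: "\<nu> None > 0" and q: "qf gv \<nu> = -1" and o: "\<And>i. (\<Sum>a\<in>UNIV. gv a (Some i) * \<nu> a) = 0"
      by (auto simp: is_unit_normal_def)
    define Y :: "real ^ 'n" where "Y = (\<chi> i. - \<nu> (Some i) / \<nu> None)"
    have "(\<Sum>j\<in>UNIV. gv (Some i) (Some j) * Y $ j) = gv None (Some i)" for i
    proof -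
      have "(\<Sum>j\<in>UNIV. gv (Some i) (Some j) * Y $ j) = - (\<Sum>j\<in>UNIV. gv (Some j) (Some i) * \<nu> (Some j)) / \<nu> None"
        by (simp add: Y_def sum_negf sum_divide_distrib sym)
      also have "(\<Sum>j\<in>UNIV. gv (Some j) (Some i) * \<nu> (Some j)) = - (gv None (Some i) * \<nu> None)"
        using o[of i] by (simp add: sum_option)
      finally show ?thesis using p by simp
    qed
    then have Y: "Y = shift_of gv" using shift_of_iff[OF riem] by blast
    have \<nu>m: "\<nu> a = \<nu> None * m a" for a
    proof (cases a)
      case (Some i)
      have "- \<nu> (Some i) / \<nu> None = shift_of gv $ i" using arg_cong[OF Y, of "\<lambda>v. v $ i"] by (simp add: Y_def)
      then have "- \<nu> (Some i) = \<nu> None * shift_of gv $ i" using p by (simp add: field_simps)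
      then show ?thesis unfolding Some mN by linarith
    qed (simp add: mN)
    have "qf gv \<nu> = qf gv (\<lambda>a. \<nu> None * m a)"
      by (rule arg_cong[where f = "qf gv"], rule ext, rule \<nu>m)
    then have "qf gv \<nu> = (\<nu> None)\<^sup>2 * qf gv m" unfolding qs .
    then have "(\<nu> None)\<^sup>2 * n\<^sup>2 = 1" using q n by simp
    then have "(\<nu> None * n)\<^sup>2 = 1" by (simp add: power_mult_distrib)
    moreover have "\<nu> None * n > 0" using p n(1) by simp
    ultimately have "\<nu> None * n = 1" by (auto simp: power2_eq_1_iff)
    then have "\<nu> None = 1 / n" using n(1) by (simp add: eq_divide_eq)
    have "\<nu> a = m a / n" for a
      by (subst \<nu>m) (simp add: \<open>\<nu> None = 1 / n\<close>)
    then show "\<nu> = (\<lambda>a. m a / n)" by (rule ext)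
  next
    assume \<nu>: "\<nu> = (\<lambda>a. m a / n)"
    have "qf gv (\<lambda>a. m a / n) = -1"
      using qs[of "1 / n"] n \<open>qf gv m < 0\<close> by (simp add: power_divide divide_simps)
    moreover have "(\<Sum>a\<in>UNIV. gv a (Some i) * (m a / n)) = 0" for i
      using orth[of i] by (simp add: sum_divide_distrib[symmetric])
    ultimately show "is_unit_normal gv \<nu>"
      using n unfolding is_unit_normal_def \<nu> by (simp add: mN)
  qed
  then show ?thesis using that n unfolding m_def by blast
qed

lemma is_unit_normal_nu:
  fixes gv :: "'n::finite option \<Rightarrow> 'n option \<Rightarrow> real"
  assumes "lorentzian gv" "riemannian (\<lambda>i j. gv (Some i) (Some j))"
  shows "is_unit_normal gv (nu gv)"
proof (rule unit_normal_iff[OF assms])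
  fix n assume "\<And>\<nu>. is_unit_normal gv \<nu> \<longleftrightarrow> \<nu> = (\<lambda>a. case_option 1 (\<lambda>i. - shift_of gv $ i) a / n)"
  then have "\<exists>!\<nu>. is_unit_normal gv \<nu>" by simp
  then show ?thesis unfolding nu_def by (rule theI')
qed

text \<open>The decomposition forces the normal to be (\<partial>_t - X)/n. Orthogonality to the
  slices then gives the shift, and normalization gives the lowered normal -n dt and the time-time
  component of the metric.\<close>

lemma adm:
  fixes gv :: "'n::finite option \<Rightarrow> 'n option \<Rightarrow> real"
  assumes lor: "lorentzian gv" and riem: "riemannian (\<lambda>i j. gv (Some i) (Some j))" and N: "n > 0"
    and dec: "\<And>a. (case a of None \<Rightarrow> 1 | Some i \<Rightarrow> 0) = n * nu gv a + (case a of None \<Rightarrow> 0 | Some i \<Rightarrow> Y $ i)"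
  shows "Y = shift_of gv" "gHNX (\<lambda>i j. gv (Some i) (Some j)) n Y = gv"
    "(\<Sum>a\<in>UNIV. gv a b * nu gv a) = (if b = None then - n else 0)"
proof -
  have sym: "gv a b = gv b a" for a b using lor unfolding lorentzian_def by blast
  have nu: "is_unit_normal gv (nu gv)" by (rule is_unit_normal_nu[OF lor riem])
  have nN: "nu gv None = 1 / n" using dec[of None] N by (simp add: field_simps)
  have nS: "nu gv (Some i) = - Y $ i / n" for i using dec[of "Some i"] N by (simp add: field_simps)
  have o: "(\<Sum>a\<in>UNIV. gv a (Some i) * nu gv a) = 0" for i using nu by (simp add: is_unit_normal_def)
  have sh: "(\<Sum>j\<in>UNIV. gv (Some i) (Some j) * Y $ j) = gv None (Some i)" for i
  proof -
    have "gv None (Some i) * (1 / n) - (\<Sum>j\<in>UNIV. gv (Some i) (Some j) * Y $ j) / n = 0"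
      using o[of i] by (simp add: sum_option nN nS sum_divide_distrib sum_negf sym)
    then show ?thesis using N by (simp add: field_simps)
  qed
  then show "Y = shift_of gv" using shift_of_iff[OF riem] by blast
  have q: "qf gv (nu gv) = -1" using nu by (simp add: is_unit_normal_def)
  have "qf gv (nu gv) = (\<Sum>b\<in>UNIV. nu gv b * (\<Sum>a\<in>UNIV. gv a b * nu gv a))"
    unfolding qf_def by (subst sum.swap) (simp add: sum_distrib_left mult_ac)
  also have "\<dots> = (1 / n) * (\<Sum>a\<in>UNIV. gv a None * nu gv a)"
    by (simp add: sum_option[of "\<lambda>b. nu gv b * _ b"] o nN)
  finally have gN: "(\<Sum>a\<in>UNIV. gv a None * nu gv a) = - n" using q N by (simp add: field_simps)
  then show "(\<Sum>a\<in>UNIV. gv a b * nu gv a) = (if b = None then - n else 0)"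
    using o by (cases b) auto
  have "gv None None * (1 / n) - (\<Sum>j\<in>UNIV. gv None (Some j) * Y $ j) / n = - n"
    using gN by (simp add: sum_option nN nS sum_divide_distrib sum_negf sym)
  then have tt: "gv None None = - n\<^sup>2 + (\<Sum>j\<in>UNIV. gv None (Some j) * Y $ j)"
    using N by (simp add: field_simps power2_eq_square)
  have "(\<Sum>i\<in>UNIV. \<Sum>j\<in>UNIV. gv (Some i) (Some j) * Y $ i * Y $ j) = (\<Sum>i\<in>UNIV. Y $ i * gv None (Some i))"
    unfolding sh[symmetric] by (simp add: sum_distrib_left mult_ac)
  then have XX: "(\<Sum>i\<in>UNIV. \<Sum>j\<in>UNIV. gv (Some i) (Some j) * Y $ i * Y $ j) = (\<Sum>j\<in>UNIV. gv None (Some j) * Y $ j)"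
    by (simp add: mult.commute)
  have sh': "(\<Sum>i\<in>UNIV. gv (Some i) (Some j) * Y $ i) = gv None (Some j)" for j
    using sh[of j] by (simp add: sym)
  show "gHNX (\<lambda>i j. gv (Some i) (Some j)) n Y = gv"
  proof (intro ext)
    fix a b
    show "gHNX (\<lambda>i j. gv (Some i) (Some j)) n Y a b = gv a b"
      using tt XX sh sh' sym by (cases a; cases b) (simp_all add: gHNX_def)
  qed
qed

lemma det_differentiable:
  fixes A :: "'z::real_normed_vector \<Rightarrow> 'a::finite \<Rightarrow> 'a \<Rightarrow> real"
  assumes "\<And>i j. (\<lambda>x. A x i j) differentiable (at p)"
  shows "(\<lambda>x. det (\<chi> i j. A x i j)) differentiable (at p)"
proof -
  have "(\<lambda>x. \<Prod>i\<in>UNIV. A x i (\<pi> i)) differentiable (at p)" for \<pi> :: "'a \<Rightarrow> 'a"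
  proof -
    have "\<exists>f'. ((\<lambda>x. \<Prod>i\<in>UNIV. A x i (\<pi> i)) has_derivative f') (at p)"
      by (rule exI, rule has_derivative_prod, rule has_derivative_frechet, rule assms)
    then show ?thesis by (simp add: differentiable_def)
  qed
  then show ?thesis
    unfolding det_def by (simp add: finite_permutations)
qed

lemma shift_differentiable:
  fixes g :: "'z::real_normed_vector \<Rightarrow> 'n::finite option \<Rightarrow> 'n option \<Rightarrow> real"
  assumes "\<And>a b. (\<lambda>x. g x a b) differentiable (at p)" "riemannian (\<lambda>i j. g p (Some i) (Some j))"
  shows "(\<lambda>x. shift_of (g x) $ k) differentiable (at p)"
proof -
  have "(\<lambda>x. det (\<chi> i j. if j = k then g x None (Some i) else g x (Some i) (Some j))) differentiable (at p)"
    by (rule det_differentiable, rename_tac i j, case_tac "j = k") (simp_all add: assms)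
  moreover have "(\<lambda>x. det (\<chi> i j. g x (Some i) (Some j))) differentiable (at p)"
    by (rule det_differentiable) (simp add: assms)
  ultimately show ?thesis
    unfolding shift_of_def using riemannian_det[OF assms(2)] by (simp cong: if_cong)
qed

section \<open>Differentiation of the matrix inverse\<close>

lemma matrix_inv_right:
  fixes B :: "real ^ 'a::finite ^ 'a"
  assumes "det B \<noteq> 0"
  shows "B ** matrix_inv B = mat 1" "matrix_inv B ** B = mat 1"
proof -
  obtain C where "B ** C = mat 1" "C ** B = mat 1"
    using assms unfolding invertible_det_nz[symmetric] invertible_def by blast
  then show "B ** matrix_inv B = mat 1" "matrix_inv B ** B = mat 1"
    using matrix_inv_eqI by metis+
qed

text \<open>Entries of the inverse as quotients of determinants, the source of its continuity along
  a path.\<close>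

lemma matrix_inv_cramer:
  fixes B :: "real ^ 'a::finite ^ 'a"
  assumes "det B \<noteq> 0"
  shows "matrix_inv B $ k $ j = det (\<chi> i l. if l = k then axis j 1 $ i else B $ i $ l) / det B"
proof -
  have "B *v column j (matrix_inv B) = axis j 1"
    using matrix_inv_right(1)[OF assms]
    by (simp add: vec_eq_iff matrix_vector_mult_def matrix_matrix_mult_def column_def mat_def axis_def)
  then have "column j (matrix_inv B) = (\<chi> k. det (\<chi> i l. if l = k then axis j 1 $ i else B $ i $ l) / det B)"
    using cramer[OF assms] by blast
  then show ?thesis by (simp add: column_def vec_eq_iff)
qed

lemma isCont_det:
  fixes A :: "real \<Rightarrow> 'a::finite \<Rightarrow> 'a \<Rightarrow> real"
  assumes "\<And>i j. (\<lambda>x. A x i j) differentiable (at p)"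
  shows "((\<lambda>x. det (\<chi> i j. A x i j)) \<longlongrightarrow> det (\<chi> i j. A p i j)) (at p)"
  using differentiable_imp_continuous_within[OF det_differentiable[OF assms]] by (simp add: continuous_within)

text \<open>The resolvent identity (A + \<epsilon> E)^{-1} = A^{-1} - \<epsilon> (A + \<epsilon>
  E)^{-1} E A^{-1} turns the difference quotient into an expression whose limit needs only
  continuity of the inverse.\<close>

lemma matrix_inv_path:
  fixes A E :: "real ^ 'a::finite ^ 'a"
  assumes A: "det A \<noteq> 0"
  shows "\<forall>\<^sub>F \<epsilon> in at 0. det (A + \<epsilon> *\<^sub>R E) \<noteq> 0"
    "((\<lambda>\<epsilon>. matrix_inv (A + \<epsilon> *\<^sub>R E) $ i $ j) has_field_derivative
       - (matrix_inv A ** E ** matrix_inv A) $ i $ j) (at 0)"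
proof -
  define B where "B \<epsilon> = A + \<epsilon> *\<^sub>R E" for \<epsilon>
  have B0: "B 0 = A" by (simp add: B_def)
  have eta: "(\<chi> i j. M $ i $ j) = M" for M :: "real ^ 'a ^ 'a" by (simp add: vec_eq_iff)
  have c1: "((\<lambda>\<epsilon>. det (B \<epsilon>)) \<longlongrightarrow> det A) (at 0)"
    using isCont_det[of "\<lambda>\<epsilon> i j. B \<epsilon> $ i $ j" 0] by (simp add: eta B0) (simp add: B_def)
  show ev: "\<forall>\<^sub>F \<epsilon> in at 0. det (A + \<epsilon> *\<^sub>R E) \<noteq> 0"
    using tendsto_imp_eventually_ne[OF c1 A] by (simp add: B_def)
  have c2: "((\<lambda>\<epsilon>. matrix_inv (B \<epsilon>) $ k $ l) \<longlongrightarrow> matrix_inv A $ k $ l) (at 0)" for k l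
  proof -
    have "((\<lambda>\<epsilon>. det (\<chi> i m. if m = k then axis l 1 $ i else B \<epsilon> $ i $ m)) \<longlongrightarrow>
        det (\<chi> i m. if m = k then axis l 1 $ i else B 0 $ i $ m)) (at 0)"
      by (rule isCont_det, rename_tac i m, case_tac "m = k") (simp_all add: B_def)
    from tendsto_divide[OF this c1 A]
    have "((\<lambda>\<epsilon>. det (\<chi> i m. if m = k then axis l 1 $ i else B \<epsilon> $ i $ m) / det (B \<epsilon>)) \<longlongrightarrow> matrix_inv A $ k $ l) (at 0)"
      unfolding B0 matrix_inv_cramer[OF A] .
    then show ?thesis
    proof (rule Lim_transform_eventually)
      show "\<forall>\<^sub>F \<epsilon> in at 0. det (\<chi> i m. if m = k then axis l 1 $ i else B \<epsilon> $ i $ m) / det (B \<epsilon>) = matrix_inv (B \<epsilon>) $ k $ l"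
        using ev unfolding B_def[symmetric] by eventually_elim (simp add: matrix_inv_cramer)
    qed
  qed
  have "((\<lambda>\<epsilon>. - (matrix_inv (B \<epsilon>) ** E ** matrix_inv A) $ i $ j) \<longlongrightarrow> - (matrix_inv A ** E ** matrix_inv A) $ i $ j) (at 0)"
    unfolding matrix_matrix_mult_def by (simp, intro tendsto_intros c2)
  then have "((\<lambda>\<epsilon>. (matrix_inv (B \<epsilon>) $ i $ j - matrix_inv (B 0) $ i $ j) / (\<epsilon> - 0)) \<longlongrightarrow> - (matrix_inv A ** E ** matrix_inv A) $ i $ j) (at 0)"
  proof (rule Lim_transform_eventually)
    have ne: "\<forall>\<^sub>F \<epsilon> in at 0. \<epsilon> \<noteq> (0::real)" by (simp add: eventually_at_filter)
    show "\<forall>\<^sub>F \<epsilon> in at 0. - (matrix_inv (B \<epsilon>) ** E ** matrix_inv A) $ i $ j = (matrix_inv (B \<epsilon>) $ i $ j - matrix_inv (B 0) $ i $ j) / (\<epsilon> - 0)"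
      using ev[folded B_def] ne
    proof eventually_elim
      case (elim \<epsilon>)
      let ?R = "matrix_inv (B \<epsilon>)" and ?G = "matrix_inv A"
      have "?R = ?R ** A ** ?G" by (simp add: matrix_mul_assoc[symmetric] matrix_inv_right(1)[OF A])
      moreover have "?R ** A = mat 1 - \<epsilon> *\<^sub>R (?R ** E)"
      proof -
        have "?R ** B \<epsilon> = mat 1" by (rule matrix_inv_right(2)[OF elim(1)])
        then have "?R ** A + \<epsilon> *\<^sub>R (?R ** E) = mat 1"
          by (simp add: B_def matrix_add_ldistrib matrix_scalar_ac scalar_matrix_assoc[symmetric])
        then show ?thesis by (simp add: algebra_simps)
      qed
      ultimately have "?R = (mat 1 - \<epsilon> *\<^sub>R (?R ** E)) ** ?G" by metis
      also have "\<dots> = ?G - \<epsilon> *\<^sub>R (?R ** E ** ?G)"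
        by (simp add: vec_eq_iff matrix_matrix_mult_def mat_def left_diff_distrib sum_subtractf sum_distrib_left mult.assoc
            if_distrib[of "\<lambda>x. x * _"] cong: if_cong) (simp add: sum_distrib_left[symmetric] mult.assoc)
      finally have "?R $ i $ j = (?G - \<epsilon> *\<^sub>R (?R ** E ** ?G)) $ i $ j" by (rule arg_cong)
      then show ?case using elim(2) by (simp add: B0 field_simps)
    qed
  qed
  then show "((\<lambda>\<epsilon>. matrix_inv (A + \<epsilon> *\<^sub>R E) $ i $ j) has_field_derivative
       - (matrix_inv A ** E ** matrix_inv A) $ i $ j) (at 0)"
    unfolding has_field_derivative_iff B_def .
qed

lemma matrix_inv_symmetric:
  fixes B :: "real ^ 'a::finite ^ 'a"
  assumes "det B \<noteq> 0" "\<And>i j. B $ i $ j = B $ j $ i"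
  shows "matrix_inv B $ i $ j = matrix_inv B $ j $ i"
proof -
  have t: "transpose B = B" using assms(2) by (simp add: transpose_def vec_eq_iff)
  have "B ** transpose (matrix_inv B) = mat 1" "transpose (matrix_inv B) ** B = mat 1"
    using matrix_inv_right[OF assms(1)] by (metis t matrix_transpose_mul transpose_mat)+
  then have "matrix_inv B = transpose (matrix_inv B)" by (rule matrix_inv_eqI)
  then have "matrix_inv B $ i $ j = transpose (matrix_inv B) $ i $ j" by (rule arg_cong)
  then show ?thesis by (simp add: transpose_def)
qed

subsection \<open>Momentum density and conjugate momentum\<close>

lemma dec_add: "dec k1 k2 (\<lambda>us ls. \<sigma> us ls + c * \<tau> us ls) cu cl us ls = dec k1 k2 \<sigma> cu cl us ls + c * dec k1 k2 \<tau> cu cl us ls"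
  by (simp add: dec_def)

lemma Esym_el: "Esym a b $ c $ d = (el a b c d + el b a c d) / 2"
  by (simp add: Esym_def el_def)

lemma sandwich_Esym:
  fixes G :: "real ^ 'n::finite option ^ 'n option"
  shows "(G ** Esym a b ** G) $ c $ d = (G $ c $ a * G $ b $ d + G $ c $ b * G $ a $ d) / 2"
proof -
  have "(G ** Esym a b) $ c $ k = (if k = b then G $ c $ a / 2 else 0) + (if k = a then G $ c $ b / 2 else 0)" for k
  proof -
    have "(G ** Esym a b) $ c $ k = (\<Sum>l\<in>UNIV. (G $ c $ l / 2) * el a b l k) + (\<Sum>l\<in>UNIV. (G $ c $ l / 2) * el b a l k)"
      unfolding sum.distrib[symmetric]
      by (simp add: matrix_matrix_mult_def Esym_el distrib_left add_divide_distrib)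
    then show ?thesis unfolding sum_el .
  qed
  then have "(G ** Esym a b ** G) $ c $ d =
      (\<Sum>k\<in>UNIV. ((if k = b then G $ c $ a / 2 else 0) + (if k = a then G $ c $ b / 2 else 0)) * G $ k $ d)"
    by (simp add: matrix_matrix_mult_def[of "G ** Esym a b"])
  then show ?thesis
    by (simp add: distrib_right sum.distrib if_distrib[of "\<lambda>x. x * _"] add_divide_distrib cong: if_cong)
qed

context matter
begin

lemma EL_continuous: "c \<in> jcoords k1 k2 \<Longrightarrow> continuous_on M (\<lambda>p. EL p c)"
  unfolding EL_def
proof (rule Lpart_continuous[OF lagr])
  show "continuous_on M (\<lambda>p. T p us ls)" for us ls
    by (rule Csmooth_on_continuous[OF T_smooth open_M])
  show "continuous_on M (\<lambda>p. dT T p a us ls)" for a us ls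
    unfolding dT_def pd_def
    by (rule Csmooth_on_continuous[OF Csmooth_on_pdir[OF T_smooth] open_M]) simp
  show "continuous_on M (\<lambda>p. g p a b)" for a b
    using lor_metric Csmooth_on_continuous[OF _ open_M] by (simp add: lor_metric_def)
qed (use lorentzian in auto)

lemma flux_continuous:
  assumes "\<And>us ls. continuous_on M (\<lambda>p. \<tau> p us ls)"
  shows "continuous_on M (\<lambda>p. flux p a (\<tau> p))"
  unfolding flux_def tpair_def
  by (intro continuous_on_sum continuous_on_mult assms EL_continuous) (auto simp: jcoords_def lists_len_def)

lemma mom_continuous: "continuous_on M (\<lambda>p. mom p i)"
  unfolding mom_def
  using lor_metric Csmooth_on_continuous[OF _ open_M]
  by (intro continuous_on_add continuous_on_sum continuous_on_mult EL_continuous) (auto simp: jcoords_def lor_metric_def)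

text \<open>The chain rule with \<delta>g = - g E g, where E is the symmetrized elementary variation
  of the inverse metric.\<close>

lemma dLdginv_eq:
  assumes p: "p \<in> M"
  shows "dLdginv L p (T p) (dT T p) (g p) a b =
    - (\<Sum>c\<in>UNIV. \<Sum>d\<in>UNIV. EL p (JG c d) * ((g p c a * g p b d + g p c b * g p a d) / 2))"
proof -
  define G where "G = toM (g p)"
  have Gn: "G $ c $ d = g p c d" for c d by (simp add: G_def toM_def)
  have dG: "det G \<noteq> 0" using lorentzian[OF p] by (simp add: lorentzian_def G_def)
  define A where "A = matrix_inv G"
  have AG: "A ** G = mat 1" "G ** A = mat 1" using matrix_inv_right[OF dG] by (simp_all add: A_def)
  have iA: "matrix_inv A = G" by (rule matrix_inv_eqI[OF AG])
  have "det A * det G = 1" using AG(1) by (metis det_I det_mul)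
  then have dA: "det A \<noteq> 0" by auto
  have symA: "A $ c $ d = A $ d $ c" for c d
    unfolding A_def by (rule matrix_inv_symmetric[OF dG]) (simp add: Gn g_sym[OF p])
  define R where "R \<epsilon> = matrix_inv (A + \<epsilon> *\<^sub>R Esym a b)" for \<epsilon>
  obtain r where r: "r > 0" "\<And>\<epsilon>. \<epsilon> \<noteq> 0 \<Longrightarrow> dist \<epsilon> 0 < r \<Longrightarrow> det (A + \<epsilon> *\<^sub>R Esym a b) \<noteq> 0"
    using matrix_inv_path(1)[OF dA, of "Esym a b"] unfolding eventually_at by blast
  have det_r: "det (A + \<epsilon> *\<^sub>R Esym a b) \<noteq> 0" if "\<bar>\<epsilon>\<bar> < r" for \<epsilon>
    using r(2)[of \<epsilon>] that dA by (cases "\<epsilon> = 0") (auto simp: dist_real_def)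
  \<comment> \<open>The inverse is known to exist, and hence to be symmetric, only for small
    \<epsilon>, whereas the chain rule asks for a symmetric curve throughout. Outside the good
    interval the curve is set to g, which does not affect the derivative at 0.\<close>
  define \<gamma> where "\<gamma> \<epsilon> = (if \<bar>\<epsilon>\<bar> < r then fromM (R \<epsilon>) else g p)" for \<epsilon>
  have R0: "R 0 = G" by (simp add: R_def iA)
  have \<gamma>0: "\<gamma> 0 = g p" using r(1) by (simp add: \<gamma>_def R0 fromM_def Gn)
  have "((\<lambda>\<epsilon>. L p (T p) (dT T p) (\<gamma> \<epsilon>)) has_field_derivative
      tpair k1 k2 (\<lambda>us ls. EL p (JT us ls)) (\<lambda>_ _. 0) + (\<Sum>e\<in>UNIV. tpair k1 k2 (\<lambda>us ls. EL p (JD e us ls)) (\<lambda>_ _. 0))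
      + (\<Sum>c\<in>UNIV. \<Sum>d\<in>UNIV. EL p (JG c d) * - (G ** Esym a b ** G) $ c $ d)) (at 0)"
  proof (rule lagrangian_chain[OF lagr open_M p])
    show "lorentzian (\<gamma> 0)" "riemannian (\<lambda>i j. \<gamma> 0 (Some i) (Some j))"
      using lorentzian[OF p] riem[OF p] by (simp_all add: \<gamma>0)
    show "EL p = Lpart k1 k2 L p (T p) (dT T p) (\<gamma> 0)" by (simp add: \<gamma>0 EL_def)
    show "\<gamma> s c d = \<gamma> s d c" for s c d
    proof (cases "\<bar>s\<bar> < r")
      case True
      have "R s $ c $ d = R s $ d $ c"
        unfolding R_def
      proof (rule matrix_inv_symmetric[OF det_r[OF True]])
        fix i j
        have "Esym a b $ i $ j = Esym a b $ j $ i" by (simp only: Esym_def vec_lambda_beta conj_commute add.commute)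
        then show "(A + s *\<^sub>R Esym a b) $ i $ j = (A + s *\<^sub>R Esym a b) $ j $ i"
          unfolding vector_add_component vector_scaleR_component symA[of i j] by (simp only:)
      qed
      then show ?thesis using True by (simp add: \<gamma>_def fromM_def)
    next
      case False
      then show ?thesis using g_sym[OF p, of c d] by (simp only: \<gamma>_def if_False)
    qed
    show "((\<lambda>s. \<gamma> s c d) has_field_derivative - (G ** Esym a b ** G) $ c $ d) (at 0)" for c d
    proof (rule has_field_derivative_transform_within_open)
      show "((\<lambda>s. R s $ c $ d) has_field_derivative - (G ** Esym a b ** G) $ c $ d) (at 0)"
        using matrix_inv_path(2)[OF dA, of "Esym a b" c d] by (simp add: R_def iA)
      show "R s $ c $ d = \<gamma> s c d" if "s \<in> {-r<..<r}" for s
        using that by (auto simp: \<gamma>_def fromM_def abs_less_iff)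
    qed (use r(1) in auto)
  qed (simp_all add: T_tenvals dT_tenvals)
  then have "((\<lambda>\<epsilon>. L p (T p) (dT T p) (\<gamma> \<epsilon>)) has_field_derivative
      - (\<Sum>c\<in>UNIV. \<Sum>d\<in>UNIV. EL p (JG c d) * ((g p c a * g p b d + g p c b * g p a d) / 2))) (at 0)"
    unfolding sandwich_Esym Gn tpair_zero by (simp add: sum_negf)
  then have "((\<lambda>\<epsilon>. L p (T p) (dT T p) (fromM (R \<epsilon>))) has_field_derivative
      - (\<Sum>c\<in>UNIV. \<Sum>d\<in>UNIV. EL p (JG c d) * ((g p c a * g p b d + g p c b * g p a d) / 2))) (at 0)"
    by (rule has_field_derivative_transform_within_open[where S = "{-r<..<r}"]) (use r(1) in \<open>auto simp: \<gamma>_def abs_less_iff\<close>)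
  then show ?thesis
    unfolding dLdginv_def R_def A_def G_def by (rule DERIV_imp_deriv)
qed

text \<open>Contraction with the normal turns one factor g into -N dt, so only coefficients with a
  time index survive and they form \<open>mom\<close>. The factor N cancels against dV_h = dV_g / N,
  and 1/2 remains from the symmetrization of the variation.\<close>

lemma Jmom_eq:
  assumes p: "p \<in> M" and dec: "decomp M g h N X"
  shows "Jmom L ori g T p v * dVh ori g N p = (\<Sum>i\<in>UNIV. v $ i * mom p i) / 2"
proof -
  have N: "N p > 0" and eq: "\<And>a. (case a of None \<Rightarrow> 1 | Some i \<Rightarrow> 0) =
      N p * nu (g p) a + (case a of None \<Rightarrow> 0 | Some i \<Rightarrow> X p $ i)"
    using dec p unfolding decomp_def by blast+
  have nu1: "(\<Sum>a\<in>UNIV. g p a b * nu (g p) a) = (if b = None then - N p else 0)" for b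
    by (rule adm(3)[OF lorentzian[OF p] riem[OF p] N eq])
  have nu2: "(\<Sum>a\<in>UNIV. g p b a * nu (g p) a) = (if b = None then - N p else 0)" for b
    using nu1[of b] by (simp add: g_sym[OF p])
  have V: "dVg ori g p \<noteq> 0"
    using ori p lorentzian[OF p] by (auto simp: dVg_def orientation_def lorentzian_def)
  have contr: "(\<Sum>a\<in>UNIV. dLdginv L p (T p) (dT T p) (g p) a (Some i) * nu (g p) a) = N p / 2 * mom p i" for i
  proof -
    have "(\<Sum>a\<in>UNIV. dLdginv L p (T p) (dT T p) (g p) a (Some i) * nu (g p) a) =
       - (\<Sum>a\<in>UNIV. \<Sum>c\<in>UNIV. \<Sum>d\<in>UNIV. (EL p (JG c d) * g p (Some i) d / 2) * (g p c a * nu (g p) a)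
          + (EL p (JG c d) * g p c (Some i) / 2) * (g p a d * nu (g p) a))"
      unfolding dLdginv_eq[OF p] mult_minus_left sum_negf sum_distrib_right
      by (simp add: algebra_simps add_divide_distrib)
    also have "\<dots> = - (\<Sum>c\<in>UNIV. \<Sum>d\<in>UNIV. (EL p (JG c d) * g p (Some i) d / 2) * (\<Sum>a\<in>UNIV. g p c a * nu (g p) a)
          + (EL p (JG c d) * g p c (Some i) / 2) * (\<Sum>a\<in>UNIV. g p a d * nu (g p) a))"
    proof -
      define F where "F a c d = (EL p (JG c d) * g p (Some i) d / 2) * (g p c a * nu (g p) a)
          + (EL p (JG c d) * g p c (Some i) / 2) * (g p a d * nu (g p) a)" for a c d
      have "(\<Sum>a\<in>UNIV. \<Sum>c\<in>UNIV. \<Sum>d\<in>UNIV. F a c d) = (\<Sum>c\<in>UNIV. \<Sum>a\<in>UNIV. \<Sum>d\<in>UNIV. F a c d)"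
        by (rule sum.swap)
      also have "\<dots> = (\<Sum>c\<in>UNIV. \<Sum>d\<in>UNIV. \<Sum>a\<in>UNIV. F a c d)"
        by (rule sum.cong[OF refl], rule sum.swap)
      finally show ?thesis unfolding F_def by (simp add: sum.distrib sum_distrib_left)
    qed
    also have "\<dots> = N p / 2 * ((\<Sum>c\<in>UNIV. \<Sum>d\<in>UNIV. if c = None then EL p (JG c d) * g p (Some i) d else 0)
          + (\<Sum>c\<in>UNIV. \<Sum>d\<in>UNIV. if d = None then EL p (JG c d) * g p c (Some i) else 0))"
    proof -
      have "(EL p (JG c d) * g p (Some i) d / 2) * (if c = None then - N p else 0)
          + (EL p (JG c d) * g p c (Some i) / 2) * (if d = None then - N p else 0)
        = - (N p / 2 * (if c = None then EL p (JG c d) * g p (Some i) d else 0)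
          + N p / 2 * (if d = None then EL p (JG c d) * g p c (Some i) else 0))" for c d
        by (cases "c = None"; cases "d = None") (simp_all add: algebra_simps del: not_None_eq)
      then show ?thesis
        unfolding nu1 nu2 by (simp only: sum_negf sum.distrib sum_distrib_left[symmetric] distrib_left minus_minus)
    qed
    also have "(\<Sum>c\<in>UNIV. \<Sum>d\<in>UNIV. if c = None then EL p (JG c d) * g p (Some i) d else 0) = (\<Sum>d\<in>UNIV. EL p (JG None d) * g p (Some i) d)"
      by (subst sum.swap) simp
    also have "(\<Sum>c\<in>UNIV. \<Sum>d\<in>UNIV. if d = None then EL p (JG c d) * g p c (Some i) else 0) = (\<Sum>c\<in>UNIV. EL p (JG c None) * g p c (Some i))"
      by simp
    finally show ?thesis by (simp add: mom_def)
  qed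
  have "Jmom L ori g T p v = (\<Sum>a\<in>UNIV. \<Sum>i\<in>UNIV. (v $ i / dVg ori g p) * (dLdginv L p (T p) (dT T p) (g p) a (Some i) * nu (g p) a))"
    by (simp add: Jmom_def TSE_def sum_negf mult_ac)
  also have "\<dots> = (\<Sum>i\<in>UNIV. (v $ i / dVg ori g p) * (N p / 2 * mom p i))"
    unfolding contr[symmetric] sum_distrib_left by (rule sum.swap)
  finally have "Jmom L ori g T p v * dVh ori g N p = (\<Sum>i\<in>UNIV. (v $ i / dVg ori g p) * (N p / 2 * mom p i)) * (dVg ori g p / N p)"
    by (simp add: dVh_def)
  also have "\<dots> = (\<Sum>i\<in>UNIV. v $ i * mom p i) / 2"
    unfolding sum_distrib_right sum_divide_distrib using V N by (intro sum.cong refl) (simp add: field_simps)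
  finally show ?thesis .
qed

text \<open>On the open set M the shift agrees with \<open>shift_of (g q)\<close>, which depends
  differentiably on the metric components.\<close>

lemma shift_diff:
  assumes p: "p \<in> M" and dec: "decomp M g h N X"
  shows "(\<lambda>q. X q $ k) differentiable (at p)"
proof (rule differentiable_cong_open[OF open_M p])
  show "shift_of (g q) $ k = X q $ k" if q: "q \<in> M" for q
  proof -
    have "X q = shift_of (g q)"
      by (rule adm(1)[OF lorentzian[OF q] riem[OF q]]) (use dec q in \<open>unfold decomp_def, blast+\<close>)
    then show ?thesis by simp
  qed
  show "(\<lambda>q. shift_of (g q) $ k) differentiable (at p)"
    using lor_metric Csmooth_on_differentiable[OF _ open_M p]
    by (intro shift_differentiable riem[OF p]) (simp add: lor_metric_def)
qed

text \<open>Reassembled, the extension of B becomes T + \<epsilon> (t - t_p) R, where R is the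
  perturbation in the coordinate frame. At p it changes neither T nor its spatial derivatives and
  shifts \<partial>_t T by \<epsilon> R(p), so the conjugate momentum is \<pi> evaluated on
  R(p).\<close>

lemma PiB_dec:
  assumes p: "p \<in> M" and dec: "decomp M g h N X" and \<tau>: "\<tau> \<in> tenvals k1 k2"
  shows "PiB k1 k2 L h N X (\<lambda>q. Sdec k1 k2 (X q) (T q)) p (dec k1 k2 \<tau>) =
     flux p None (Act k1 k2 (Mx (- X p)) (Mx (X p)) \<tau>)"
proof -
  define R where "R q = Act k1 k2 (Mx (- X q)) (Mx (X q)) \<tau>" for q
  define Tf where "Tf \<epsilon> q us ls = T q us ls + \<epsilon> * ((q $ None - p $ None) * R q us ls)" for \<epsilon> q us ls
  have N: "N p > 0" and eq: "\<And>a. (case a of None \<Rightarrow> 1 | Some i \<Rightarrow> 0) =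
      N p * nu (g p) a + (case a of None \<Rightarrow> 0 | Some i \<Rightarrow> X p $ i)" and hp: "h p = (\<lambda>i j. g p (Some i) (Some j))"
    using dec p unfolding decomp_def by blast+
  have gH: "gHNX (h p) (N p) (X p) = g p"
    unfolding hp by (rule adm(2)[OF lorentzian[OF p] riem[OF p] N eq])
  have Rten: "R q \<in> tenvals k1 k2" for q by (simp add: R_def Act_in_tenvals)
  have Sinv: "Sinv k1 k2 (X q) (\<lambda>cu cl us ls. Sdec k1 k2 (X q) (T q) cu cl us ls + \<epsilon> * (q $ None - p $ None) * dec k1 k2 \<tau> cu cl us ls)
     = Tf \<epsilon> q" for \<epsilon> q
  proof -
    let ?A = "Act k1 k2 (Mx (X q)) (Mx (- X q)) (T q)"
    have "(\<lambda>cu cl us ls. Sdec k1 k2 (X q) (T q) cu cl us ls + \<epsilon> * (q $ None - p $ None) * dec k1 k2 \<tau> cu cl us ls)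
      = dec k1 k2 (\<lambda>us ls. ?A us ls + \<epsilon> * (q $ None - p $ None) * \<tau> us ls)"
      unfolding Sdec_eq by (intro ext) (simp add: dec_add)
    moreover have "(\<lambda>us ls. ?A us ls + \<epsilon> * (q $ None - p $ None) * \<tau> us ls) \<in> tenvals k1 k2"
      using \<tau> Act_in_tenvals[of k1 k2 _ _ "T q"] by (auto simp: tenvals_def)
    ultimately have "Sinv k1 k2 (X q) (\<lambda>cu cl us ls. Sdec k1 k2 (X q) (T q) cu cl us ls + \<epsilon> * (q $ None - p $ None) * dec k1 k2 \<tau> cu cl us ls)
      = Act k1 k2 (Mx (- X q)) (Mx (X q)) (\<lambda>us ls. ?A us ls + \<epsilon> * (q $ None - p $ None) * \<tau> us ls)"
      by (simp add: Sinv_dec)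
    also have "\<dots> = Tf \<epsilon> q"
      by (intro ext) (simp add: Act_add Act_scale Act_Mx_inverse(2)[OF T_tenvals] Tf_def R_def mult.assoc)
    finally show ?thesis .
  qed
  \<comment> \<open>The shift varies with q, and with it R. Differentiability justifies the product
    rule, in which the derivative of R is then multiplied by t - t_p = 0.\<close>
  have Rdiff: "(\<lambda>q. R q us ls) differentiable (at p)" for us ls
  proof (cases "length us = k1 \<and> length ls = k2")
    case True
    have "((\<lambda>q. (- X q) $ k) has_derivative (\<lambda>h. - frechet_derivative (\<lambda>q. X q $ k) (at p) h)) (at p)" for k
      using has_derivative_minus[OF has_derivative_frechet[OF shift_diff[OF p dec]]] by simp
    from Act_Mx_has_derivative[OF this, of "\<lambda>_. \<tau>" "\<lambda>_ _ _. 0" us k1 ls k2] True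
    show ?thesis unfolding R_def differentiable_def by auto
  next
    case False
    then have "(\<lambda>q. R q us ls) = (\<lambda>q. 0)" by (auto simp: R_def Act_def)
    then show ?thesis by simp
  qed
  have dTf: "dT (Tf \<epsilon>) p a us ls = dT T p a us ls + \<epsilon> * ((if a = None then 1 else 0) * R p us ls)" for \<epsilon> a us ls
  proof -
    have "((\<lambda>q. T q us ls + \<epsilon> * ((q $ None - p $ None) * R q us ls)) has_derivative
      (\<lambda>h. frechet_derivative (\<lambda>q. T q us ls) (at p) h + \<epsilon> * ((p $ None - p $ None) * frechet_derivative (\<lambda>q. R q us ls) (at p) h
          + (h $ None - 0) * R p us ls))) (at p)"
      by (intro has_derivative_add has_derivative_mult_right has_derivative_mult has_derivative_diff has_derivative_const
          has_derivative_frechet T_diff p Rdiff bounded_linear_imp_has_derivative[OF bounded_linear_vec_nth])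
    from pdir_eqI[OF this, of "axis a 1"] show ?thesis
      by (auto simp: dT_def pd_def Tf_def pdir_def axis_def)
  qed
  have Tfp: "Tf \<epsilon> p = T p" for \<epsilon> by (simp add: Tf_def fun_eq_iff)
  have "((\<lambda>\<epsilon>. L p (T p) (dT (Tf \<epsilon>) p) (g p)) has_field_derivative
      tpair k1 k2 (\<lambda>us ls. EL p (JT us ls)) (\<lambda>_ _. 0)
      + (\<Sum>a\<in>UNIV. tpair k1 k2 (\<lambda>us ls. EL p (JD a us ls)) (\<lambda>us ls. (if a = None then 1 else 0) * R p us ls))
      + (\<Sum>c\<in>UNIV. \<Sum>d\<in>UNIV. EL p (JG c d) * 0)) (at 0)"
  proof (rule lagrangian_chain[OF lagr open_M p])
    show "EL p = Lpart k1 k2 L p (T p) (dT (Tf 0) p) (g p)"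
    proof -
      have "dT (Tf 0) p = dT T p" by (simp add: dTf fun_eq_iff)
      then show ?thesis by (simp add: EL_def)
    qed
    show "dT (Tf s) p a \<in> tenvals k1 k2" for s a
      by (rule dT_tenvals) (use T_tenvals Rten in \<open>auto simp: Tf_def tenvals_def\<close>)
    show "((\<lambda>s. dT (Tf s) p a us ls) has_field_derivative (if a = None then 1 else 0) * R p us ls) (at 0)" for a us ls
      unfolding dTf by (auto intro!: derivative_eq_intros)
  qed (simp_all add: T_tenvals lorentzian p riem g_sym[OF p])
  then have "((\<lambda>\<epsilon>. L p (T p) (dT (Tf \<epsilon>) p) (g p)) has_field_derivative flux p None (R p)) (at 0)"
    unfolding tpair_zero tpair_scale by (simp add: flux_def if_distrib[of "\<lambda>x. x * _"] cong: if_cong)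
  then show ?thesis
    unfolding PiB_def LSig_def Sinv Let_def gH Tfp R_def by (rule DERIV_imp_deriv)
qed

end

subsection \<open>The slice identity\<close>

lemma lact_vjac:
  fixes Y :: "real ^ 'n::finite \<Rightarrow> real ^ 'n"
  shows "lact (vjac Y x) \<tau> us ls = (\<Sum>i\<in>UNIV. \<Sum>c\<in>UNIV. spd c (\<lambda>y. Y y $ i) x * lact (el (Some i) (Some c)) \<tau> us ls)"
proof -
  have v: "vjac Y x a b = (\<Sum>i\<in>UNIV. \<Sum>c\<in>UNIV. spd c (\<lambda>y. Y y $ i) x * el (Some i) (Some c) a b)" for a b
  proof (cases a; cases b)
    fix j e assume ab: "a = Some j" "b = Some e"
    have "(\<Sum>i\<in>UNIV. \<Sum>c\<in>UNIV. spd c (\<lambda>y. Y y $ i) x * el (Some i) (Some c) a b)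
      = (\<Sum>i\<in>UNIV. \<Sum>c\<in>UNIV. if c = e then (if i = j then spd c (\<lambda>y. Y y $ i) x else 0) else 0)"
      by (intro sum.cong refl) (auto simp: el_def ab)
    then show ?thesis by (simp add: vjac_def ab)
  qed (auto simp: vjac_def el_def)
  have "lact (vjac Y x) \<tau> us ls = dact (\<lambda>a b. \<Sum>i\<in>UNIV. \<Sum>c\<in>UNIV. spd c (\<lambda>y. Y y $ i) x * - el (Some i) (Some c) a b)
      (\<lambda>a b. \<Sum>i\<in>UNIV. \<Sum>c\<in>UNIV. spd c (\<lambda>y. Y y $ i) x * el (Some i) (Some c) a b) \<tau> us ls"
    by (simp add: v[abs_def] sum_negf)
  then show ?thesis by (simp only: dact_sum dact_scale)
qed

lemma mk_has_derivative: "((\<lambda>y. mk y t) has_derivative (\<lambda>h. mk h 0)) (at x)"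
proof -
  have "((\<lambda>y. (\<lambda>(t, x). mk x t) (t, y)) has_derivative (\<lambda>h. (\<lambda>(t, x). mk x t) (0, h))) (at x)"
    by (rule bounded_linear.has_derivative[OF bounded_linear_mk]) (auto intro!: derivative_eq_intros)
  then show ?thesis by simp
qed

lemma spd_mk:
  fixes f :: "('n::finite) pt \<Rightarrow> real"
  assumes "f differentiable (at (mk x t))"
  shows "(\<lambda>y. f (mk y t)) differentiable (at x)" "spd c (\<lambda>y. f (mk y t)) x = pd (Some c) f (mk x t)"
proof -
  have d: "((\<lambda>y. f (mk y t)) has_derivative (\<lambda>h. frechet_derivative f (at (mk x t)) (mk h 0))) (at x)"
    by (rule has_derivative_compose[OF mk_has_derivative has_derivative_frechet[OF assms]])
  then show "(\<lambda>y. f (mk y t)) differentiable (at x)" by (auto simp: differentiable_def)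
  have "mk (axis c 1) 0 $ a = axis (Some c) 1 $ a" for a by (cases a) (auto simp: axis_def)
  then have "mk (axis c 1) 0 = axis (Some c) (1::real)" by (simp add: vec_eq_iff)
  then show "spd c (\<lambda>y. f (mk y t)) x = pd (Some c) f (mk x t)"
    using pdir_eqI[OF d, of "axis c 1"] by (simp add: spd_def pd_def pdir_def)
qed

context matter
begin

text \<open>This is \<pi>(L_Y T) for Y extended independently of time, expanded by linearity of
  \<pi>.\<close>

definition lie_flux :: "(real ^ 'n \<Rightarrow> real ^ 'n) \<Rightarrow> 'n pt \<Rightarrow> real" where
  "lie_flux Y p = (\<Sum>i\<in>UNIV. Y (sp p) $ i * flux p None (dT T p (Some i)))
    + (\<Sum>i\<in>UNIV. \<Sum>c\<in>UNIV. spd c (\<lambda>y. Y y $ i) (sp p) * flux p None (lact (el (Some i) (Some c)) (T p)))"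

lemma PiB_dLie:
  assumes p: "mk x t \<in> M" and dec: "decomp M g h N X"
  shows "PiB k1 k2 L h N X (\<lambda>q. Sdec k1 k2 (X q) (T q)) (mk x t)
      (dLie Y (\<lambda>y. Sdec k1 k2 (X (mk y t)) (T (mk y t))) x) = lie_flux Y (mk x t)"
proof -
  define \<tau> where "\<tau> y = T (mk y t)" for y
  define Z where "Z y = X (mk y t)" for y
  define \<tau>' where "\<tau>' y = Act k1 k2 (Mx (Z y)) (Mx (- Z y)) (\<tau> y)" for y
  define \<sigma> where "\<sigma> us ls = (\<Sum>c\<in>UNIV. Y x $ c * spd c (\<lambda>y. \<tau>' y us ls) x) + lact (vjac Y x) (\<tau>' x) us ls" for us ls
  have \<tau>'ten: "\<tau>' y \<in> tenvals k1 k2" for y by (simp add: \<tau>'_def Act_in_tenvals)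
  have "dLie Y (\<lambda>y. Sdec k1 k2 (X (mk y t)) (T (mk y t))) x = dLie Y (\<lambda>y. dec k1 k2 (\<tau>' y)) x"
    by (simp add: Sdec_eq \<tau>'_def Z_def \<tau>_def)
  also have "\<dots> = dec k1 k2 \<sigma>"
    unfolding dLie_dec[OF \<tau>'ten] \<sigma>_def ..
  finally have d: "dLie Y (\<lambda>y. Sdec k1 k2 (X (mk y t)) (T (mk y t))) x = dec k1 k2 \<sigma>" .
  have \<sigma>ten: "\<sigma> \<in> tenvals k1 k2"
    unfolding tenvals_def
  proof (intro CollectI allI impI)
    fix us ls :: "'n option list" assume *: "\<not> (length us = k1 \<and> length ls = k2)"
    then have "\<tau>' y us ls = 0" for y using \<tau>'ten[of y] by (auto simp: tenvals_def)
    moreover have "lact (vjac Y x) (\<tau>' x) us ls = 0"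
      using dact_in_tenvals[OF \<tau>'ten[of x], of "\<lambda>a b. - vjac Y x a b" "vjac Y x"] * by (auto simp: tenvals_def)
    ultimately show "\<sigma> us ls = 0" by (simp add: \<sigma>_def spd_const)
  qed
  have \<tau>d: "(\<lambda>y. \<tau> y us ls) differentiable (at x)" "spd c (\<lambda>y. \<tau> y us ls) x = dT T (mk x t) (Some c) us ls" for us ls c
    unfolding \<tau>_def dT_def using spd_mk[of "\<lambda>q. T q us ls" x t] T_diff[OF p] by auto
  have Zd: "(\<lambda>y. Z y $ j) differentiable (at x)" for j
    unfolding Z_def by (rule spd_mk(1)[OF shift_diff[OF p dec]])
  have \<tau>ten: "\<tau> y \<in> tenvals k1 k2" for y by (simp add: \<tau>_def T_tenvals)
  obtain v where v: "Act k1 k2 (Mx (- Z x)) (Mx (Z x)) \<sigma> =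
     (\<lambda>us ls. (\<Sum>c\<in>UNIV. Y x $ c * spd c (\<lambda>y. \<tau> y us ls) x) + lact (vjac Y x) (\<tau> x) us ls
        + (\<Sum>j\<in>UNIV. v j * lact (el (Some j) None) (\<tau> x) us ls))"
    using Act_Lie[where \<tau> = \<tau> and Z = Z and x = x and Y = Y, OF \<tau>ten \<tau>d(1) Zd]
    unfolding \<tau>'_def[symmetric] \<sigma>_def[abs_def] by blast
  have "flux (mk x t) None (Act k1 k2 (Mx (- X (mk x t))) (Mx (X (mk x t))) \<sigma>) =
     flux (mk x t) None (\<lambda>us ls. ((\<Sum>c\<in>UNIV. Y x $ c * dT T (mk x t) (Some c) us ls)
        + (\<Sum>i\<in>UNIV. \<Sum>c\<in>UNIV. spd c (\<lambda>y. Y y $ i) x * lact (el (Some i) (Some c)) (T (mk x t)) us ls))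
        + (\<Sum>j\<in>UNIV. v j * lact (el (Some j) None) (T (mk x t)) us ls))"
    using v by (simp only: Z_def[symmetric] \<tau>d(2) lact_vjac) (simp only: \<tau>_def)
  also have "\<dots> = lie_flux Y (mk x t) + (\<Sum>j\<in>UNIV. v j * flux (mk x t) None (lact (el (Some j) None) (T (mk x t))))"
    unfolding flux_def tpair_add tpair_sum tpair_scale by (simp add: lie_flux_def flux_def)
  also have "\<dots> = lie_flux Y (mk x t)" by (simp add: flux_gauge[OF p])
  finally show ?thesis unfolding d PiB_dec[OF p dec \<sigma>ten] .
qed

end

locale matter_slab = matter "Mset S I" ori k1 k2 L g T
  for S :: "(real ^ 'n::finite) set" and I ori k1 k2 and L :: "'n lagr" and g T +
  fixes Y :: "real ^ 'n \<Rightarrow> real ^ 'n" and K :: "(real ^ 'n) set"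
  assumes open_S: "open S" and open_I: "open I"
    and stat: "stationary (Mset S I) ori k1 k2 L g T"
    and Y: "\<And>i. Csmooth_on S (\<lambda>x. Y x $ i)"
    and K: "compact K" "K \<subseteq> S" "\<And>x. x \<in> S - K \<Longrightarrow> Y x = 0"
begin

lemma spd_Y_zero: "x \<in> S - K \<Longrightarrow> spd c (\<lambda>y. Y y $ i) x = 0"
proof -
  assume x: "x \<in> S - K"
  have "pdir (axis c 1) (\<lambda>y. Y y $ i) x = pdir (axis c 1) (\<lambda>y. 0) x"
    by (rule pdir_cong_open[of "S - K"])
      (use x K open_S in \<open>auto intro: open_Diff compact_imp_closed\<close>)
  then show ?thesis by (simp add: spd_def pdir_const)
qed

lemma Y_lift_smooth: "Csmooth_on (Mset S I) (\<lambda>p. Y (sp p) $ i)"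
  by (rule Csmooth_on_comp_linear[OF open_M open_S Y bounded_linear_sp]) (simp add: Mset_iff)

lemma spd_Y_smooth: "Csmooth_on (Mset S I) (\<lambda>p. spd c (\<lambda>y. Y y $ i) (sp p))"
  unfolding spd_def
  by (rule Csmooth_on_comp_linear[OF open_M open_S Csmooth_on_pdir[OF Y] bounded_linear_sp])
    (simp_all add: Mset_iff)

lemma ori_continuous: "continuous_on (Mset S I) ori"
  using ori by (simp add: orientation_def)

lemma lie_flux_continuous: "continuous_on (Mset S I) (lie_flux Y)"
  unfolding lie_flux_def
proof (intro continuous_on_add continuous_on_sum continuous_on_mult flux_continuous
    Csmooth_on_continuous[OF Y_lift_smooth open_M] Csmooth_on_continuous[OF spd_Y_smooth open_M])
  show "continuous_on (Mset S I) (\<lambda>p. dT T p (Some i) us ls)" for i us ls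
    unfolding dT_def pd_def
    by (rule Csmooth_on_continuous[OF Csmooth_on_pdir[OF T_smooth] open_M]) simp
  show "continuous_on (Mset S I) (\<lambda>p. lact (el (Some i) (Some c)) (T p) us ls)" for i c us ls
    by (rule Csmooth_on_continuous[OF Csmooth_dact open_M])
qed

lemma mom_Y_continuous: "continuous_on (Mset S I) (\<lambda>p. \<Sum>i\<in>UNIV. Y (sp p) $ i * mom p i)"
  by (intro continuous_on_sum continuous_on_mult mom_continuous Csmooth_on_continuous[OF Y_lift_smooth open_M])

text \<open>Stationarity with W the bump times Y. The bump depends on time alone, so its spatial
  derivatives vanish, and it can be pulled out of the integrand once its time derivative has been
  removed.\<close>

lemma bump_integral_zero:
  assumes r: "{c - r..c + r} \<subseteq> I"
  shows "integral (Mset S I) (\<lambda>p. bump c r (p $ None) *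
     (ori p * (lie_flux Y p + (\<Sum>i\<in>UNIV. Y (sp p) $ i * mom p i)))) = 0"
proof -
  define \<beta> where "\<beta> p = bump c r (p $ None)" for p :: "'n pt"
  define W where "W p i = \<beta> p * Y (sp p) $ i" for p i
  have \<beta>_smooth: "Csmooth_on (Mset S I) \<beta>"
    unfolding \<beta>_def
    by (intro Csmooth_on_comp_real[OF open_M Csmooth_bump] Csmooth_on_bounded_linear[OF open_M] bounded_linear_vec_nth)
  have W_smooth: "Csmooth_on (Mset S I) (\<lambda>p. W p i)" for i
    unfolding W_def by (intro Csmooth_on_mult open_M \<beta>_smooth Y_lift_smooth)
  \<comment> \<open>The closed interval contains the support of the bump, and its product with K is
    compact in M, as stationarity requires.\<close>
  define K' where "K' = (\<lambda>(t, x). mk x t) ` ({c - r..c + r} \<times> K)"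
  have K': "compact K'" "K' \<subseteq> Mset S I"
    unfolding K'_def using K r
    by (auto intro!: compact_continuous_image continuous_mk compact_Times simp: subset_iff)
  have W0: "W p i = 0" if "p \<in> Mset S I - K'" for p i
  proof -
    have "p $ None \<notin> {c - r..c + r} \<or> sp p \<notin> K"
    proof (rule ccontr)
      assume "\<not> ?thesis"
      then have "mk (sp p) (p $ None) \<in> K'" unfolding K'_def by force
      then show False using that by (simp add: mk_sp)
    qed
    then show ?thesis
    proof
      assume "p $ None \<notin> {c - r..c + r}"
      then have "\<beta> p = 0"
        using bump_nonneg[of c r "p $ None"] bump_pos_iff[of c r "p $ None"] unfolding \<beta>_def by force
      then show ?thesis by (simp add: W_def)
    next
      assume "sp p \<notin> K"
      then show ?thesis using K(3)[of "sp p"] that by (simp add: W_def Mset_iff)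
    qed
  qed
  have "integral (Mset S I) (\<lambda>p. ori p * ((\<Sum>i\<in>UNIV. W p i * (flux p None (dT T p (Some i)) + mom p i))
     + (\<Sum>i\<in>UNIV. \<Sum>a\<in>UNIV. pd a (\<lambda>q. W q i) p * flux p None (lact (el (Some i) a) (T p))))) = 0"
    by (rule stationary_variation[OF stat W_smooth K' W0])
  also have "integral (Mset S I) (\<lambda>p. ori p * ((\<Sum>i\<in>UNIV. W p i * (flux p None (dT T p (Some i)) + mom p i))
     + (\<Sum>i\<in>UNIV. \<Sum>a\<in>UNIV. pd a (\<lambda>q. W q i) p * flux p None (lact (el (Some i) a) (T p)))))
    = integral (Mset S I) (\<lambda>p. \<beta> p * (ori p * (lie_flux Y p + (\<Sum>i\<in>UNIV. Y (sp p) $ i * mom p i))))"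
  proof (rule integral_cong)
    fix p assume p: "p \<in> Mset S I"
    have pd: "pd (Some k) (\<lambda>q. W q i) p = \<beta> p * spd k (\<lambda>y. Y y $ i) (sp p)" for k i
    proof -
      have d: "(\<lambda>q. W q i) differentiable (at (mk (sp p) (p $ None)))"
        unfolding mk_sp by (rule Csmooth_on_differentiable[OF W_smooth open_M p])
      have Yd: "(\<lambda>y. Y y $ i) differentiable (at (sp p))"
        by (rule Csmooth_on_differentiable[OF Y open_S]) (use p in \<open>simp add: Mset_iff\<close>)
      have "pd (Some k) (\<lambda>q. W q i) p = spd k (\<lambda>y. W (mk y (p $ None)) i) (sp p)"
        using spd_mk(2)[OF d, of k] by (simp add: mk_sp)
      also have "\<dots> = spd k (\<lambda>y. \<beta> p * Y y $ i) (sp p)" by (simp add: W_def \<beta>_def)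
      also have "\<dots> = \<beta> p * spd k (\<lambda>y. Y y $ i) (sp p)"
        unfolding spd_def
        using pdir_eqI[OF has_derivative_mult_right[OF has_derivative_frechet[OF Yd]], of "axis k 1" "\<beta> p"]
        by (simp add: pdir_def)
      finally show ?thesis .
    qed
    \<comment> \<open>The summand a = None carries the derivative of the bump; its coefficient
      vanishes by \<open>flux_gauge\<close>.\<close>
    have "(\<Sum>i\<in>UNIV. \<Sum>a\<in>UNIV. pd a (\<lambda>q. W q i) p * flux p None (lact (el (Some i) a) (T p)))
      = \<beta> p * (\<Sum>i\<in>UNIV. \<Sum>k\<in>UNIV. spd k (\<lambda>y. Y y $ i) (sp p) * flux p None (lact (el (Some i) (Some k)) (T p)))"
      unfolding sum_option[of "\<lambda>a. pd a _ p * flux p None (lact (el _ a) (T p))"] flux_gauge[OF p] pd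
      by (simp add: sum_distrib_left mult.assoc)
    moreover have "(\<Sum>i\<in>UNIV. W p i * (flux p None (dT T p (Some i)) + mom p i)) =
        \<beta> p * ((\<Sum>i\<in>UNIV. Y (sp p) $ i * flux p None (dT T p (Some i))) + (\<Sum>i\<in>UNIV. Y (sp p) $ i * mom p i))"
      by (simp add: W_def distrib_left sum.distrib sum_distrib_left mult.assoc)
    ultimately show "ori p * ((\<Sum>i\<in>UNIV. W p i * (flux p None (dT T p (Some i)) + mom p i))
     + (\<Sum>i\<in>UNIV. \<Sum>a\<in>UNIV. pd a (\<lambda>q. W q i) p * flux p None (lact (el (Some i) a) (T p))))
      = \<beta> p * (ori p * (lie_flux Y p + (\<Sum>i\<in>UNIV. Y (sp p) $ i * mom p i)))"
      unfolding lie_flux_def by (simp only:) (simp add: algebra_simps)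
  qed
  finally show ?thesis by (simp add: \<beta>_def)
qed

lemma slice_identity:
  assumes t: "t \<in> I"
  shows "integral S (\<lambda>x. ori (mk x t) * (\<Sum>i\<in>UNIV. Y x $ i * mom (mk x t) i)) =
    - integral S (\<lambda>x. ori (mk x t) * lie_flux Y (mk x t))"
proof -
  define G1 where "G1 p = ori p * lie_flux Y p" for p
  define G2 where "G2 p = ori p * (\<Sum>i\<in>UNIV. Y (sp p) $ i * mom p i)" for p
  have G1: "continuous_on (Mset S I) G1" and G2: "continuous_on (Mset S I) G2"
    unfolding G1_def G2_def by (intro continuous_on_mult ori_continuous lie_flux_continuous mom_Y_continuous)+
  have z1: "G1 p = 0" and z2: "G2 p = 0" if "p \<in> Mset S I" "sp p \<notin> K" for p
  proof -
    have "sp p \<in> S - K" using that by (simp add: Mset_iff)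
    then show "G1 p = 0" "G2 p = 0"
      using K(3)[of "sp p"] spd_Y_zero[of "sp p"] by (simp_all add: G1_def G2_def lie_flux_def)
  qed
  have "integral S (\<lambda>x. G1 (mk x t) + G2 (mk x t)) = 0"
  proof (rule slice_integral_zero[OF open_S open_I t K(1,2), where G = "\<lambda>p. G1 p + G2 p"])
    show "continuous_on (Mset S I) (\<lambda>p. G1 p + G2 p)" by (intro continuous_on_add G1 G2)
    show "G1 p + G2 p = 0" if "p \<in> Mset S I" "sp p \<notin> K" for p using z1[OF that] z2[OF that] by simp
    show "integral (Mset S I) (\<lambda>p. bump t r (p $ None) * (G1 p + G2 p)) = 0" if "{t - r..t + r} \<subseteq> I" for r
      using bump_integral_zero[OF that] by (simp add: G1_def G2_def distrib_left)
  qed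
  moreover have "(\<lambda>x. G (mk x t)) integrable_on S"
    if "continuous_on (Mset S I) G" "\<And>p. p \<in> Mset S I \<Longrightarrow> sp p \<notin> K \<Longrightarrow> G p = 0" for G :: "'n pt \<Rightarrow> real"
  proof (rule integrable_on_compact_support[OF _ K(1,2)])
    have "continuous_on S (\<lambda>x. mk x t :: 'n pt)"
      using has_derivative_continuous[OF mk_has_derivative] by (intro continuous_at_imp_continuous_on) blast
    then show "continuous_on S (\<lambda>x. G (mk x t))"
      by (rule continuous_on_compose2[OF that(1)]) (use t in auto)
    show "G (mk x t) = 0" if "x \<in> S - K" for x
      using \<open>\<And>p. p \<in> Mset S I \<Longrightarrow> sp p \<notin> K \<Longrightarrow> G p = 0\<close>[of "mk x t"] that t by simp
  qed
  then have "(\<lambda>x. G1 (mk x t)) integrable_on S" "(\<lambda>x. G2 (mk x t)) integrable_on S"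
    using G1 G2 z1 z2 by blast+
  ultimately have "integral S (\<lambda>x. G1 (mk x t)) + integral S (\<lambda>x. G2 (mk x t)) = 0"
    by (simp add: integral_add)
  then show ?thesis by (simp add: G1_def G2_def)
qed

end

theorem theorem5p4:
  fixes S :: "(real ^ 'n) set" and I :: "real set" and ori :: "'n pt \<Rightarrow> real"
    and k1 k2 :: nat and L :: "'n lagr"
    and g :: "'n pt \<Rightarrow> 'n option \<Rightarrow> 'n option \<Rightarrow> real"
    and h :: "'n pt \<Rightarrow> 'n \<Rightarrow> 'n \<Rightarrow> real" and N :: "'n pt \<Rightarrow> real" and X :: "'n pt \<Rightarrow> real ^ 'n"
    and T :: "'n pt \<Rightarrow> 'n ten" and t :: real and \<delta>X :: "real ^ 'n \<Rightarrow> real ^ 'n"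
  assumes "open S" and "open I" and "is_interval I" and "I \<noteq> {}"
    and "orientation (Mset S I) ori"
    and "lagrangian (Mset S I) k1 k2 L"
    and "diffeo_invariant (Mset S I) ori k1 k2 L"
    and "slice_compatible (Mset S I) g"
    and "decomp (Mset S I) g h N X"
    and "tfield k1 k2 (Mset S I) T"
    and "stationary (Mset S I) ori k1 k2 L g T"
    and "t \<in> I"
    and "\<forall>i. Csmooth_on S (\<lambda>x. \<delta>X x $ i)"
    and "\<exists>K. compact K \<and> K \<subseteq> S \<and> (\<forall>x\<in>S - K. \<delta>X x = 0)"
  shows "intSlice S t ori (\<lambda>x. Jmom L ori g T (mk x t) (\<delta>X x) * dVh ori g N (mk x t))
       = - (1/2) * intSlice S t ori (\<lambda>x. PiB k1 k2 L h N X (\<lambda>q. Sdec k1 k2 (X q) (T q)) (mk x t)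
              (dLie \<delta>X (\<lambda>y. Sdec k1 k2 (X (mk y t)) (T (mk y t))) x))"
proof -
  obtain K where K: "compact K" "K \<subseteq> S" "\<forall>x\<in>S - K. \<delta>X x = 0" using assms(14) by blast
  interpret matter_slab S I ori k1 k2 L g T \<delta>X K
    by unfold_locales (use assms K in \<open>auto intro: open_Mset\<close>)
  have m: "mk x t \<in> Mset S I" if "x \<in> S" for x using that assms(12) by simp
  have "intSlice S t ori (\<lambda>x. Jmom L ori g T (mk x t) (\<delta>X x) * dVh ori g N (mk x t)) =
      integral S (\<lambda>x. (ori (mk x t) * (\<Sum>i\<in>UNIV. \<delta>X x $ i * mom (mk x t) i)) * (1/2))"
    unfolding intSlice_def by (rule integral_cong) (simp add: Jmom_eq[OF m assms(9)])
  also have "\<dots> = - (1/2) * integral S (\<lambda>x. ori (mk x t) * lie_flux \<delta>X (mk x t))"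
    unfolding integral_mult_left slice_identity[OF assms(12)] by simp
  also have "integral S (\<lambda>x. ori (mk x t) * lie_flux \<delta>X (mk x t)) =
      intSlice S t ori (\<lambda>x. PiB k1 k2 L h N X (\<lambda>q. Sdec k1 k2 (X q) (T q)) (mk x t)
              (dLie \<delta>X (\<lambda>y. Sdec k1 k2 (X (mk y t)) (T (mk y t))) x))"
    unfolding intSlice_def by (rule integral_cong) (simp add: PiB_dLie[OF m assms(9)])
  finally show ?thesis .
qed

end
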